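(* Let $T$ be a nontrivial tree of order $n(T)$ with $l(T)$ leaves and $s(T)$ support vertices. Then $$\gamma^{d}_2(T)\leq \frac{n(T)+l(T)+s(T)}{4},$$ with equality if and only if there is a labeling $S$ of $T$ such that $(T,S)\in\mathscr{T}_2$.
   Context: Graphs are finite and simple. For a vertex $v$ of a graph $G$, $N(v)$ is its open neighborhood, $N[v]=N(v)\cup\{v\}$, $d(v)=|N(v)|$. A leaf is a vertex of degree $1$; a support vertex is a vertex adjacent to a leaf. For a tree $T$, $n(T)$, $l(T)$, $s(T)$ denote its order, number of leaves and number of support vertices. A set $D\subseteq V(G)$ is a disjunctive dominating set ($2DD$-set) of $G$ if every vertex $v\notin D$ either has a neighbor in $D$ or has at least two vertices of $D$ at distance exactly $2$ from it. $\gamma^{d}_2(G)$ is the minimum size of a $2DD$-set. Labeled trees: a labeling of a tree $T$ is a partition $S=(S_A,S_B,S_C,S_D)$ of $V(T)$ into four (possibly empty) sets; $\mathrm{sta}(v)$ is the letter $x$ with $v\in S_x$. The family $\mathscr{T}_2$ is built from the starting labeled tree $(P_4,S'')$, where $S''$ gives the two leaves of $P_4$ status $C$ and the two internal vertices status $A$; in any tree built from it, this original $P_4$ is called the basic path. Corresponding vertices: if $v$ is a vertex with $\mathrm{sta}(v)=A$ that is not a support vertex and not on the basic path, a vertex $u$ is a corresponding vertex of $v$ if there is an induced path $vv_1v_2u$ with $\mathrm{sta}(v_1)=C$, $\mathrm{sta}(v_2)=D$, $\mathrm{sta}(u)=B$; if $\mathrm{sta}(u)=B$, a vertex $v$ is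 a corresponding vertex of $u$ if there is an induced path $vv_1v_2u$ with $\mathrm{sta}(v)=A$, $\mathrm{sta}(v_1)=C$, $\mathrm{sta}(v_2)=D$. Operation $\mathscr{O}_2$: choose $v$ with $\mathrm{sta}(v)=B$ having a corresponding vertex of degree two; add a new path $u_1u_2$ and the edge $u_1v$, with $\mathrm{sta}(u_1)=A$, $\mathrm{sta}(u_2)=C$. Operation $\mathscr{O}_3$: choose $v$ with $\mathrm{sta}(v)=C$ and $d(v)=1$; add a new path $u_1u_2u_3u_4$ and the edge $u_1v$, with $\mathrm{sta}(u_1)=D$, $\mathrm{sta}(u_2)=B$, $\mathrm{sta}(u_3)=A$, $\mathrm{sta}(u_4)=C$. Operation $\mathscr{O}_4$: choose $v$ not on the basic path with $\mathrm{sta}(v)=A$ having a corresponding vertex of degree two; add a new path $u_1u_2$ and the edge $u_1v$, with $\mathrm{sta}(u_1)=A$, $\mathrm{sta}(u_2)=C$. (Existing vertices keep their statuses.) $\mathscr{T}_2$ is the smallest family of labeled trees containing $(P_4,S'')$ and closed under $\mathscr{O}_2$, $\mathscr{O}_3$, $\mathscr{O}_4$. *)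

theory Defs
  imports Main
begin

definition graph :: "'a set \<Rightarrow> ('a \<times> 'a) set \<Rightarrow> bool" where
  "graph V E \<longleftrightarrow> finite V \<and> E \<subseteq> V \<times> V \<and> sym E \<and> (\<forall>v. (v, v) \<notin> E)"

definition nbhd :: "('a \<times> 'a) set \<Rightarrow> 'a \<Rightarrow> 'a set" where
  "nbhd E v = {u. (v, u) \<in> E}"

definition deg :: "('a \<times> 'a) set \<Rightarrow> 'a \<Rightarrow> nat" where
  "deg E v = card (nbhd E v)"

definition walk :: "('a \<times> 'a) set \<Rightarrow> 'a list \<Rightarrow> bool" where
  "walk E xs \<longleftrightarrow> xs \<noteq> [] \<and> (\<forall>i. Suc i < length xs \<longrightarrow> (xs ! i, xs ! Suc i) \<in> E)"

definition connected_graph :: "'a set \<Rightarrow> ('a \<times> 'a) set \<Rightarrow> bool" where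
  "connected_graph V E \<longleftrightarrow>
     (\<forall>u\<in>V. \<forall>v\<in>V. \<exists>xs. walk E xs \<and> hd xs = u \<and> last xs = v)"

definition has_cycle :: "('a \<times> 'a) set \<Rightarrow> bool" where
  "has_cycle E \<longleftrightarrow> (\<exists>xs. length xs \<ge> 3 \<and> distinct xs \<and> walk E xs \<and> (last xs, hd xs) \<in> E)"

definition tree :: "'a set \<Rightarrow> ('a \<times> 'a) set \<Rightarrow> bool" where
  "tree V E \<longleftrightarrow> graph V E \<and> V \<noteq> {} \<and> connected_graph V E \<and> \<not> has_cycle E"

definition gdist :: "('a \<times> 'a) set \<Rightarrow> 'a \<Rightarrow> 'a \<Rightarrow> nat" where
  "gdist E u v = (LEAST k. \<exists>xs. walk E xs \<and> hd xs = u \<and> last xs = v \<and> length xs = Suc k)"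

definition leaf :: "('a \<times> 'a) set \<Rightarrow> 'a \<Rightarrow> bool" where
  "leaf E v \<longleftrightarrow> deg E v = 1"

definition support :: "('a \<times> 'a) set \<Rightarrow> 'a \<Rightarrow> bool" where
  "support E v \<longleftrightarrow> (\<exists>u. (v, u) \<in> E \<and> leaf E u)"

definition num_leaves :: "'a set \<Rightarrow> ('a \<times> 'a) set \<Rightarrow> nat" where
  "num_leaves V E = card {v\<in>V. leaf E v}"

definition num_support :: "'a set \<Rightarrow> ('a \<times> 'a) set \<Rightarrow> nat" where
  "num_support V E = card {v\<in>V. support E v}"

definition is_2DD :: "'a set \<Rightarrow> ('a \<times> 'a) set \<Rightarrow> 'a set \<Rightarrow> bool" where
  "is_2DD V E D \<longleftrightarrow> D \<subseteq> V \<and>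
     (\<forall>v\<in>V - D. (\<exists>u\<in>D. (v, u) \<in> E) \<or> card {u\<in>D. gdist E v u = 2} \<ge> 2)"

definition gamma_2d :: "'a set \<Rightarrow> ('a \<times> 'a) set \<Rightarrow> nat" where
  "gamma_2d V E = Min (card ` {D. is_2DD V E D})"

datatype status = SA | SB | SC | SD

definition induced_P4 :: "'a set \<Rightarrow> ('a \<times> 'a) set \<Rightarrow> 'a \<Rightarrow> 'a \<Rightarrow> 'a \<Rightarrow> 'a \<Rightarrow> bool" where
  "induced_P4 V E a b c d \<longleftrightarrow> {a, b, c, d} \<subseteq> V \<and> distinct [a, b, c, d] \<and>
     (a, b) \<in> E \<and> (b, c) \<in> E \<and> (c, d) \<in> E \<and>
     (a, c) \<notin> E \<and> (a, d) \<notin> E \<and> (b, d) \<notin> E"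

definition corr_of_A ::
  "'a set \<Rightarrow> ('a \<times> 'a) set \<Rightarrow> ('a \<Rightarrow> status) \<Rightarrow> 'a set \<Rightarrow> 'a \<Rightarrow> 'a \<Rightarrow> bool" where
  "corr_of_A V E S P v u \<longleftrightarrow> S v = SA \<and> \<not> support E v \<and> v \<notin> P \<and>
     (\<exists>v1 v2. induced_P4 V E v v1 v2 u \<and> S v1 = SC \<and> S v2 = SD \<and> S u = SB)"

definition corr_of_B ::
  "'a set \<Rightarrow> ('a \<times> 'a) set \<Rightarrow> ('a \<Rightarrow> status) \<Rightarrow> 'a \<Rightarrow> 'a \<Rightarrow> bool" where
  "corr_of_B V E S u v \<longleftrightarrow> S u = SB \<and>
     (\<exists>v1 v2. induced_P4 V E v v1 v2 u \<and> S v = SA \<and> S v1 = SC \<and> S v2 = SD)"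

definition sym_edges :: "('a \<times> 'a) set \<Rightarrow> ('a \<times> 'a) set" where
  "sym_edges F = F \<union> F\<inverse>"

(* The family T_2: labeled trees (V, E, S) together with the vertex set P of the
   basic path.  New vertices are fresh elements of the vertex type. *)
inductive T2 :: "'a set \<Rightarrow> ('a \<times> 'a) set \<Rightarrow> ('a \<Rightarrow> status) \<Rightarrow> 'a set \<Rightarrow> bool" where
  start: "\<lbrakk> distinct [a, b, c, d]; S a = SC; S b = SA; S c = SA; S d = SC \<rbrakk> \<Longrightarrow>
     T2 {a, b, c, d} (sym_edges {(a, b), (b, c), (c, d)}) S {a, b, c, d}"
| op2: "\<lbrakk> T2 V E S P; v \<in> V; S v = SB; \<exists>w. corr_of_B V E S v w \<and> deg E w = 2;
          u1 \<notin> V; u2 \<notin> V; u1 \<noteq> u2 \<rbrakk> \<Longrightarrow>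
     T2 (V \<union> {u1, u2}) (E \<union> sym_edges {(u1, v), (u1, u2)}) (S(u1 := SA, u2 := SC)) P"
| op3: "\<lbrakk> T2 V E S P; v \<in> V; S v = SC; deg E v = 1;
          u1 \<notin> V; u2 \<notin> V; u3 \<notin> V; u4 \<notin> V; distinct [u1, u2, u3, u4] \<rbrakk> \<Longrightarrow>
     T2 (V \<union> {u1, u2, u3, u4})
        (E \<union> sym_edges {(u1, v), (u1, u2), (u2, u3), (u3, u4)})
        (S(u1 := SD, u2 := SB, u3 := SA, u4 := SC)) P"
| op4: "\<lbrakk> T2 V E S P; v \<in> V; v \<notin> P; S v = SA; \<exists>w. corr_of_A V E S P v w \<and> deg E w = 2;
          u1 \<notin> V; u2 \<notin> V; u1 \<noteq> u2 \<rbrakk> \<Longrightarrow>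
     T2 (V \<union> {u1, u2}) (E \<union> sym_edges {(u1, v), (u1, u2)}) (S(u1 := SA, u2 := SC)) P"

end

(* Upper bound: put all support vertices into D. The remaining vertices I that are neither leaves nor
   support vertices induce a forest whose vertices of degree at most one are adjacent to D. Peeling off the
   subtree below the third ancestor of a deepest vertex, and adding that ancestor to D, removes at least
   four vertices per new element of D. Hence gamma <= s + |I| / 4 <= (n + l + s) / 4.

   Equality forces V to be partitioned into gamma blocks: pairs (a leaf with its neighbour) and quads (paths
   on four non-leaves). Root the tree anywhere in a block; choosing in every other block the vertex closest
   to the root dominates everything outside the root block, and also the root block itself if its pair
   has a neighbour of the leaf of degree at least three, or its quad has an inner vertex or both ends of
   degree at least three. So in the case of equality every block has an end of degree two. Hence some
   edge joins two such ends of different blocks; it is the middle edge of the basic path, and the tree grows from it by the operations O2, O3, O4, each quad being labelled A, C, D, B away from it.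

   Conversely, every 2DD-set of a labelled tree in T_2 has at least as many elements as there are vertices
   of status A. The induction needs a stronger statement, in which the closed neighbourhoods of vertices that
   can still be extended by O2 or O4 are exempt from domination. *)

theory Submission
  imports Defs
begin

section \<open>Domination\<close>

text \<open>The four in the bound balances two kinds of blocks: if l = s, a pair contributes 2 + 1 +
  1 to n + l + s, a quad contributes 4, and each costs one vertex. The degree-two requirement in the
  operations O2 and O4 is where both directions meet. In the upper bound, a quad whose two ends both
  branch lets one block be saved. In the lower bound, deleting a pair added by O2 or O4 can leave
  the closed neighbourhood of its old neighbour undominated, so a plain induction on the number of
  vertices of status A breaks down; this is why such neighbourhoods are exempted. The ends A and B
  of a quad must not both be exempt: when O3 is undone, one element of the dominating set has to be
  given up, and the end A is no longer exempt in the smaller tree. It can be covered there only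
  because the vertex of status D, not excused through the end B, has forced a further element
  nearby, which is moved to A.\<close>

definition dominated :: "('a \<times> 'a) set \<Rightarrow> 'a set \<Rightarrow> 'a \<Rightarrow> bool" where
  "dominated E D v \<longleftrightarrow> v \<in> D \<or> (\<exists>u\<in>D. (v, u) \<in> E) \<or>
     (\<exists>u\<in>D. \<exists>w\<in>D. u \<noteq> w \<and> (\<exists>z. (v, z) \<in> E \<and> (z, u) \<in> E) \<and> (\<exists>z. (v, z) \<in> E \<and> (z, w) \<in> E))"

lemma dominated_self: "v \<in> D \<Longrightarrow> dominated E D v"
  by (simp add: dominated_def)

lemma dominated_nbr: "u \<in> D \<Longrightarrow> (v, u) \<in> E \<Longrightarrow> dominated E D v"
  by (auto simp: dominated_def)

lemma dominated_two:
  "u \<in> D \<Longrightarrow> w \<in> D \<Longrightarrow> u \<noteq> w \<Longrightarrow> (v, y) \<in> E \<Longrightarrow> (y, u) \<in> E \<Longrightarrow> (v, z) \<in> E \<Longrightarrow> (z, w) \<in> E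
    \<Longrightarrow> dominated E D v"
  by (auto simp: dominated_def)

lemma dominated_mono: "dominated E D v \<Longrightarrow> D \<subseteq> D' \<Longrightarrow> dominated E D' v"
  unfolding dominated_def by blast

lemma walk_iff_successively: "walk E xs \<longleftrightarrow> xs \<noteq> [] \<and> successively (\<lambda>x y. (x, y) \<in> E) xs"
  by (auto simp: walk_def successively_conv_nth)

lemma walk_simps [simp]:
  "\<not> walk E []" "walk E [x]" "walk E (x # y # xs) \<longleftrightarrow> (x, y) \<in> E \<and> walk E (y # xs)"
  by (auto simp: walk_iff_successively)

lemma walk_in_rtrancl: "walk E xs \<Longrightarrow> (hd xs, last xs) \<in> E\<^sup>*"
proof (induction xs)
  case (Cons x xs)
  then show ?case
    by (cases xs) (auto intro: converse_rtrancl_into_rtrancl)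
qed (simp add: walk_def)

text \<open>The walk is assumed because \<open>gdist\<close> is an unspecified \<open>LEAST\<close>
  for vertices in different components; once a walk exists, \<open>LeastI\<close> yields one of
  minimal length.\<close>

lemma gdist_eq_2_D:
  assumes "walk E xs" "hd xs = v" "last xs = u" "gdist E v u = 2"
  shows "\<exists>z. (v, z) \<in> E \<and> (z, u) \<in> E"
proof -
  let ?P = "\<lambda>k. \<exists>xs. walk E xs \<and> hd xs = v \<and> last xs = u \<and> length xs = Suc k"
  have "?P (length xs - 1)"
    using assms by (intro exI[of _ xs]) (auto simp: walk_def)
  then have "?P (gdist E v u)"
    unfolding gdist_def by (rule LeastI)
  then obtain ys where "walk E ys" "hd ys = v" "last ys = u" "length ys = 3"
    using assms by (auto simp: numeral_3_eq_3)
  then show ?thesis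
    by (auto simp: numeral_3_eq_3 length_Suc_conv)
qed

lemma gdist_eq_2_I:
  assumes "(v, z) \<in> E" "(z, u) \<in> E" "v \<noteq> u" "(v, u) \<notin> E"
  shows "gdist E v u = 2"
  unfolding gdist_def
proof (rule Least_equality)
  show "\<exists>xs. walk E xs \<and> hd xs = v \<and> last xs = u \<and> length xs = Suc 2"
    using assms by (intro exI[of _ "[v, z, u]"]) auto
next
  fix k assume "\<exists>xs. walk E xs \<and> hd xs = v \<and> last xs = u \<and> length xs = Suc k"
  then obtain xs where xs: "walk E xs" "hd xs = v" "last xs = u" "length xs = Suc k" by blast
  show "2 \<le> k"
  proof (rule ccontr)
    assume "\<not> 2 \<le> k"
    then have "k = 0 \<or> k = 1" by auto
    then show False
      using xs assms by (auto simp: length_Suc_conv)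
  qed
qed

text \<open>\<open>dominated\<close> replaces distance two by walks of two edges, which makes it
  local and monotone in \<open>D\<close>. Such a walk from \<open>v\<close> may also end at
  \<open>v\<close> or at a neighbour of \<open>v\<close>, but if that end lies in \<open>D\<close>,
  another disjunct already holds.\<close>

lemma is_2DD_iff:
  assumes "finite V" "connected_graph V E"
  shows "is_2DD V E D \<longleftrightarrow> D \<subseteq> V \<and> (\<forall>v\<in>V. dominated E D v)"
proof -
  have "(\<exists>u\<in>D. (v, u) \<in> E) \<or> card {u\<in>D. gdist E v u = 2} \<ge> 2 \<longleftrightarrow> dominated E D v"
    if D: "D \<subseteq> V" and v: "v \<in> V" "v \<notin> D" for v
  proof
    assume "(\<exists>u\<in>D. (v, u) \<in> E) \<or> card {u\<in>D. gdist E v u = 2} \<ge> 2"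
    then show "dominated E D v"
    proof
      assume "card {u\<in>D. gdist E v u = 2} \<ge> 2"
      then obtain u w where uw: "u \<in> D" "w \<in> D" "u \<noteq> w" "gdist E v u = 2" "gdist E v w = 2"
        by (auto simp: numeral_2_eq_2 card_le_Suc_iff)
      moreover obtain xs ys where "walk E xs" "hd xs = v" "last xs = u" "walk E ys" "hd ys = v" "last ys = w"
        using assms(2) D v uw unfolding connected_graph_def by (meson subsetD)
      ultimately have "\<exists>z. (v, z) \<in> E \<and> (z, u) \<in> E" "\<exists>z. (v, z) \<in> E \<and> (z, w) \<in> E"
        using uw gdist_eq_2_D[of E xs v u] gdist_eq_2_D[of E ys v w] by simp_all
      then show ?thesis
        unfolding dominated_def using uw by blast
    qed (auto simp: dominated_def)
  next
    assume *: "dominated E D v"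
    show "(\<exists>u\<in>D. (v, u) \<in> E) \<or> card {u\<in>D. gdist E v u = 2} \<ge> 2"
    proof (rule disjCI)
      assume "\<not> card {u\<in>D. gdist E v u = 2} \<ge> 2"
      have fin: "finite {u\<in>D. gdist E v u = 2}"
        using D assms(1) finite_subset by fastforce
      show "\<exists>u\<in>D. (v, u) \<in> E"
      proof (rule ccontr)
        assume no: "\<not> ?thesis"
        with * v obtain u w y z where "u \<in> D" "w \<in> D" "u \<noteq> w"
          "(v, y) \<in> E" "(y, u) \<in> E" "(v, z) \<in> E" "(z, w) \<in> E"
          unfolding dominated_def by blast
        moreover from this have "gdist E v u = 2" "gdist E v w = 2"
          using no v gdist_eq_2_I[of v y E u] gdist_eq_2_I[of v z E w] by blast+
        ultimately have "{u, w} \<subseteq> {u\<in>D. gdist E v u = 2}" "card {u, w} = 2"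
          by auto
        with fin have "card {u\<in>D. gdist E v u = 2} \<ge> 2"
          by (metis card_mono)
        with \<open>\<not> card {u\<in>D. gdist E v u = 2} \<ge> 2\<close> show False by simp
      qed
    qed
  qed
  then have "is_2DD V E D \<longleftrightarrow> D \<subseteq> V \<and> (\<forall>v\<in>V - D. dominated E D v)"
    unfolding is_2DD_def by (intro conj_cong ball_cong) simp_all
  then show ?thesis
    using dominated_self[of _ D E] by blast
qed

lemma gamma_2d_le:
  assumes "finite V" "connected_graph V E" "D \<subseteq> V" "\<And>v. v \<in> V \<Longrightarrow> dominated E D v"
  shows "gamma_2d V E \<le> card D"
proof -
  have "{D. is_2DD V E D} \<subseteq> Pow V" by (auto simp: is_2DD_def)
  then have "finite {D. is_2DD V E D}" using assms(1) finite_subset by blast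
  moreover have "is_2DD V E D" using assms is_2DD_iff by blast
  ultimately show ?thesis unfolding gamma_2d_def by (intro Min_le) auto
qed

lemma gamma_2d_attained:
  assumes "finite V" "connected_graph V E"
  obtains D where "D \<subseteq> V" "\<And>v. v \<in> V \<Longrightarrow> dominated E D v" "card D = gamma_2d V E"
proof -
  have "{D. is_2DD V E D} \<subseteq> Pow V" by (auto simp: is_2DD_def)
  then have "finite {D. is_2DD V E D}" using assms(1) finite_subset by blast
  moreover have "is_2DD V E V" by (simp add: is_2DD_def)
  ultimately have "gamma_2d V E \<in> card ` {D. is_2DD V E D}"
    unfolding gamma_2d_def by (intro Min_in) auto
  then show ?thesis using that is_2DD_iff[OF assms] by auto
qed

section \<open>Rooted trees\<close>

lemma rtrancl_distinct_walk:
  assumes "(u, w) \<in> R\<^sup>*"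
  shows "\<exists>xs. distinct xs \<and> walk R xs \<and> hd xs = u \<and> last xs = w"
  using assms
proof (induction rule: converse_rtrancl_induct)
  case base
  show ?case by (intro exI[of _ "[w]"]) auto
next
  case (step y z)
  then obtain xs where xs: "distinct xs" "walk R xs" "hd xs = z" "last xs = w" by blast
  show ?case
  proof (cases "y \<in> set xs")
    case False
    then show ?thesis
      using xs step by (intro exI[of _ "y # xs"]) (cases xs, auto)
  next
    case True
    then obtain ys zs where "xs = ys @ y # zs" by (meson split_list)
    then show ?thesis
      using xs by (intro exI[of _ "y # zs"]) (auto simp: walk_iff_successively successively_append_iff)
  qed
qed

text \<open>\<open>par r\<close> is left unspecified, so every condition on \<open>par\<close>
  excludes \<open>r\<close>. The depth function is the measure for inductions and turns the
  exclusion of short cycles into arithmetic.\<close>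

locale rooted_tree =
  fixes V :: "'a set" and E :: "('a \<times> 'a) set" and r :: 'a and par :: "'a \<Rightarrow> 'a" and dep :: "'a \<Rightarrow> nat"
  assumes finite_V: "finite V"
    and r_in: "r \<in> V"
    and edge_iff: "(u, v) \<in> E \<longleftrightarrow> u \<in> V \<and> v \<in> V \<and> (v \<noteq> r \<and> u = par v \<or> u \<noteq> r \<and> v = par u)"
    and par_in: "v \<in> V \<Longrightarrow> v \<noteq> r \<Longrightarrow> par v \<in> V"
    and dep_par: "v \<in> V \<Longrightarrow> v \<noteq> r \<Longrightarrow> dep v = Suc (dep (par v))"
    and dep_r: "dep r = 0"

lemma relpow_Least_Suc:
  assumes "(r, u) \<in> E\<^sup>*" "(u, v) \<in> E"
  shows "(LEAST k. (r, v) \<in> E ^^ k) \<le> Suc (LEAST k. (r, u) \<in> E ^^ k)"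
proof (rule Least_le)
  obtain k where "(r, u) \<in> E ^^ k" using assms rtrancl_imp_relpow by blast
  then have "(r, u) \<in> E ^^ (LEAST k. (r, u) \<in> E ^^ k)" by (rule LeastI)
  then show "(r, v) \<in> E ^^ Suc (LEAST k. (r, u) \<in> E ^^ k)" using assms(2) by auto
qed

text \<open>The walk that avoids \<open>v\<close>, shortened to a path, is closed to a cycle by the
  two edges at \<open>v\<close>.\<close>

lemma avoiding_walk_has_cycle:
  assumes E: "sym E" and vuw: "(v, u) \<in> E" "(v, w) \<in> E" "u \<noteq> w"
    and "v \<noteq> u" and "(u, w) \<in> {(x, y) \<in> E. x \<noteq> v \<and> y \<noteq> v}\<^sup>*" (is "_ \<in> ?R\<^sup>*")
  shows "has_cycle E"
proof -
  obtain xs where xs: "distinct xs" "walk ?R xs" "hd xs = u" "last xs = w"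
    using rtrancl_distinct_walk[OF assms(6)] by blast
  have "walk E xs" using xs(2) by (auto simp: walk_def)
  \<comment> \<open>Each entry of a list with at least two entries lies on an edge of
    \<open>?R\<close>; a list with one entry consists of \<open>u\<close>.\<close>
  have "v \<notin> set xs"
  proof
    assume "v \<in> set xs"
    then obtain i where i: "i < length xs" "xs ! i = v" by (auto simp: in_set_conv_nth)
    show False
    proof (cases "Suc i < length xs")
      case True
      then have "(xs ! i, xs ! Suc i) \<in> ?R" using xs(2) by (simp add: walk_def)
      then show False using i by simp
    next
      case False
      show False
      proof (cases i)
        case 0
        then show False using i xs(3) \<open>v \<noteq> u\<close> by (cases xs) auto
      next
        case (Suc j)
        then have "(xs ! j, xs ! Suc j) \<in> ?R" using xs(2) i by (simp add: walk_def)
        then show False using i Suc by simp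
      qed
    qed
  qed
  have ne: "xs \<noteq> []" using xs(2) by (simp add: walk_def)
  have len: "length xs \<ge> 2"
    using ne xs(3,4) vuw(3) by (cases xs; cases "tl xs") auto
  show ?thesis
    unfolding has_cycle_def
  proof (intro exI[of _ "v # xs"] conjI)
    show "3 \<le> length (v # xs)" using len by simp
    show "distinct (v # xs)" using xs \<open>v \<notin> set xs\<close> by simp
    show "walk E (v # xs)" using \<open>walk E xs\<close> xs(3) vuw(1) ne by (cases xs) auto
    show "(last (v # xs), hd (v # xs)) \<in> E" using ne xs(4) vuw(2) E by (auto dest: symD)
  qed
qed

text \<open>Depth is the distance from \<open>r\<close>. Two neighbours of \<open>v\<close> that are
  no deeper than \<open>v\<close> could both reach \<open>r\<close> by decreasing depth without
  meeting \<open>v\<close>, which would close a cycle. So a vertex other than \<open>r\<close> has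
  exactly one such neighbour, its parent, and no edge stays within a level.\<close>

lemma tree_rooted:
  assumes "tree V E" "r \<in> V"
  shows "\<exists>par dep. rooted_tree V E r par dep"
proof -
  have g: "finite V" "E \<subseteq> V \<times> V" "sym E" "\<And>v. (v, v) \<notin> E" and nc: "\<not> has_cycle E"
    and con: "connected_graph V E"
    using assms by (auto simp: tree_def graph_def)
  define dep where "dep v = (LEAST k. (r, v) \<in> E ^^ k)" for v
  have reach: "(r, v) \<in> E\<^sup>*" if "v \<in> V" for v
    using con assms(2) that walk_in_rtrancl unfolding connected_graph_def by metis
  have dep_r: "dep r = 0" by (simp add: dep_def)
  have dep_le: "dep v \<le> Suc (dep u)" if "(u, v) \<in> E" for u v
    unfolding dep_def using that g(2) reach by (intro relpow_Least_Suc) auto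
  have ex_par: "\<exists>u. (v, u) \<in> E \<and> dep v = Suc (dep u)" if v: "v \<in> V" "v \<noteq> r" for v
  proof -
    obtain k where "(r, v) \<in> E ^^ k" using reach[OF v(1)] rtrancl_imp_relpow by blast
    then have *: "(r, v) \<in> E ^^ dep v" unfolding dep_def by (rule LeastI)
    then obtain m where m: "dep v = Suc m" using v(2) by (cases "dep v") auto
    with * obtain u where u: "(r, u) \<in> E ^^ m" "(u, v) \<in> E" by auto
    then have "dep u \<le> m" unfolding dep_def by (intro Least_le)
    moreover have "dep v \<le> Suc (dep u)" using u(2) dep_le by blast
    ultimately show ?thesis using m u(2) g(3) by (auto dest: symD)
  qed
  have avoid: "(x, r) \<in> {(x, y) \<in> E. x \<noteq> v \<and> y \<noteq> v}\<^sup>*"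
    if "x \<in> V" "x \<noteq> v" "dep x \<le> dep v" for x v
    using that
  proof (induction "dep x" arbitrary: x rule: less_induct)
    case less
    show ?case
    proof (cases "x = r")
      case False
      then obtain p where p: "(x, p) \<in> E" "dep x = Suc (dep p)" using ex_par less by blast
      have "p \<noteq> v" using p less by auto
      moreover have "(p, r) \<in> {(x, y) \<in> E. x \<noteq> v \<and> y \<noteq> v}\<^sup>*"
        using p less g(2) \<open>p \<noteq> v\<close> by (intro less.hyps) auto
      ultimately show ?thesis
        using p less.prems by (auto intro: converse_rtrancl_into_rtrancl)
    qed simp
  qed
  have uniq: "u = w" if "(v, u) \<in> E" "(v, w) \<in> E" "dep u \<le> dep v" "dep w \<le> dep v" for u v w
  proof (rule ccontr)
    assume "u \<noteq> w"
    have "u \<noteq> v" "w \<noteq> v" using that g(4) by auto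
    let ?R = "{(x, y) \<in> E. x \<noteq> v \<and> y \<noteq> v}"
    have "sym ?R" using g(3) by (auto simp: sym_def)
    have "(u, r) \<in> ?R\<^sup>*" "(w, r) \<in> ?R\<^sup>*"
      using that g(2) \<open>u \<noteq> v\<close> \<open>w \<noteq> v\<close> by (auto intro!: avoid)
    then have "(u, w) \<in> ?R\<^sup>*"
      using sym_rtrancl[OF \<open>sym ?R\<close>] by (meson rtrancl_trans symD)
    then have "has_cycle E"
      using that g \<open>u \<noteq> w\<close> \<open>u \<noteq> v\<close> by (intro avoiding_walk_has_cycle[of E v u w]) auto
    with nc show False ..
  qed
  define par where "par v = (SOME u. (v, u) \<in> E \<and> dep v = Suc (dep u))" for v
  have par: "(v, par v) \<in> E" "dep v = Suc (dep (par v))" if "v \<in> V" "v \<noteq> r" for v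
    using someI_ex[OF ex_par[OF that]] unfolding par_def by auto
  have lower: "v \<noteq> r \<and> u = par v" if "(v, u) \<in> E" "dep u \<le> dep v" for u v
  proof -
    have "v \<noteq> r"
    proof
      assume "v = r"
      then have "dep u = 0" "u \<in> V" "u \<noteq> r" using that dep_r g by auto
      then show False using par(2) by force
    qed
    then show ?thesis using uniq[OF that(1) par(1)] that par g(2) by force
  qed
  have "rooted_tree V E r par dep"
  proof
    fix u v
    show "(u, v) \<in> E \<longleftrightarrow> u \<in> V \<and> v \<in> V \<and> (v \<noteq> r \<and> u = par v \<or> u \<noteq> r \<and> v = par u)" (is "?L \<longleftrightarrow> ?R")
    proof
      assume ?L
      then have "(v, u) \<in> E" using g(3) by (auto dest: symD)
      then show ?R using \<open>?L\<close> lower[of v u] lower[of u v] g(2) by (meson mem_Sigma_iff nle_le subsetD)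
    next
      assume ?R then show ?L using par g(3) by (auto dest: symD)
    qed
  qed (use g par assms dep_r in auto)
  then show ?thesis by blast
qed

section \<open>Greedy domination of forests\<close>

definition quad :: "('a \<times> 'a) set \<Rightarrow> 'a set \<Rightarrow> bool" where
  "quad E Q \<longleftrightarrow> (\<exists>p q s t. distinct [p, q, s, t] \<and> Q = {p, q, s, t} \<and> (p, q) \<in> E \<and> (q, s) \<in> E \<and> (s, t) \<in> E)"

definition at_most_one_nbr :: "('a \<times> 'a) set \<Rightarrow> 'a set \<Rightarrow> 'a \<Rightarrow> bool" where
  "at_most_one_nbr E U v \<longleftrightarrow> (\<forall>y\<in>U. \<forall>z\<in>U. (v, y) \<in> E \<longrightarrow> (v, z) \<in> E \<longrightarrow> y = z)"

context rooted_tree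
begin

lemma edge_sym: "(u, v) \<in> E \<Longrightarrow> (v, u) \<in> E"
  using edge_iff by blast

lemma edge_in: "(u, v) \<in> E \<Longrightarrow> u \<in> V" "(u, v) \<in> E \<Longrightarrow> v \<in> V"
  using edge_iff by blast+

lemma par_edge: "v \<in> V \<Longrightarrow> v \<noteq> r \<Longrightarrow> (v, par v) \<in> E" "v \<in> V \<Longrightarrow> v \<noteq> r \<Longrightarrow> (par v, v) \<in> E"
  using edge_iff par_in by blast+

lemma edge_cases:
  assumes "(u, v) \<in> E"
  obtains (down) "v \<noteq> r" "u = par v" "dep v = Suc (dep u)" | (up) "u \<noteq> r" "v = par u" "dep u = Suc (dep v)"
  using assms edge_iff dep_par by metis

lemma no_loop: "(v, v) \<notin> E"
  by (auto elim: edge_cases)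

lemma edge_neq: "(u, v) \<in> E \<Longrightarrow> u \<noteq> v"
  using no_loop by blast

text \<open>At most one of two different neighbours is the parent, so the other one is a
  child.\<close>

lemma two_nbrs:
  assumes "(v, y) \<in> E" "(v, z) \<in> E" "y \<noteq> z"
  shows "v = par y \<and> dep y = Suc (dep v) \<or> v = par z \<and> dep z = Suc (dep v)"
proof (rule edge_cases[OF assms(1)])
  assume "v \<noteq> r" "y = par v"
  then show ?thesis by (rule_tac edge_cases[OF assms(2)]) (use assms(3) in auto)
qed blast

text \<open>Otherwise the four edges form a cycle in which, by \<open>two_nbrs\<close>, every vertex
  has a child; this is impossible for the deepest one.\<close>

lemma common_nbr_unique:
  assumes "(u, y) \<in> E" "(w, y) \<in> E" "(u, z) \<in> E" "(w, z) \<in> E" "u \<noteq> w"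
  shows "y = z"
proof (rule ccontr)
  assume "y \<noteq> z"
  note sym = assms(1-4)[THEN edge_sym]
  from two_nbrs[OF assms(1,3) \<open>y \<noteq> z\<close>] two_nbrs[OF assms(2,4) \<open>y \<noteq> z\<close>]
    two_nbrs[OF sym(1,2) assms(5)] two_nbrs[OF sym(3,4) assms(5)] assms(5)
  show False by linarith
qed

text \<open>If \<open>v\<close> is outside \<open>D\<close>, elements of \<open>D\<close> reached
  through different neighbours of \<open>v\<close> are different, since otherwise a cycle of length
  four would arise.\<close>

lemma dominated_halves:
  assumes "(v, y1) \<in> E" "(v, y2) \<in> E" "y1 \<noteq> y2" "u1 \<in> D" "(y1, u1) \<in> E" "u2 \<in> D" "(y2, u2) \<in> E"
  shows "dominated E D v"
proof (cases "v \<in> D")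
  case False
  then have "u1 \<noteq> u2" using common_nbr_unique[of y1 v y2 u1] assms edge_sym by blast
  then show ?thesis using assms dominated_two by metis
qed (simp add: dominated_self)

lemma at_most_one_nbr_bottom:
  assumes "\<And>y. y \<in> U \<Longrightarrow> (v, y) \<in> E \<Longrightarrow> dep y \<le> dep v"
  shows "at_most_one_nbr E U v"
  unfolding at_most_one_nbr_def
proof (intro ballI impI)
  fix y z assume yz: "y \<in> U" "z \<in> U" "(v, y) \<in> E" "(v, z) \<in> E"
  have "y = par v" by (rule edge_cases[OF yz(3)]) (use assms yz in force)+
  moreover have "z = par v" by (rule edge_cases[OF yz(4)]) (use assms yz in force)+
  ultimately show "y = z" by simp
qed

text \<open>The last hypothesis is the invariant of the greedy procedure. It survives the removal of
  \<open>W\<close> because the only outside vertex that can lose a neighbour is the parent of the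
  top of \<open>W\<close>, and in that case the top belongs to \<open>X\<close>. A component of the
  forest that is a star is dominated by \<open>D\<close> at no cost; otherwise one vertex is paid
  for at least four removed ones.\<close>

lemma peel_step:
  assumes U: "U \<subseteq> V" "U \<noteq> {}" and disj: "D \<inter> U = {}"
    and few: "\<And>v. v \<in> U \<Longrightarrow> at_most_one_nbr E U v \<Longrightarrow> \<exists>u\<in>D. (v, u) \<in> E"
  shows "\<exists>W X. W \<subseteq> U \<and> W \<noteq> {} \<and> X \<subseteq> W \<and> 4 * card X \<le> card W \<and> (4 * card X < card W \<or> quad E W)
    \<and> (\<forall>v\<in>W. dominated E (D \<union> X) v) \<and> (\<forall>v\<in>U - W. at_most_one_nbr E (U - W) v \<longrightarrow> (\<exists>u\<in>D \<union> X. (v, u) \<in> E))"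
proof -
  have finU: "finite U" using U finite_V finite_subset by blast
  define m where "m = Max (dep ` U)"
  have m: "dep v \<le> m" if "v \<in> U" for v using that finU by (simp add: m_def)
  have "m \<in> dep ` U" unfolding m_def using finU U by (intro Max_in) auto
  then obtain x0 where x0: "x0 \<in> U" "dep x0 = m" by auto
  define ch where "ch A = {v \<in> U. v \<noteq> r \<and> par v \<in> A}" for A
  have chD: "(par v, v) \<in> E" "(v, par v) \<in> E" "dep v = Suc (dep (par v))" if "v \<in> ch A" for v A
    using that par_edge dep_par U(1) unfolding ch_def by auto
  have chP: "par v \<in> A" if "v \<in> ch A" for v A using that by (simp add: ch_def)
  have dep1: "dep v = Suc (dep t)" if "v \<in> ch {t}" for v t
    using chD(3)[OF that] chP[OF that] by simp
  have dep2: "dep v = dep t + 2" if "v \<in> ch (ch {t})" for v t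
    using chD(3)[OF that] dep1[OF chP[OF that]] by simp
  have dep3: "dep v = dep t + 3" if "v \<in> ch (ch (ch {t}))" for v t
    using chD(3)[OF that] dep2[OF chP[OF that]] by simp
  have dep4: "dep v = dep t + 4" if "v \<in> ch (ch (ch (ch {t})))" for v t
    using chD(3)[OF that] dep3[OF chP[OF that]] by simp
  \<comment> \<open>Three levels below \<open>t\<close> suffice: at depth \<open>m - 3\<close> or
    more, these are all descendants of \<open>t\<close> in \<open>U\<close>.\<close>
  define W where "W t = {t} \<union> ch {t} \<union> ch (ch {t}) \<union> ch (ch (ch {t}))" for t
  have ch_empty: "ch {} = {}" by (simp add: ch_def)
  have W_ch: "ch (W t) \<subseteq> W t" if "t \<in> U" "m \<le> dep t + 3" for t
  proof -
    have "ch (ch (ch (ch {t}))) = {}"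
    proof (rule equals0I)
      fix v assume v: "v \<in> ch (ch (ch (ch {t})))"
      then have "dep v = dep t + 4" by (rule dep4)
      moreover have "v \<in> U" using v by (simp add: ch_def)
      ultimately show False using m[of v] that by simp
    qed
    then show ?thesis unfolding W_def ch_def by blast
  qed
  have W_sub: "W t \<subseteq> U" if "t \<in> U" for t using that unfolding W_def ch_def by blast
  have fewD: "\<exists>u\<in>D. (v, u) \<in> E" if "v \<in> U" "ch {v} = {}" for v
  proof (rule few[OF that(1)], rule at_most_one_nbr_bottom)
    fix y assume y: "y \<in> U" "(v, y) \<in> E"
    show "dep y \<le> dep v" by (rule edge_cases[OF y(2)]) (use y that in \<open>auto simp: ch_def\<close>)
  qed
  have bottom: "ch {v} = {}" if "v \<in> U" "dep v = m" for v
  proof (rule equals0I)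
    fix y assume y: "y \<in> ch {v}"
    then have "dep y = Suc m" using chD(3)[OF y] that by (simp add: ch_def)
    moreover have "y \<in> U" using y by (simp add: ch_def)
    ultimately show False using m by force
  qed
  have rest: "\<exists>u\<in>D \<union> X. (v, u) \<in> E"
    if t: "t \<in> U" "m \<le> dep t + 3" and X: "t \<in> X \<or> t = r \<or> par t \<notin> U"
      and v: "v \<in> U - W t" and fv: "at_most_one_nbr E (U - W t) v" for t X v
  proof (cases "\<exists>y\<in>W t. (v, y) \<in> E")
    case False
    then have "at_most_one_nbr E U v" using fv v unfolding at_most_one_nbr_def by blast
    then show ?thesis using few v by blast
  next
    case True
    then obtain y where y: "y \<in> W t" "(v, y) \<in> E" by blast
    from y(2) show ?thesis
    proof (cases rule: edge_cases)
      case up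
      then have "v \<in> ch (W t)" using y v by (simp add: ch_def)
      then show ?thesis using W_ch[OF t] v by blast
    next
      case down
      have "y = t"
      proof (rule ccontr)
        assume "y \<noteq> t"
        then have "par y \<in> W t" using y(1) unfolding W_def ch_def by auto
        then show False using down v by simp
      qed
      then show ?thesis using down X v y by auto
    qed
  qed
  have nopick: ?thesis
    if t: "t \<in> U" "m \<le> dep t + 3" "t = r \<or> par t \<notin> U" and dom: "\<And>v. v \<in> W t \<Longrightarrow> dominated E D v" for t
  proof (rule exI[of _ "W t"], rule exI[of _ "{}"], intro conjI)
    have "finite (W t)" using W_sub[OF t(1)] finU finite_subset by blast
    moreover have "W t \<noteq> {}" by (simp add: W_def)
    ultimately have "card (W t) > 0" by (simp add: card_gt_0_iff)
    then show "4 * card ({} :: 'a set) \<le> card (W t)" "4 * card ({} :: 'a set) < card (W t) \<or> quad E (W t)" by simp_all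
    show "\<forall>v\<in>U - W t. at_most_one_nbr E (U - W t) v \<longrightarrow> (\<exists>u\<in>D \<union> {}. (v, u) \<in> E)"
      using rest[of t "{}"] t by blast
  qed (use W_sub[OF t(1)] dom in \<open>auto simp: W_def\<close>)
  \<comment> \<open>\<open>Q\<close> witnesses that \<open>W t\<close> has at least four vertices.
    If there are exactly four, then \<open>W t = Q\<close>, and this is how the alternative
    \<open>quad E W\<close> arises.\<close>
  have pick: ?thesis
    if t: "t \<in> U" "m \<le> dep t + 3" and Q: "Q \<subseteq> W t" "card Q = 4" "quad E Q" for t Q
  proof (rule exI[of _ "W t"], rule exI[of _ "{t}"], intro conjI)
    have fin: "finite (W t)" using W_sub[OF t(1)] finU finite_subset by blast
    then have "4 \<le> card (W t)" using Q card_mono by metis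
    then show "4 * card {t} \<le> card (W t)" by simp
    show "4 * card {t} < card (W t) \<or> quad E (W t)"
      using card_subset_eq[OF fin Q(1)] Q \<open>4 \<le> card (W t)\<close> by (cases "card (W t) = 4") auto
    show "\<forall>v\<in>U - W t. at_most_one_nbr E (U - W t) v \<longrightarrow> (\<exists>u\<in>D \<union> {t}. (v, u) \<in> E)"
      using rest[of t "{t}"] t by blast
    show "\<forall>v\<in>W t. dominated E (D \<union> {t}) v"
    proof
      fix v assume v: "v \<in> W t"
      have vU: "v \<in> U" using v W_sub t by blast
      consider "v = t" | "v \<in> ch {t}" | "v \<in> ch (ch {t})" | "v \<in> ch (ch (ch {t}))"
        using v unfolding W_def by blast
      then show "dominated E (D \<union> {t}) v"
      proof cases
        case 1 then show ?thesis by (simp add: dominated_self)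
      next
        case 2 then show ?thesis using chD(2)[OF 2] dominated_nbr[of t _ v E] by (auto simp: ch_def)
      next
        case 3
        then have pp: "(v, par v) \<in> E" "(par v, t) \<in> E" using chD(2)[OF 3] chD(2)[of "par v" "{t}"] by (auto simp: ch_def)
        show ?thesis
        proof (cases "ch {v} = {}")
          case True
          then show ?thesis using fewD[OF vU] dominated_nbr by (metis UnI1)
        next
          case False
          \<comment> \<open>The child \<open>y\<close> of the grandchild \<open>v\<close> has
            maximal depth and therefore a neighbour in \<open>D\<close>; together with
            \<open>t\<close>, reached through the parent of \<open>v\<close>, it dominates
            \<open>v\<close>.\<close>
          then obtain y where y: "y \<in> ch {v}" by blast
          have "y \<in> ch (ch (ch {t}))" using y 3 by (auto simp: ch_def)
          then have "dep y = dep t + 3" "y \<in> U" using dep3 by (auto simp: ch_def)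
          then have "dep y = m" using m t by force
          then obtain u where "u \<in> D" "(y, u) \<in> E" using fewD[of y] bottom[of y] \<open>y \<in> U\<close> by blast
          moreover have "(v, y) \<in> E" "par v \<noteq> y"
            using chD[OF y] chD[OF 3] y by (auto simp: ch_def)
          ultimately show ?thesis using dominated_halves[of v "par v" y t _ u] pp by auto
        qed
      next
        case 4
        then have "dep v = dep t + 3" by (rule dep3)
        then have "dep v = m" using m[OF vU] t by force
        then obtain u where "u \<in> D" "(v, u) \<in> E" using fewD[of v] bottom[of v] vU by blast
        then show ?thesis using dominated_nbr[of u "D \<union> {t}" v E] by auto
      qed
    qed
  qed (use W_sub[OF t(1)] in \<open>auto simp: W_def\<close>)
  have top_ch: "w \<in> ch {t}" if "t = r \<or> par t \<notin> U" "w \<in> U" "(t, w) \<in> E" for t w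
    using that(3)
  proof (cases rule: edge_cases)
    case down then show ?thesis using that(2) by (simp add: ch_def)
  next
    case up then show ?thesis using that(1,2) by simp
  qed
  have ch_step: "v \<in> ch {par v} \<and> (v, par v) \<in> E \<and> dep v = Suc (dep (par v))" if "v \<in> U" "v \<noteq> r" for v
    using that U par_edge dep_par by (auto simp: ch_def)
  \<comment> \<open>\<open>x0\<close>, \<open>x1\<close>, \<open>x2\<close>, \<open>x3\<close> climb
    from a deepest vertex as long as the parent lies in \<open>U\<close>. If the climb ends at
    \<open>x0\<close>, at \<open>x1\<close>, or at an \<open>x2\<close> whose only child is
    \<open>x1\<close>, the component is a star and \<open>nopick\<close> applies.\<close>
  show ?thesis
  proof (cases "x0 = r \<or> par x0 \<notin> U")
    case True
    have "ch {x0} = {}" using bottom x0 by blast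
    then have "W x0 = {x0}" by (simp add: W_def ch_empty)
    moreover have "dominated E D x0" using fewD[OF x0(1)] \<open>ch {x0} = {}\<close> dominated_nbr by metis
    ultimately show ?thesis using nopick[of x0] True x0 by simp
  next
    case x1: False
    define x1 where "x1 = par x0"
    have x1: "x1 \<in> U" "x0 \<in> ch {x1}" "(x0, x1) \<in> E" "m = Suc (dep x1)"
      using x1 ch_step[of x0] x0 by (auto simp: x1_def)
    show ?thesis
    proof (cases "x1 = r \<or> par x1 \<notin> U")
      case True
      have ch2: "ch {y} = {}" "\<exists>u\<in>D. (y, u) \<in> E" if "y \<in> ch {x1}" for y
      proof -
        have "y \<in> U" "dep y = m" using that x1 chD(3)[OF that] by (auto simp: ch_def)
        then show "ch {y} = {}" "\<exists>u\<in>D. (y, u) \<in> E" using bottom fewD by auto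
      qed
      have "ch (ch {x1}) = {}"
      proof (rule equals0I)
        fix v assume "v \<in> ch (ch {x1})"
        then have "v \<in> ch {par v}" "par v \<in> ch {x1}" by (auto simp: ch_def)
        then show False using ch2 by blast
      qed
      then have W: "W x1 = insert x1 (ch {x1})" by (simp add: W_def ch_empty)
      show ?thesis
      proof (rule nopick[of x1])
        fix v assume "v \<in> W x1"
        then consider "v = x1" | "v \<in> ch {x1}" using W by blast
        then show "dominated E D v"
        proof cases
          case 2 then show ?thesis using ch2 dominated_nbr by metis
        next
          case 1
          show ?thesis
          proof (cases "at_most_one_nbr E U x1")
            case True
            then obtain u where "u \<in> D" "(x1, u) \<in> E" using few[OF x1(1)] by blast
            then show ?thesis using dominated_nbr[of u D x1 E] 1 by simp
          next
            case False
            then obtain y z where yz: "y \<in> U" "z \<in> U" "(x1, y) \<in> E" "(x1, z) \<in> E" "y \<noteq> z"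
              unfolding at_most_one_nbr_def by blast
            then have "y \<in> ch {x1}" "z \<in> ch {x1}" using top_ch[OF \<open>x1 = r \<or> par x1 \<notin> U\<close>] by simp_all
            then obtain u u' where "u \<in> D" "(y, u) \<in> E" "u' \<in> D" "(z, u') \<in> E"
              using ch2(2)[of y] ch2(2)[of z] by blast
            then show ?thesis using dominated_halves[of x1 y z u D u'] yz 1 by simp
          qed
        qed
      qed (use x1 True in auto)
    next
      case x2: False
      define x2 where "x2 = par x1"
      have x2: "x2 \<in> U" "x1 \<in> ch {x2}" "(x1, x2) \<in> E" "dep x1 = Suc (dep x2)"
        using x2 ch_step[of x1] x1 by (auto simp: x2_def)
      show ?thesis
      proof (cases "x2 = r \<or> par x2 \<notin> U")
        case top: True
        show ?thesis
        proof (cases "ch {x2} = {x1}")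
          case True
          have ch3: "ch {y} = {}" "\<exists>u\<in>D. (y, u) \<in> E" if "y \<in> ch {x1}" for y
          proof -
            have "y \<in> U" "dep y = m" using that x1 chD(3)[OF that] by (auto simp: ch_def)
            then show "ch {y} = {}" "\<exists>u\<in>D. (y, u) \<in> E" using bottom fewD by auto
          qed
          have "ch (ch {x1}) = {}"
      proof (rule equals0I)
        fix v assume "v \<in> ch (ch {x1})"
        then have "v \<in> ch {par v}" "par v \<in> ch {x1}" by (auto simp: ch_def)
        then show False using ch3 by blast
      qed
          then have W: "W x2 = {x2, x1} \<union> ch {x1}" using True by (simp add: W_def insert_commute)
          have "at_most_one_nbr E U x2"
            unfolding at_most_one_nbr_def
          proof (intro ballI impI)
            fix y z
            show "y = z" if "y \<in> U" "z \<in> U" "(x2, y) \<in> E" "(x2, z) \<in> E"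
              using top_ch[OF top that(1,3)] top_ch[OF top that(2,4)] True by simp
          qed
          then obtain u2 where u2: "u2 \<in> D" "(x2, u2) \<in> E" using few x2 by blast
          obtain u0 where u0: "u0 \<in> D" "(x0, u0) \<in> E" using ch3(2)[of x0] x1 by blast
          have "x0 \<noteq> x2" using x0 x1 x2 by auto
          then have "dominated E D x1"
            using dominated_halves[of x1 x0 x2 u0 D u2] u0 u2 x1 x2 edge_sym by blast
          moreover have "dominated E D x2" using u2 dominated_nbr by metis
          moreover have "dominated E D y" if "y \<in> ch {x1}" for y using ch3(2)[OF that] dominated_nbr by metis
          ultimately show ?thesis using W top x1 x2 by (intro nopick[of x2]) auto
        next
          case False
          then obtain y where y: "y \<in> ch {x2}" "y \<noteq> x1" using x2 by blast
          have "(y, x2) \<in> E" "dep y = Suc (dep x2)" using chD[OF y(1)] y by (auto simp: ch_def)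
          then have d: "distinct [y, x2, x1, x0]" using y x0 x1 x2 by auto
          moreover have "{y, x2, x1, x0} \<subseteq> W x2" using x1 x2 y by (auto simp: W_def ch_def)
          moreover have "quad E {y, x2, x1, x0}"
            unfolding quad_def using d \<open>(y, x2) \<in> E\<close> x1 x2 edge_sym by blast
          ultimately show ?thesis using x1 x2 by (intro pick[of x2 "{y, x2, x1, x0}"]) auto
        qed
      next
        case x3: False
        define x3 where "x3 = par x2"
        have x3: "x3 \<in> U" "x2 \<in> ch {x3}" "(x2, x3) \<in> E" "dep x2 = Suc (dep x3)"
          using x3 ch_step[of x2] x2 by (auto simp: x3_def)
        have d: "distinct [x0, x1, x2, x3]" using x0 x1 x2 x3 by auto
        moreover have "{x0, x1, x2, x3} \<subseteq> W x3" using x1 x2 x3 by (auto simp: W_def ch_def)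
        moreover have "quad E {x0, x1, x2, x3}"
          unfolding quad_def using d x1 x2 x3 by blast
        ultimately show ?thesis using x0 x1 x2 x3 by (intro pick[of x3 "{x0, x1, x2, x3}"]) auto
      qed
    qed
  qed
qed

lemma greedy_domination:
  assumes "U \<subseteq> V" "D \<inter> U = {}" "\<And>v. v \<in> U \<Longrightarrow> at_most_one_nbr E U v \<Longrightarrow> \<exists>u\<in>D. (v, u) \<in> E"
  shows "\<exists>X\<subseteq>U. 4 * card X \<le> card U \<and> (\<forall>v\<in>U. dominated E (D \<union> X) v) \<and>
    (4 * card X = card U \<longrightarrow> (\<exists>\<Q>. \<Union>\<Q> = U \<and> pairwise disjnt \<Q> \<and> (\<forall>Q\<in>\<Q>. quad E Q)))"
  using assms
proof (induction "card U" arbitrary: U D rule: less_induct)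
  case less
  show ?case
  proof (cases "U = {}")
    case True
    have "\<exists>\<Q>. \<Union>\<Q> = {} \<and> pairwise disjnt \<Q> \<and> (\<forall>Q\<in>\<Q>. quad E Q)"
      by (rule exI[of _ "{}"]) simp
    then show ?thesis using True by (intro exI[of _ "{}"]) simp
  next
    case False
    obtain W X where W: "W \<subseteq> U" "W \<noteq> {}" "X \<subseteq> W" "4 * card X \<le> card W" "4 * card X < card W \<or> quad E W"
      and domW: "\<forall>v\<in>W. dominated E (D \<union> X) v"
      and rest: "\<forall>v\<in>U - W. at_most_one_nbr E (U - W) v \<longrightarrow> (\<exists>u\<in>D \<union> X. (v, u) \<in> E)"
      using peel_step[OF less.prems(1) False less.prems(2,3)] by metis
    have fin: "finite U" using finite_subset[OF less.prems(1) finite_V] .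
    have finW: "finite W" "finite X" using finite_subset[OF W(1) fin] finite_subset[OF W(3)] by simp_all
    have cU: "card U = card W + card (U - W)"
      using card_Diff_subset[OF finW(1) W(1)] card_mono[OF fin W(1)] by simp
    have "card W > 0" using W(2) finW by (simp add: card_gt_0_iff)
    have "\<exists>Y\<subseteq>U - W. 4 * card Y \<le> card (U - W) \<and> (\<forall>v\<in>U - W. dominated E ((D \<union> X) \<union> Y) v) \<and>
      (4 * card Y = card (U - W) \<longrightarrow> (\<exists>\<Q>. \<Union>\<Q> = U - W \<and> pairwise disjnt \<Q> \<and> (\<forall>Q\<in>\<Q>. quad E Q)))"
    proof (rule less.hyps)
      show "card (U - W) < card U" using cU \<open>card W > 0\<close> by simp
      show "U - W \<subseteq> V" "(D \<union> X) \<inter> (U - W) = {}" using less.prems(1,2) W(3) by blast+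
      show "\<exists>u\<in>D \<union> X. (v, u) \<in> E" if "v \<in> U - W" "at_most_one_nbr E (U - W) v" for v
        using rest that by blast
    qed
    then obtain Y where Y: "Y \<subseteq> U - W" "4 * card Y \<le> card (U - W)" "\<forall>v\<in>U - W. dominated E ((D \<union> X) \<union> Y) v"
      and eqY: "4 * card Y = card (U - W) \<Longrightarrow> \<exists>\<Q>. \<Union>\<Q> = U - W \<and> pairwise disjnt \<Q> \<and> (\<forall>Q\<in>\<Q>. quad E Q)"
      by blast
    have "finite Y" using finite_subset[OF Y(1)] fin by simp
    then have cXY: "card (X \<union> Y) = card X + card Y"
      using finW W(3) Y(1) by (intro card_Un_disjoint) auto
    show ?thesis
    proof (intro exI[of _ "X \<union> Y"] conjI impI)
      show "X \<union> Y \<subseteq> U" using W(1,3) Y(1) by blast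
      show "4 * card (X \<union> Y) \<le> card U" using cXY cU W Y by simp
      show "\<forall>v\<in>U. dominated E (D \<union> (X \<union> Y)) v"
      proof
        fix v assume "v \<in> U"
        show "dominated E (D \<union> (X \<union> Y)) v"
        proof (cases "v \<in> W")
          case True then show ?thesis using domW dominated_mono[of E "D \<union> X" v "D \<union> (X \<union> Y)"] by auto
        next
          case False then show ?thesis using Y \<open>v \<in> U\<close> by (simp add: Un_assoc)
        qed
      qed
      assume "4 * card (X \<union> Y) = card U"
      \<comment> \<open>The two summands are bounded separately, so equality of the sums forces
        equality in each.\<close>
      then have "4 * card X = card W" "4 * card Y = card (U - W)" using cXY cU W Y by auto
      then obtain \<Q> where Q: "\<Union>\<Q> = U - W" "pairwise disjnt \<Q>" "\<forall>Q\<in>\<Q>. quad E Q" and "quad E W"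
        using eqY W by auto
      have "disjnt W Q" if "Q \<in> \<Q>" for Q using Q(1) that unfolding disjnt_def by blast
      then have "pairwise disjnt (insert W \<Q>)"
        using Q(2) by (simp add: pairwise_insert disjnt_sym)
      moreover have "\<Union>(insert W \<Q>) = U" using Q(1) W(1) by auto
      ultimately show "\<exists>\<Q>. \<Union>\<Q> = U \<and> pairwise disjnt \<Q> \<and> (\<forall>Q\<in>\<Q>. quad E Q)"
        using Q(3) \<open>quad E W\<close> by (intro exI[of _ "insert W \<Q>"]) simp
    qed
  qed
qed

end

section \<open>The upper bound\<close>

definition pair_block :: "('a \<times> 'a) set \<Rightarrow> 'a set \<Rightarrow> bool" where
  "pair_block E B \<longleftrightarrow> (\<exists>a c. a \<noteq> c \<and> B = {a, c} \<and> (a, c) \<in> E \<and> leaf E c)"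

definition quad_block :: "('a \<times> 'a) set \<Rightarrow> 'a set \<Rightarrow> bool" where
  "quad_block E B \<longleftrightarrow> quad E B \<and> (\<forall>v\<in>B. \<not> leaf E v)"

definition block_partition :: "'a set \<Rightarrow> ('a \<times> 'a) set \<Rightarrow> 'a set set \<Rightarrow> bool" where
  "block_partition V E \<B> \<longleftrightarrow> \<Union>\<B> = V \<and> pairwise disjnt \<B> \<and> (\<forall>B\<in>\<B>. pair_block E B \<or> quad_block E B)"

lemma quad_card: "quad E Q \<Longrightarrow> card Q = 4"
  by (auto simp: quad_def)

lemma leaf_nbr_unique: "leaf E v \<Longrightarrow> (v, u) \<in> E \<Longrightarrow> (v, w) \<in> E \<Longrightarrow> u = w"
proof -
  assume "leaf E v" "(v, u) \<in> E" "(v, w) \<in> E"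
  then obtain x where "nbhd E v = {x}" "u \<in> nbhd E v" "w \<in> nbhd E v"
    by (auto simp: leaf_def deg_def card_1_singleton_iff nbhd_def)
  then show "u = w" by simp
qed

lemma leafI: "(v, u) \<in> E \<Longrightarrow> (\<And>w. (v, w) \<in> E \<Longrightarrow> w = u) \<Longrightarrow> leaf E v"
proof -
  assume "(v, u) \<in> E" "\<And>w. (v, w) \<in> E \<Longrightarrow> w = u"
  then have "nbhd E v = {u}" unfolding nbhd_def by blast
  then show ?thesis by (simp add: leaf_def deg_def)
qed

lemma nbr_outside:
  assumes "finite A" "card A < deg E v"
  obtains y where "(v, y) \<in> E" "y \<notin> A"
proof -
  have "\<not> nbhd E v \<subseteq> A" using assms card_mono[of A "nbhd E v"] by (auto simp: deg_def)
  then show ?thesis using that by (auto simp: nbhd_def)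
qed

context rooted_tree
begin

text \<open>The least deep element of \<open>A\<close> has its parent in \<open>A\<close> unless it
  is the root; so \<open>r\<close> is in \<open>A\<close>, and all other vertices follow by
  induction on the depth.\<close>

lemma closed_set_eq:
  assumes A: "A \<subseteq> V" "A \<noteq> {}" and closed: "\<And>x y. x \<in> A \<Longrightarrow> (x, y) \<in> E \<Longrightarrow> y \<in> A"
  shows "A = V"
proof -
  obtain x where x: "x \<in> A" "\<And>y. y \<in> A \<Longrightarrow> dep x \<le> dep y"
    using A(2) ex_has_least_nat[of "\<lambda>x. x \<in> A" _ dep] by blast
  have "x = r"
  proof (rule ccontr)
    assume "x \<noteq> r"
    then have "par x \<in> A" "dep x = Suc (dep (par x))"
      using closed[OF x(1) par_edge(1)[of x]] dep_par[of x] subsetD[OF A(1) x(1)] by simp_all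
    then show False using x(2)[of "par x"] by simp
  qed
  have "v \<in> A" if "v \<in> V" for v
    using that
  proof (induction "dep v" arbitrary: v rule: less_induct)
    case less
    show ?case
    proof (cases "v = r")
      case False
      then have "par v \<in> A" using less dep_par[of v] par_in[of v] by simp
      then show ?thesis using closed par_edge(2)[of v] less.prems False by blast
    qed (use x \<open>x = r\<close> in simp)
  qed
  then show ?thesis using A(1) by blast
qed

lemma nbhd_finite: "finite (nbhd E v)"
  by (rule finite_subset[OF _ finite_V]) (auto simp: nbhd_def dest: edge_in)

lemma ex_nbr:
  assumes "2 \<le> card V" "v \<in> V"
  shows "\<exists>u. (v, u) \<in> E"
proof (rule ccontr)
  assume "\<not> ?thesis"
  then have "{v} = V" using assms(2) by (intro closed_set_eq) auto
  moreover have "card {v} = 1" by simp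
  ultimately show False using assms(1) by simp
qed

lemma deg_ge_2:
  assumes "2 \<le> card V" "v \<in> V" "\<not> leaf E v"
  shows "2 \<le> deg E v"
proof -
  have "nbhd E v \<noteq> {}" using ex_nbr[OF assms(1,2)] by (auto simp: nbhd_def)
  then have "deg E v > 0" using nbhd_finite by (simp add: deg_def card_gt_0_iff)
  then show ?thesis using assms(3) by (simp add: leaf_def)
qed

lemma leaf_nbr_not_leaf:
  assumes "3 \<le> card V" "(u, v) \<in> E" "leaf E u"
  shows "\<not> leaf E v"
proof
  assume "leaf E v"
  have "{u, v} = V"
  proof (rule closed_set_eq)
    fix x y assume "x \<in> {u, v}" "(x, y) \<in> E"
    then show "y \<in> {u, v}"
      using leaf_nbr_unique[OF assms(3,2)] leaf_nbr_unique[OF \<open>leaf E v\<close> edge_sym[OF assms(2)]] by blast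
  qed (use edge_in[OF assms(2)] in simp_all)
  moreover have "card {u, v} \<le> 2" by (simp add: card_insert_if)
  ultimately show False using assms(1) by simp
qed

text \<open>A leaf has a single neighbour, so choosing a leaf at every support vertex is injective.
  In the case of equality this choice supplies the pairs of the partition.\<close>

lemma support_leaf_card:
  obtains f where "inj_on f {v\<in>V. support E v}" "f ` {v\<in>V. support E v} \<subseteq> {v\<in>V. leaf E v}"
    "\<And>v. v \<in> V \<Longrightarrow> support E v \<Longrightarrow> (v, f v) \<in> E \<and> leaf E (f v)"
proof -
  define f where "f v = (SOME u. (v, u) \<in> E \<and> leaf E u)" for v
  have f: "(v, f v) \<in> E \<and> leaf E (f v)" if "support E v" for v
    using someI_ex[of "\<lambda>u. (v, u) \<in> E \<and> leaf E u"] that unfolding f_def support_def by simp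
  show ?thesis
  proof (rule that[of f])
    show "inj_on f {v\<in>V. support E v}"
    proof (rule inj_onI)
      fix x y assume xy: "x \<in> {v\<in>V. support E v}" "y \<in> {v\<in>V. support E v}" "f x = f y"
      have sx: "support E x" and sy: "support E y" using xy(1,2) by blast+
      have "(f x, x) \<in> E" by (rule edge_sym) (simp add: f[OF sx])
      moreover have "(f x, y) \<in> E" unfolding xy(3) by (rule edge_sym) (simp add: f[OF sy])
      ultimately show "x = y" using leaf_nbr_unique[of E "f x" x y] f[OF sx] by simp
    qed
    show "f ` {v\<in>V. support E v} \<subseteq> {v\<in>V. leaf E v}" using f edge_in(2) by blast
  qed (use f in blast)
qed

lemma num_support_le_leaves: "num_support V E \<le> num_leaves V E"
proof -
  obtain f where "inj_on f {v\<in>V. support E v}" "f ` {v\<in>V. support E v} \<subseteq> {v\<in>V. leaf E v}"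
    by (rule support_leaf_card)
  then show ?thesis unfolding num_support_def num_leaves_def
    using finite_V by (intro card_inj_on_le[of f]) simp_all
qed

theorem gamma_2d_bound:
  assumes con: "connected_graph V E" and n: "3 \<le> card V"
  shows "4 * gamma_2d V E \<le> card V + num_leaves V E + num_support V E"
    and "4 * gamma_2d V E = card V + num_leaves V E + num_support V E \<Longrightarrow>
      \<exists>\<B>. block_partition V E \<B> \<and> card \<B> \<le> gamma_2d V E"
proof -
  define Lf where "Lf = {v\<in>V. leaf E v}"
  define Sp where "Sp = {v\<in>V. support E v}"
  define I where "I = V - Lf - Sp"
  have fin: "finite Lf" "finite Sp" "finite I" using finite_V by (auto simp: Lf_def Sp_def I_def)
  have disj: "Lf \<inter> Sp = {}"
    using leaf_nbr_not_leaf[OF n] by (auto simp: Lf_def Sp_def support_def)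
  have sub: "Lf \<subseteq> V" "Sp \<subseteq> V" by (auto simp: Lf_def Sp_def)
  have "V = Lf \<union> Sp \<union> I" using sub by (auto simp: I_def)
  moreover have "card (Lf \<union> Sp \<union> I) = card (Lf \<union> Sp) + card I"
    using fin by (intro card_Un_disjoint) (auto simp: I_def)
  ultimately have cV: "card V = card Lf + card Sp + card I"
    using card_Un_disjoint[OF fin(1,2) disj] by simp
  have n2: "2 \<le> card V" using n by simp
  \<comment> \<open>Without a neighbour in \<open>Sp\<close>, all neighbours of \<open>v\<close> lie
    in \<open>I\<close>; if there is at most one, then \<open>v\<close> is a leaf and not in
    \<open>I\<close>.\<close>
  have "\<exists>u\<in>Sp. (v, u) \<in> E" if v: "v \<in> I" "at_most_one_nbr E I v" for v
  proof (rule ccontr)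
    assume no: "\<not> ?thesis"
    have vV: "v \<in> V" "\<not> leaf E v" "\<not> support E v" using v(1) by (auto simp: I_def Lf_def Sp_def)
    obtain u where u: "(v, u) \<in> E" using ex_nbr[OF n2 vV(1)] by blast
    have nI: "w \<in> I" if "(v, w) \<in> E" for w
      using that no vV(3) edge_in(2)[OF that] by (auto simp: I_def Lf_def Sp_def support_def)
    have "leaf E v"
    proof (rule leafI[OF u])
      fix w assume "(v, w) \<in> E"
      then show "w = u" using v(2) u nI unfolding at_most_one_nbr_def by simp
    qed
    with vV show False by simp
  qed
  then have "\<exists>X\<subseteq>I. 4 * card X \<le> card I \<and> (\<forall>v\<in>I. dominated E (Sp \<union> X) v) \<and>
    (4 * card X = card I \<longrightarrow> (\<exists>\<Q>. \<Union>\<Q> = I \<and> pairwise disjnt \<Q> \<and> (\<forall>Q\<in>\<Q>. quad E Q)))"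
    by (intro greedy_domination) (auto simp: I_def)
  then obtain X where X: "X \<subseteq> I" "4 * card X \<le> card I" "\<forall>v\<in>I. dominated E (Sp \<union> X) v"
    and Xeq: "4 * card X = card I \<Longrightarrow> \<exists>\<Q>. \<Union>\<Q> = I \<and> pairwise disjnt \<Q> \<and> (\<forall>Q\<in>\<Q>. quad E Q)"
    by blast
  have "gamma_2d V E \<le> card (Sp \<union> X)"
  proof (rule gamma_2d_le[OF finite_V con])
    show "Sp \<union> X \<subseteq> V" using X(1) sub by (auto simp: I_def)
    fix v assume v: "v \<in> V"
    consider "v \<in> I" | "v \<in> Sp" | "v \<in> Lf" using v by (auto simp: I_def)
    then show "dominated E (Sp \<union> X) v"
    proof cases
      case 3
      obtain u where u: "(v, u) \<in> E" using ex_nbr[OF n2 v] by blast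
      then have "u \<in> V" "support E u" using 3 edge_in(2)[OF u] edge_sym[OF u] unfolding support_def Lf_def by blast+
      then have "u \<in> Sp" by (simp add: Sp_def)
      then show ?thesis using u dominated_nbr[of u "Sp \<union> X"] by simp
    qed (use X in \<open>auto simp: dominated_self\<close>)
  qed
  moreover have "card (Sp \<union> X) \<le> card Sp + card X" by (rule card_Un_le)
  ultimately have g: "gamma_2d V E \<le> card Sp + card X" by simp
  have sl: "card Sp \<le> card Lf"
    using num_support_le_leaves by (simp add: Sp_def Lf_def num_support_def num_leaves_def)
  \<comment> \<open>In this form the sum is at least \<open>4 * card Sp + 4 * card X\<close>, by the
    two inequalities \<open>card Sp \<le> card Lf\<close> and
    \<open>4 * card X \<le> card I\<close>; equality makes both of them tight.\<close>
  have phi: "card V + num_leaves V E + num_support V E = 2 * card Lf + 2 * card Sp + card I"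
    using cV by (simp add: Sp_def Lf_def num_support_def num_leaves_def)
  show "4 * gamma_2d V E \<le> card V + num_leaves V E + num_support V E"
    using phi g sl X(2) by simp
  assume "4 * gamma_2d V E = card V + num_leaves V E + num_support V E"
  then have eq: "card Lf = card Sp" "4 * card X = card I" "gamma_2d V E = card Sp + card X"
    using phi g sl X(2) by linarith+
  obtain f where f: "inj_on f Sp" "f ` Sp \<subseteq> Lf"
    "\<And>v. v \<in> Sp \<Longrightarrow> (v, f v) \<in> E \<and> leaf E (f v)"
    using support_leaf_card unfolding Sp_def Lf_def by (metis (mono_tags, lifting) mem_Collect_eq)
  have "f ` Sp = Lf"
    using f eq fin by (intro card_subset_eq) (simp_all add: card_image)
  obtain \<Q> where Q: "\<Union>\<Q> = I" "pairwise disjnt \<Q>" "\<forall>Q\<in>\<Q>. quad E Q"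
    using Xeq eq by blast
  have "card I = sum card \<Q>"
    using Q fin(3) by (metis Union_upper card_Union_disjoint finite_subset)
  also have "\<dots> = (\<Sum>Q\<in>\<Q>. 4)" using Q(3) quad_card by (intro sum.cong) auto
  also have "\<dots> = 4 * card \<Q>" by simp
  finally have cQ: "card \<Q> = card X" using eq by simp
  define \<P> where "\<P> = (\<lambda>v. {v, f v}) ` Sp"
  have "card (\<Q> \<union> \<P>) \<le> gamma_2d V E"
    using card_Un_le[of \<Q> \<P>] cQ eq(3) card_image_le[OF fin(2), of "\<lambda>v. {v, f v}"] by (simp add: \<P>_def)
  moreover have "block_partition V E (\<Q> \<union> \<P>)"
    unfolding block_partition_def
  proof (intro conjI ballI)
    have UP: "\<Union>\<P> = Sp \<union> Lf" using \<open>f ` Sp = Lf\<close> by (auto simp: \<P>_def)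
    show "\<Union>(\<Q> \<union> \<P>) = V" using Q(1) UP sub by (auto simp: I_def)
    have "disjnt A B" if "A \<in> \<P>" "B \<in> \<P>" "A \<noteq> B" for A B
    proof -
      obtain x y where xy: "x \<in> Sp" "y \<in> Sp" "A = {x, f x}" "B = {y, f y}"
        using \<open>A \<in> \<P>\<close> \<open>B \<in> \<P>\<close> by (auto simp: \<P>_def)
      then have "x \<noteq> y" "f x \<noteq> f y" "f x \<in> Lf" "f y \<in> Lf"
        using that(3) f(1,2) inj_onD[OF f(1)] by blast+
      then show ?thesis using xy disj by (auto simp: disjnt_def)
    qed
    moreover have "disjnt A B" if "A \<in> \<P>" "B \<in> \<Q>" for A B
    proof -
      have "A \<subseteq> Sp \<union> Lf" "B \<subseteq> I" using that UP Q(1) by blast+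
      then show ?thesis unfolding disjnt_def I_def by blast
    qed
    ultimately show "pairwise disjnt (\<Q> \<union> \<P>)"
      using Q(2) unfolding pairwise_def by (metis Un_iff disjnt_sym)
    fix B assume "B \<in> \<Q> \<union> \<P>"
    then show "pair_block E B \<or> quad_block E B"
    proof
      assume "B \<in> \<Q>"
      then have "quad E B" "B \<subseteq> I" using Q by blast+
      then show ?thesis by (auto simp: quad_block_def I_def Lf_def)
    next
      assume "B \<in> \<P>"
      then obtain v where "v \<in> Sp" "B = {v, f v}" by (auto simp: \<P>_def)
      then show ?thesis unfolding pair_block_def using f(3)[of v] edge_neq by blast
    qed
  qed
  ultimately show "\<exists>\<B>. block_partition V E \<B> \<and> card \<B> \<le> gamma_2d V E" by blast
qed

end

section \<open>Paths on four vertices in a rooted tree\<close>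

context rooted_tree
begin

lemma no_triangle: "(u, v) \<in> E \<Longrightarrow> (v, w) \<in> E \<Longrightarrow> (u, w) \<notin> E"
proof
  assume e: "(u, v) \<in> E" "(v, w) \<in> E" "(u, w) \<in> E"
  have "v \<noteq> w" "u \<noteq> w" "u \<noteq> v" using e edge_neq by auto
  then show False
    using two_nbrs[OF e(1,3)] two_nbrs[OF edge_sym[OF e(1)] e(2)]
      two_nbrs[OF edge_sym[OF e(3)] edge_sym[OF e(2)]] by linarith
qed

lemma path_induced:
  assumes "(p, q) \<in> E" "(q, s) \<in> E" "(s, t) \<in> E" "p \<noteq> s" "q \<noteq> t"
  shows "(p, s) \<notin> E" "(q, t) \<notin> E" "(p, t) \<notin> E"
  using no_triangle[OF assms(1,2)] no_triangle[OF assms(2,3)]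
    common_nbr_unique[of p q s t] assms edge_sym by blast+

text \<open>A path has a unique vertex closest to the root, from which all its edges point
  downwards. Up to reversal this vertex is the first or the second one.\<close>

lemma quad_cases:
  assumes "quad E Q" "Q \<subseteq> V"
  obtains p q s t where "distinct [p, q, s, t]" "Q = {p, q, s, t}" "(p, q) \<in> E" "(q, s) \<in> E" "(s, t) \<in> E"
    "q \<noteq> r" "par q = p" "s \<noteq> r" "par s = q" "t \<noteq> r" "par t = s"
  | p q s t where "distinct [p, q, s, t]" "Q = {p, q, s, t}" "(p, q) \<in> E" "(q, s) \<in> E" "(s, t) \<in> E"
    "p \<noteq> r" "par p = q" "s \<noteq> r" "par s = q" "t \<noteq> r" "par t = s"
proof -
  obtain p q s t where Q: "distinct [p, q, s, t]" "Q = {p, q, s, t}" "(p, q) \<in> E" "(q, s) \<in> E" "(s, t) \<in> E"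
    using assms(1) unfolding quad_def by metis
  have rev: "distinct [t, s, q, p]" "Q = {t, s, q, p}" "(t, s) \<in> E" "(s, q) \<in> E" "(q, p) \<in> E"
    using Q by (auto intro: edge_sym)
  show ?thesis
  proof (rule edge_cases[OF Q(3)])
    assume pq: "q \<noteq> r" "p = par q"
    show ?thesis
    proof (rule edge_cases[OF Q(4)])
      assume qs: "s \<noteq> r" "q = par s"
      have "t \<noteq> r \<and> s = par t" using Q(1) qs(2) by (rule_tac edge_cases[OF Q(5)]) auto
      then show ?thesis using that(1)[OF Q pq(1) pq(2)[symmetric] qs(1) qs(2)[symmetric]] by blast
    next
      assume "q \<noteq> r" "s = par q"
      then show ?thesis using pq(2) Q(1) by simp
    qed
  next
    assume pq: "p \<noteq> r" "q = par p"
    show ?thesis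
    proof (rule edge_cases[OF Q(4)])
      assume qs: "s \<noteq> r" "q = par s"
      have "t \<noteq> r \<and> s = par t" using Q(1) qs(2) by (rule_tac edge_cases[OF Q(5)]) auto
      then show ?thesis using that(2)[OF Q pq(1) pq(2)[symmetric] qs(1) qs(2)[symmetric]] by blast
    next
      assume qs: "q \<noteq> r" "s = par q"
      show ?thesis
      proof (rule edge_cases[OF Q(5)])
        assume "t \<noteq> r" "s = par t"
        then show ?thesis
          using that(2)[OF rev _ _ qs(1) qs(2)[symmetric] pq(1) pq(2)[symmetric]] by blast
      next
        assume "s \<noteq> r" "t = par s"
        then show ?thesis
          using that(1)[OF rev _ _ qs(1) qs(2)[symmetric] pq(1) pq(2)[symmetric]] by blast
      qed
    qed
  qed
qed

end

section \<open>Block partitions\<close>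

locale rooted_blocks = rooted_tree +
  fixes \<B> :: "'a set set"
  assumes part: "block_partition V E \<B>" and card_V: "3 \<le> card V"
begin

text \<open>Every block has exactly one head, its vertex closest to the root.\<close>

definition heads :: "'a set" where
  "heads = {v \<in> V. v = r \<or> (\<forall>B\<in>\<B>. v \<in> B \<longrightarrow> par v \<notin> B)}"

lemma block_sub: "B \<in> \<B> \<Longrightarrow> B \<subseteq> V"
  using part by (auto simp: block_partition_def)

lemma block_eq: "B \<in> \<B> \<Longrightarrow> B' \<in> \<B> \<Longrightarrow> v \<in> B \<Longrightarrow> v \<in> B' \<Longrightarrow> B = B'"
  using part unfolding block_partition_def pairwise_def disjnt_def by blast

lemma ex_block: "v \<in> V \<Longrightarrow> \<exists>B\<in>\<B>. v \<in> B"
  using part unfolding block_partition_def by blast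

lemma block_kind: "B \<in> \<B> \<Longrightarrow> pair_block E B \<or> quad_block E B"
  using part unfolding block_partition_def by blast

lemma heads_iff: "B \<in> \<B> \<Longrightarrow> v \<in> B \<Longrightarrow> v \<in> heads \<longleftrightarrow> v = r \<or> par v \<notin> B"
  using block_sub block_eq unfolding heads_def by blast

lemma r_head: "r \<in> heads"
  by (simp add: heads_def r_in)

lemma two_le_card: "2 \<le> card V"
  using card_V by simp

text \<open>A vertex of least depth in the block is a head. Since the block is a path, every other
  vertex in it has its parent there.\<close>

lemma heads_single:
  assumes "B \<in> \<B>"
  shows "\<exists>h\<in>B. B \<inter> heads = {h}"
proof -
  have par: "h \<in> heads"
    if h: "h \<in> B" "\<forall>v\<in>B. dep h \<le> dep v" for h
    unfolding heads_iff[OF assms h(1)]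
  proof (rule disjCI)
    assume "\<not> par h \<notin> B"
    then have "dep h \<le> dep (par h)" using h(2) by blast
    then show "h = r" using dep_par[of h] block_sub[OF assms] h(1) by fastforce
  qed
  have deep: "dep (par v) < dep v" if "v \<in> B" "v \<noteq> r" for v
    using dep_par[of v] that block_sub[OF assms] by auto
  have not: "v \<notin> heads" if "v \<in> B" "v \<noteq> r" "par v \<in> B" for v
    using heads_iff[OF assms that(1)] that by simp
  show ?thesis
    using block_kind[OF assms]
  proof
    assume "pair_block E B"
    then obtain a c where ac: "a \<noteq> c" "B = {a, c}" "(a, c) \<in> E" unfolding pair_block_def by blast
    show ?thesis
    proof (rule edge_cases[OF ac(3)])
      assume *: "c \<noteq> r" "a = par c"
      then have "a \<in> heads" "c \<notin> heads" using ac par[of a] not[of c] deep[of c] by auto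
      then show ?thesis using ac by auto
    next
      assume *: "a \<noteq> r" "c = par a"
      then have "c \<in> heads" "a \<notin> heads" using ac par[of c] not[of a] deep[of a] by auto
      then show ?thesis using ac by auto
    qed
  next
    assume "quad_block E B"
    then have "quad E B" by (simp add: quad_block_def)
    from this block_sub[OF assms] show ?thesis
    proof (cases rule: quad_cases)
      case (1 p q s t)
      then have "q \<notin> heads" "s \<notin> heads" "t \<notin> heads" using not by auto
      moreover have "p \<in> heads" using par[of p] deep[of q] deep[of s] deep[of t] 1 by auto
      ultimately show ?thesis using 1(2) by auto
    next
      case (2 p q s t)
      then have "p \<notin> heads" "s \<notin> heads" "t \<notin> heads" using not by auto
      moreover have "q \<in> heads" using par[of q] deep[of p] deep[of s] deep[of t] 2 by auto
      ultimately show ?thesis using 2(2) by auto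
    qed
  qed
qed

lemma finite_blocks: "finite \<B>"
  by (rule finite_subset[of _ "Pow V"]) (use block_sub finite_V in auto)

lemma card_heads: "card heads \<le> card \<B>"
proof -
  obtain h where h: "\<And>B. B \<in> \<B> \<Longrightarrow> B \<inter> heads = {h B}"
    using heads_single by metis
  have "heads \<subseteq> h ` \<B>"
  proof
    fix v assume v: "v \<in> heads"
    then obtain B where "B \<in> \<B>" "v \<in> B" using ex_block unfolding heads_def by blast
    then show "v \<in> h ` \<B>" using h[of B] v by blast
  qed
  then show ?thesis
    using finite_blocks by (meson card_image_le card_mono finite_imageI le_trans)
qed

text \<open>Blocks meet only through heads: the lower end of an edge between two blocks has its
  parent outside its own block.\<close>

lemma ext_nbr:
  assumes "B \<in> \<B>" "v \<in> B" "(v, y) \<in> E" "y \<notin> B"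
  shows "y = par v \<and> v \<noteq> r \<and> v \<in> heads \<or> y \<in> heads - {r}"
  using assms(3)
proof (cases rule: edge_cases)
  case down
  obtain B' where B': "B' \<in> \<B>" "y \<in> B'" using ex_block edge_in assms(3) by blast
  then have "v \<notin> B'" using block_eq[OF assms(1) B'(1) assms(2)] assms(4) by blast
  then show ?thesis using heads_iff[OF B'] down by simp
next
  case up
  then show ?thesis using heads_iff[OF assms(1,2)] assms(4) by simp
qed

lemma ext_nbr_nonhead:
  assumes "B \<in> \<B>" "v \<in> B" "v \<notin> heads - {r}" "(v, y) \<in> E" "y \<notin> B"
  shows "y \<in> heads - {r}"
  using ext_nbr[OF assms(1,2,4,5)] assms(3) by blast

text \<open>A vertex that is not a leaf has a second neighbour, and inside the block such a
  neighbour would close a cycle.\<close>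

lemma quad_end_nbr:
  assumes "B \<in> \<B>" "B = {p, q, s, t}" "distinct [p, q, s, t]"
    "(p, q) \<in> E" "(q, s) \<in> E" "(s, t) \<in> E" "\<not> leaf E t"
  shows "\<exists>y. (t, y) \<in> E \<and> y \<notin> B"
proof -
  have "card {s} < deg E t" using deg_ge_2[OF two_le_card _ assms(7)] block_sub[OF assms(1)] assms(2) by auto
  then obtain y where y: "(t, y) \<in> E" "y \<notin> {s}" using nbr_outside[of "{s}" E t] by auto
  moreover have "y \<noteq> p" "y \<noteq> q" "y \<noteq> t"
    using path_induced[OF assms(4-6)] assms(3) y edge_sym[OF y(1)] no_loop by auto
  ultimately show ?thesis using assms(2) by blast
qed

text \<open>Every block other than \<open>R\<close> keeps its head. In a quad, the end
  \<open>t\<close> away from the head is not a leaf and so is adjacent to the head of a block below;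
  these two heads together dominate the four vertices. Hence dropping \<open>r\<close> can only hurt
  the root block.\<close>

lemma heads_dominate:
  assumes "R \<in> \<B>" "r \<in> R" and dom: "\<And>v. v \<in> R \<Longrightarrow> dominated E (heads - {r}) v"
    and v: "v \<in> V"
  shows "dominated E (heads - {r}) v"
proof -
  obtain B where B: "B \<in> \<B>" "v \<in> B" using ex_block v by blast
  show ?thesis
  proof (cases "B = R")
    case True
    then show ?thesis using dom B by simp
  next
    case False
    then have "r \<notin> B" using block_eq[OF B(1) assms(1)] assms(2) by blast
    then have mem: "x \<in> heads - {r}" if "x \<in> B" "x \<in> heads" for x using that by auto
    obtain h where h: "h \<in> B" "B \<inter> heads = {h}" using heads_single[OF B(1)] by blast
    then have hD: "h \<in> heads - {r}" using mem by blast
    show ?thesis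
      using block_kind[OF B(1)]
    proof
      assume "pair_block E B"
      then have "v = h \<or> (v, h) \<in> E" using B(2) h(1) edge_sym unfolding pair_block_def by auto
      then show ?thesis using hD dominated_self dominated_nbr by metis
    next
      assume qb: "quad_block E B"
      then have "quad E B" and nl: "\<And>x. x \<in> B \<Longrightarrow> \<not> leaf E x" by (auto simp: quad_block_def)
      from this(1) block_sub[OF B(1)] show ?thesis
      proof (cases rule: quad_cases)
        case (1 p q s t)
        have "q \<notin> heads" "s \<notin> heads" "t \<notin> heads" using heads_iff[OF B(1)] 1 by simp_all
        then have "h = p" using h 1(2) by auto
        obtain y where y: "(t, y) \<in> E" "y \<notin> B"
          using quad_end_nbr[OF B(1) 1(2,1,3-5)] nl 1(2) by blast
        have yD: "y \<in> heads - {r}" using ext_nbr_nonhead[OF B(1) _ _ y] \<open>t \<notin> heads\<close> 1(2) by simp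
        have "p \<noteq> y" using y 1(2) by blast
        have "dominated E (heads - {r}) q" "dominated E (heads - {r}) t" "dominated E (heads - {r}) p"
          using dominated_nbr[OF hD, of q E] dominated_nbr[OF yD y(1)] dominated_self[OF hD, of E]
            edge_sym[OF 1(3)] \<open>h = p\<close> by simp_all
        \<comment> \<open>\<open>s\<close> sees the head \<open>p\<close> through \<open>q\<close>
          and the head \<open>y\<close> of a lower block through \<open>t\<close>.\<close>
        moreover have "dominated E (heads - {r}) s"
          using dominated_two[of p _ y s q E t] hD yD \<open>p \<noteq> y\<close> \<open>h = p\<close> 1 y edge_sym by simp
        ultimately show ?thesis using B(2) 1(2) by auto
      next
        case (2 p q s t)
        have "p \<notin> heads" "s \<notin> heads" "t \<notin> heads" using heads_iff[OF B(1)] 2 by simp_all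
        then have "h = q" using h 2(2) by auto
        obtain y where y: "(t, y) \<in> E" "y \<notin> B"
          using quad_end_nbr[OF B(1) 2(2,1,3-5)] nl 2(2) by blast
        have yD: "y \<in> heads - {r}" using ext_nbr_nonhead[OF B(1) _ _ y] \<open>t \<notin> heads\<close> 2(2) by simp
        have "dominated E (heads - {r}) p" "dominated E (heads - {r}) t" "dominated E (heads - {r}) q"
          "dominated E (heads - {r}) s"
          using dominated_nbr[OF hD, of p E] dominated_nbr[OF hD, of s E] dominated_nbr[OF yD y(1)]
            dominated_self[OF hD, of E] 2(3) edge_sym[OF 2(4)] \<open>h = q\<close> by simp_all
        then show ?thesis using B(2) 2(2) by auto
      qed
    qed
  qed
qed

lemma card_heads_less: "card (heads - {r}) < card \<B>"
proof -
  have "finite heads" using finite_V by (simp add: heads_def)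
  then have "card (heads - {r}) < card heads" using r_head by (intro psubset_card_mono) auto
  then show ?thesis using card_heads by simp
qed

lemma root_ext_nbr:
  assumes "R \<in> \<B>" "r \<in> R" "v \<in> R" "(v, y) \<in> E" "y \<notin> R"
  shows "y \<in> heads - {r}"
proof -
  obtain h where h: "R \<inter> heads = {h}" using heads_single[OF assms(1)] by blast
  then have "r = h" using r_head assms(2) by blast
  then have "heads \<inter> R = {r}" using h by blast
  then show ?thesis using ext_nbr_nonhead[OF assms(1,3) _ assms(4,5)] assms(3) by blast
qed

text \<open>Two further neighbours of \<open>r\<close> are heads of other blocks. Either one
  dominates \<open>r\<close>, and both together dominate \<open>c\<close> through
  \<open>r\<close>.\<close>

lemma drop_pair:
  assumes "{r, c} \<in> \<B>" "(r, c) \<in> E" "3 \<le> deg E r" "v \<in> V"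
  shows "dominated E (heads - {r}) v"
proof -
  have "card {c} < deg E r" using assms(3) by simp
  then obtain y where y: "(r, y) \<in> E" "y \<notin> {c}" using nbr_outside[of "{c}" E r] by auto
  have "card {c, y} < deg E r" using assms(3) by (simp add: card_insert_if)
  then obtain z where z: "(r, z) \<in> E" "z \<notin> {c, y}" using nbr_outside[of "{c, y}" E r] by auto
  have D: "y \<in> heads - {r}" "z \<in> heads - {r}"
    using root_ext_nbr[OF assms(1) _ _ y(1)] root_ext_nbr[OF assms(1) _ _ z(1)] y z no_loop by auto
  have "dominated E (heads - {r}) r" using dominated_nbr[OF D(1) y(1)] .
  moreover have "dominated E (heads - {r}) c"
    using dominated_two[OF D _ edge_sym[OF assms(2)] y(1) edge_sym[OF assms(2)] z(1)] z(2) by blast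
  ultimately show ?thesis using heads_dominate[OF assms(1)] assms(4) by auto
qed

text \<open>With the root in the block, all outside neighbours are heads. \<open>p\<close>,
  \<open>q\<close> and \<open>t\<close> have one each, and \<open>s\<close> lies between those of
  \<open>q\<close> and \<open>t\<close>.\<close>

lemma drop_quad_inner:
  assumes B: "{p, q, s, t} \<in> \<B>" "quad_block E {p, q, s, t}" "distinct [p, q, s, t]"
    "(p, q) \<in> E" "(q, s) \<in> E" "(s, t) \<in> E" and q: "3 \<le> deg E q" and "r = q" "v \<in> V"
  shows "dominated E (heads - {r}) v"
proof -
  let ?Q = "{p, q, s, t}"
  have ext: "y \<in> heads - {r}" if "x \<in> ?Q" "(x, y) \<in> E" "y \<notin> ?Q" for x y
    using root_ext_nbr[OF B(1) _ that] \<open>r = q\<close> by simp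
  note ind = path_induced[OF B(4-6)]
  have nl: "\<not> leaf E p" "\<not> leaf E t" using B(2) by (auto simp: quad_block_def)
  have "card {p, s} < deg E q" using q by (simp add: card_insert_if)
  then obtain y where y: "(q, y) \<in> E" "y \<notin> {p, s}" using nbr_outside[of "{p, s}" E q] by auto
  have yQ: "y \<notin> ?Q" using y ind B(3) no_loop by auto
  obtain z where z: "(t, z) \<in> E" "z \<notin> ?Q" using quad_end_nbr[OF B(1) refl B(3-6) nl(2)] by blast
  have "?Q = {t, s, q, p}" by auto
  then obtain w where w: "(p, w) \<in> E" "w \<notin> ?Q"
    using quad_end_nbr[of ?Q t s q p] B(1,3-6) nl(1) edge_sym by auto
  have D: "y \<in> heads - {r}" "z \<in> heads - {r}" "w \<in> heads - {r}"
    using ext[OF _ y(1) yQ] ext[OF _ z] ext[OF _ w] by simp_all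
  have "dominated E (heads - {r}) p" "dominated E (heads - {r}) q" "dominated E (heads - {r}) t"
    using dominated_nbr[OF D(3) w(1)] dominated_nbr[OF D(1) y(1)] dominated_nbr[OF D(2) z(1)] by simp_all
  moreover have "dominated E (heads - {r}) s"
    using dominated_halves[OF edge_sym[OF B(5)] B(6) _ D(1) y(1) D(2) z(1)] B(3) by simp
  ultimately show ?thesis using heads_dominate[OF B(1)] \<open>r = q\<close> \<open>v \<in> V\<close> by auto
qed

text \<open>Each end has two outside neighbours, which are heads. One of them dominates the end, and
  both together dominate the inner vertex next to it.\<close>

lemma drop_quad_ends:
  assumes B: "{p, q, s, t} \<in> \<B>" "distinct [p, q, s, t]"
    "(p, q) \<in> E" "(q, s) \<in> E" "(s, t) \<in> E" and deg: "3 \<le> deg E p" "3 \<le> deg E t" and "r = p" "v \<in> V"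
  shows "dominated E (heads - {r}) v"
proof -
  let ?Q = "{p, q, s, t}"
  have ext: "y \<in> heads - {r}" if "x \<in> ?Q" "(x, y) \<in> E" "y \<notin> ?Q" for x y
    using root_ext_nbr[OF B(1) _ that] \<open>r = p\<close> by simp
  note ind = path_induced[OF B(3-5)]
  have two: "\<exists>y z. (x, y) \<in> E \<and> (x, z) \<in> E \<and> y \<noteq> z \<and> y \<noteq> e \<and> z \<noteq> e" if "3 \<le> deg E x" for x e
  proof -
    have "card {e} < deg E x" using that by simp
    then obtain y where y: "(x, y) \<in> E" "y \<notin> {e}" using nbr_outside[of "{e}" E x] by auto
    have "card {e, y} < deg E x" using that by (simp add: card_insert_if)
    then obtain z where z: "(x, z) \<in> E" "z \<notin> {e, y}" using nbr_outside[of "{e, y}" E x] by auto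
    show ?thesis using y z by blast
  qed
  obtain y z where yz: "(p, y) \<in> E" "(p, z) \<in> E" "y \<noteq> z" "y \<noteq> q" "z \<noteq> q" using two[OF deg(1)] by blast
  obtain y' z' where yz': "(t, y') \<in> E" "(t, z') \<in> E" "y' \<noteq> z'" "y' \<noteq> s" "z' \<noteq> s" using two[OF deg(2)] by blast
  have "(t, p) \<notin> E" "(t, q) \<notin> E" using ind edge_sym B(2) by auto
  then have "y \<notin> ?Q" "z \<notin> ?Q" "y' \<notin> ?Q" "z' \<notin> ?Q" using yz yz' ind B(2) no_loop by auto
  then have D: "y \<in> heads - {r}" "z \<in> heads - {r}" "y' \<in> heads - {r}" "z' \<in> heads - {r}"
    using ext[OF _ yz(1)] ext[OF _ yz(2)] ext[OF _ yz'(1)] ext[OF _ yz'(2)] by simp_all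
  have "dominated E (heads - {r}) p" "dominated E (heads - {r}) t"
    using dominated_nbr[OF D(1) yz(1)] dominated_nbr[OF D(3) yz'(1)] by simp_all
  moreover have "dominated E (heads - {r}) q"
    using dominated_two[OF D(1,2) yz(3) edge_sym[OF B(3)] yz(1) edge_sym[OF B(3)] yz(2)] .
  moreover have "dominated E (heads - {r}) s"
    using dominated_two[OF D(3,4) yz'(3) B(5) yz'(1) B(5) yz'(2)] .
  ultimately show ?thesis using heads_dominate[OF B(1)] \<open>r = p\<close> \<open>v \<in> V\<close> by auto
qed

end

section \<open>Degrees in a partition with few blocks\<close>

definition thin_pair :: "('a \<times> 'a) set \<Rightarrow> 'a set \<Rightarrow> bool" where
  "thin_pair E B \<longleftrightarrow> (\<exists>a c. B = {a, c} \<and> (a, c) \<in> E \<and> deg E c = 1 \<and> deg E a = 2)"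

definition thin_quad :: "('a \<times> 'a) set \<Rightarrow> 'a set \<Rightarrow> bool" where
  "thin_quad E B \<longleftrightarrow> (\<exists>p q s t. distinct [p, q, s, t] \<and> B = {p, q, s, t} \<and>
     (p, q) \<in> E \<and> (q, s) \<in> E \<and> (s, t) \<in> E \<and>
     deg E p = 2 \<and> deg E q = 2 \<and> deg E s = 2 \<and> 2 \<le> deg E t)"

text \<open>By \<open>no_drop\<close>, no root makes the remaining heads a dominating set, as these
  are fewer than the blocks and hence fewer than the minimum. Rooting at \<open>a\<close>,
  \<open>q\<close> or \<open>p\<close> in turn lets one of the three \<open>drop\<close> lemmas
  contradict this. The first root \<open>x\<close> is arbitrary and only gives access to facts about
  degrees.\<close>

lemma blocks_thin:
  assumes T: "tree V E" and n: "3 \<le> card V" and part: "block_partition V E \<B>"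
    and min: "card \<B> \<le> gamma_2d V E" and B: "B \<in> \<B>"
  shows "thin_pair E B \<or> thin_quad E B"
proof -
  have fin: "finite V" and con: "connected_graph V E" using T by (auto simp: tree_def graph_def)
  have no_drop: False
    if "x \<in> B" "\<And>par dep v. rooted_blocks V E x par dep \<B> \<Longrightarrow> v \<in> V \<Longrightarrow>
      dominated E (rooted_blocks.heads V x par \<B> - {x}) v" for x
  proof -
    have "x \<in> V" using B that(1) part by (auto simp: block_partition_def)
    then obtain par dep where "rooted_tree V E x par dep" using tree_rooted[OF T] by blast
    then interpret rooted_blocks V E x par dep \<B>
      using part n by (simp add: rooted_blocks_def rooted_blocks_axioms_def)
    have "gamma_2d V E \<le> card (heads - {x})"
      using that(2)[OF rooted_blocks_axioms]
      by (intro gamma_2d_le[OF fin con]) (auto simp: heads_def)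
    then show False using card_heads_less min by simp
  qed
  have "B \<noteq> {}" "B \<subseteq> V"
    using B part by (auto simp: block_partition_def pair_block_def quad_block_def quad_def)
  then obtain x where x: "x \<in> B" "x \<in> V" by blast
  obtain par dep where "rooted_tree V E x par dep" using tree_rooted[OF T x(2)] by blast
  then interpret rooted_blocks V E x par dep \<B>
    using part n by (simp add: rooted_blocks_def rooted_blocks_axioms_def)
  note deg2 = deg_ge_2[OF two_le_card]
  have sub: "B \<subseteq> V" using block_sub[OF B] .
  show ?thesis
    using block_kind[OF B]
  proof
    assume "pair_block E B"
    then obtain a c where ac: "a \<noteq> c" "B = {a, c}" "(a, c) \<in> E" "leaf E c"
      unfolding pair_block_def by blast
    have "\<not> leaf E a" using leaf_nbr_not_leaf[OF n edge_sym[OF ac(3)] ac(4)] .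
    then have "2 \<le> deg E a" using deg2 sub ac(2) by simp
    moreover have "\<not> 3 \<le> deg E a"
    proof
      assume "3 \<le> deg E a"
      then have "dominated E (rooted_blocks.heads V a par \<B> - {a}) v"
        if "rooted_blocks V E a par dep \<B>" "v \<in> V" for par dep v
        using rooted_blocks.drop_pair[OF that(1)] B ac that(2) by simp
      then show False using no_drop[of a] ac(2) by blast
    qed
    ultimately show ?thesis using ac unfolding thin_pair_def leaf_def by (intro disjI1 exI[of _ a] exI[of _ c]) simp
  next
    assume qb: "quad_block E B"
    then obtain p q s t where Q: "distinct [p, q, s, t]" "B = {p, q, s, t}" "(p, q) \<in> E" "(q, s) \<in> E" "(s, t) \<in> E"
      unfolding quad_block_def quad_def by blast
    have rev: "distinct [t, s, q, p]" "B = {t, s, q, p}" "(t, s) \<in> E" "(s, q) \<in> E" "(q, p) \<in> E"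
      using Q by (auto intro: edge_sym)
    have ge: "2 \<le> deg E x" if "x \<in> B" for x
      using deg2[of x] qb sub that by (auto simp: quad_block_def)
    have inner: "deg E q = 2"
      if "distinct [p, q, s, t]" "B = {p, q, s, t}" "(p, q) \<in> E" "(q, s) \<in> E" "(s, t) \<in> E" for p q s t
    proof (rule ccontr)
      assume "deg E q \<noteq> 2"
      then have "3 \<le> deg E q" using ge[of q] that(2) by simp
      then have "dominated E (rooted_blocks.heads V q par \<B> - {q}) v"
        if "rooted_blocks V E q par dep \<B>" "v \<in> V" for par dep v
        using rooted_blocks.drop_quad_inner[OF that(1), of p q s t v] B qb that(2)
          \<open>distinct [p, q, s, t]\<close> \<open>B = {p, q, s, t}\<close> \<open>(p, q) \<in> E\<close> \<open>(q, s) \<in> E\<close> \<open>(s, t) \<in> E\<close> by simp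
      then show False using no_drop[of q] that(2) by blast
    qed
    have ends: "deg E p = 2 \<or> deg E t = 2"
    proof (rule ccontr)
      assume "\<not> ?thesis"
      then have "3 \<le> deg E p" "3 \<le> deg E t" using ge[of p] ge[of t] Q(2) by auto
      then have "dominated E (rooted_blocks.heads V p par \<B> - {p}) v"
        if "rooted_blocks V E p par dep \<B>" "v \<in> V" for par dep v
        using rooted_blocks.drop_quad_ends[OF that(1), of p q s t v] B that(2) Q by simp
      then show False using no_drop[of p] Q(2) by blast
    qed
    have d: "deg E q = 2" "deg E s = 2" using inner[OF Q] inner[OF rev] by simp_all
    have g: "2 \<le> deg E p" "2 \<le> deg E t" using ge Q(2) by simp_all
    from ends have "thin_quad E B"
    proof
      assume "deg E p = 2"
      then show ?thesis unfolding thin_quad_def using Q d g by blast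
    next
      assume "deg E t = 2"
      then show ?thesis unfolding thin_quad_def using rev d g by blast
    qed
    then show ?thesis ..
  qed
qed

section \<open>The lower bound for labelled trees\<close>

text \<open>The common core of \<open>corr_of_A\<close> and \<open>corr_of_B\<close>; a single
  relation then serves the invariant for both operations.\<close>

definition corr :: "('a \<times> 'a) set \<Rightarrow> ('a \<Rightarrow> status) \<Rightarrow> ('a \<times> 'a) set" where
  "corr E S = {(a, b). \<exists>c d. (a, c) \<in> E \<and> (c, d) \<in> E \<and> (d, b) \<in> E \<and> S a = SA \<and> S c = SC \<and> S d = SD \<and> S b = SB}"

definition uniq :: "('a \<times> 'a) set \<Rightarrow> ('a \<Rightarrow> status) \<Rightarrow> status \<Rightarrow> status \<Rightarrow> bool" where
  "uniq E S x y \<longleftrightarrow> (\<forall>v u w. (v, u) \<in> E \<longrightarrow> (v, w) \<in> E \<longrightarrow> S v = x \<longrightarrow> S u = y \<longrightarrow> S w = y \<longrightarrow> u = w)"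

definition cnt :: "'a set \<Rightarrow> ('a \<Rightarrow> status) \<Rightarrow> status \<Rightarrow> nat" where
  "cnt V S x = card {v \<in> V. S v = x}"

lemma cnt_insert:
  assumes "finite V" "u \<notin> V"
  shows "cnt (insert u V) (S(u := y)) x = cnt V S x + (if x = y then 1 else 0)"
proof -
  have "{v \<in> insert u V. (S(u := y)) v = x} = (if x = y then insert u else id) {v \<in> V. S v = x}"
    using assms(2) by auto
  then show ?thesis using assms by (simp add: cnt_def)
qed

lemma uniqD: "uniq E S x y \<Longrightarrow> (v, u) \<in> E \<Longrightarrow> (v, w) \<in> E \<Longrightarrow> S v = x \<Longrightarrow> S u = y \<Longrightarrow> S w = y \<Longrightarrow> u = w"
  unfolding uniq_def by blast

text \<open>The invariants of the family that do not concern domination. \<open>uniq\<close> makes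
  partners under \<open>corr\<close> unique in both directions, \<open>deg2\<close> shows that a
  vertex extended by O2 or O4 reaches degree three, \<open>C_nbr\<close> supplies the neighbour of
  the leaf extended by O3, and \<open>counts\<close> enters the final computation.\<close>

locale labelled =
  fixes V :: "'a set" and E :: "('a \<times> 'a) set" and S :: "'a \<Rightarrow> status" and P :: "'a set"
  assumes fin: "finite V" and sub: "E \<subseteq> V \<times> V" and sym: "sym E" and P_sub: "P \<subseteq> V"
    and nbr: "\<And>v. v \<in> V \<Longrightarrow> \<exists>u. (v, u) \<in> E"
    and deg2: "\<And>v. v \<in> V \<Longrightarrow> S v \<noteq> SC \<Longrightarrow> \<exists>x y. (v, x) \<in> E \<and> (v, y) \<in> E \<and> x \<noteq> y"
    and C_nbr: "\<And>c. c \<in> V \<Longrightarrow> S c = SC \<Longrightarrow> \<exists>a. (c, a) \<in> E \<and> S a = SA"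
    and uniq: "uniq E S SA SC" "uniq E S SC SA" "uniq E S SC SD" "uniq E S SD SC" "uniq E S SD SB" "uniq E S SB SD"
    and counts: "cnt V S SC = cnt V S SA" "cnt V S SD = cnt V S SB" "num_leaves V E + cnt V S SB \<le> cnt V S SA"
begin

lemma edge_in: "(x, y) \<in> E \<Longrightarrow> x \<in> V" "(x, y) \<in> E \<Longrightarrow> y \<in> V"
  using sub by auto

lemma edge_sym: "(x, y) \<in> E \<Longrightarrow> (y, x) \<in> E"
  using sym by (rule symD)

lemma corr_unique_right: "(a, b) \<in> corr E S \<Longrightarrow> (a, b') \<in> corr E S \<Longrightarrow> b = b'"
proof -
  assume "(a, b) \<in> corr E S" "(a, b') \<in> corr E S"
  then obtain c d c' d' where p: "(a, c) \<in> E" "(c, d) \<in> E" "(d, b) \<in> E" "S a = SA" "S c = SC" "S d = SD" "S b = SB"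
    and p': "(a, c') \<in> E" "(c', d') \<in> E" "(d', b') \<in> E" "S c' = SC" "S d' = SD" "S b' = SB"
    unfolding corr_def by blast
  have "c = c'" using uniqD[OF uniq(1) p(1) p'(1)] p p' by simp
  then have "d = d'" using uniqD[OF uniq(3) p(2), of d'] p p' by simp
  then show "b = b'" using uniqD[OF uniq(5) p(3), of b'] p p' by simp
qed

lemma corr_unique_left: "(a, b) \<in> corr E S \<Longrightarrow> (a', b) \<in> corr E S \<Longrightarrow> a = a'"
proof -
  assume "(a, b) \<in> corr E S" "(a', b) \<in> corr E S"
  then obtain c d c' d' where p: "(c, a) \<in> E" "(d, c) \<in> E" "(b, d) \<in> E" "S a = SA" "S c = SC" "S d = SD" "S b = SB"
    and p': "(c', a') \<in> E" "(d', c') \<in> E" "(b, d') \<in> E" "S c' = SC" "S d' = SD" "S a' = SA"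
    unfolding corr_def using edge_sym by blast
  have "d = d'" using uniqD[OF uniq(6) p(3) p'(3)] p p' by simp
  then have "c = c'" using uniqD[OF uniq(4) p(2), of c'] p p' by simp
  then show "a = a'" using uniqD[OF uniq(2) p(1), of a'] p p' by simp
qed

lemma corr_labels: "(a, b) \<in> corr E S \<Longrightarrow> S a = SA \<and> S b = SB \<and> a \<in> V \<and> b \<in> V"
  unfolding corr_def using edge_in by blast

end

text \<open>In \<open>free_bound\<close> the closed neighbourhoods of the vertices in \<open>X\<close> need not be dominated. The set
  \<open>X\<close> stands for the vertices to which pairs have been attached by the operations \<open>op2\<close> and \<open>op4\<close>.\<close>

definition allowed :: "'a set \<Rightarrow> ('a \<times> 'a) set \<Rightarrow> ('a \<Rightarrow> status) \<Rightarrow> 'a set \<Rightarrow> 'a set \<Rightarrow> bool" where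
  "allowed V E S P X \<longleftrightarrow> X \<subseteq> V \<and>
     (\<forall>x\<in>X. S x = SB \<or> S x = SA \<and> x \<notin> P \<and> x \<in> Domain (corr E S)) \<and>
     (\<forall>(a, b)\<in>corr E S. deg E a = 2 \<and> a \<notin> X \<or> deg E b = 2 \<and> b \<notin> X)"

definition free_bound :: "'a set \<Rightarrow> ('a \<times> 'a) set \<Rightarrow> ('a \<Rightarrow> status) \<Rightarrow> 'a set \<Rightarrow> bool" where
  "free_bound V E S P \<longleftrightarrow> (\<forall>X D. allowed V E S P X \<longrightarrow> D \<subseteq> V \<longrightarrow>
     (\<forall>v\<in>V. v \<in> X \<or> (\<exists>x\<in>X. (v, x) \<in> E) \<or> dominated E D v) \<longrightarrow> cnt V S SA \<le> card D)"

section \<open>The invariants under O2 and O4, which add the same path and differ only in the status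
  of \<open>v\<close>\<close>

locale pair_ext = labelled +
  fixes v u1 u2 :: 'a
  assumes v: "v \<in> V" "S v = SA \<or> S v = SB" and fresh: "u1 \<notin> V" "u2 \<notin> V" "u1 \<noteq> u2"
begin

definition "V' = V \<union> {u1, u2}"
definition "E' = E \<union> sym_edges {(u1, v), (u1, u2)}"
definition "S' = S(u1 := SA, u2 := SC)"

lemma nb_u1: "(u1, y) \<in> E' \<longleftrightarrow> y = v \<or> y = u2"
  using fresh v edge_in by (auto simp: E'_def sym_edges_def)

lemma nb_u2: "(u2, y) \<in> E' \<longleftrightarrow> y = u1"
  using fresh v edge_in by (auto simp: E'_def sym_edges_def)

lemma nb_v: "(v, y) \<in> E' \<longleftrightarrow> (v, y) \<in> E \<or> y = u1"
  using fresh v edge_in by (auto simp: E'_def sym_edges_def)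

lemma nb_old: "x \<noteq> v \<Longrightarrow> x \<in> V \<Longrightarrow> (x, y) \<in> E' \<longleftrightarrow> (x, y) \<in> E"
  using fresh v edge_in by (auto simp: E'_def sym_edges_def)

lemma E'_cases:
  assumes "(x, y) \<in> E'"
  obtains "(x, y) \<in> E" "x \<in> V" "y \<in> V" | "x = v" "y = u1" | "x = u1" "y = v" | "x = u1" "y = u2" | "x = u2" "y = u1"
  using assms edge_in unfolding E'_def sym_edges_def by blast

lemma S'_simps [simp]: "S' u1 = SA" "S' u2 = SC" "x \<in> V \<Longrightarrow> S' x = S x"
  using fresh by (auto simp: S'_def)

text \<open>The excluded statuses are those of the new edge at \<open>v\<close>: \<open>v\<close>
  gains a neighbour of status A, and \<open>u1\<close> itself has the neighbour \<open>v\<close> of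
  status A or B.\<close>

lemma uniq':
  assumes "uniq E S x y" "\<not> (x = S v \<and> y = SA)" "x \<noteq> SA \<or> y \<noteq> SA" "x \<noteq> SA \<or> y \<noteq> SB" 
  shows "uniq E' S' x y"
  unfolding uniq_def
proof (intro allI impI)
  fix p q r assume p: "(p, q) \<in> E'" "(p, r) \<in> E'" "S' p = x" "S' q = y" "S' r = y"
  show "q = r"
    by (rule E'_cases[OF p(1)]; rule E'_cases[OF p(2)])
      (use p v fresh assms uniqD[OF assms(1), of p q r] in auto)
qed

lemma labelled': "labelled V' E' S' P"
proof
  show "finite V'" "P \<subseteq> V'" using fin P_sub by (auto simp: V'_def)
  show "E' \<subseteq> V' \<times> V'"
  proof
    fix e assume "e \<in> E'"
    then have "(fst e, snd e) \<in> E'" by simp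
    then have "fst e \<in> V' \<and> snd e \<in> V'" by (rule E'_cases) (use v in \<open>auto simp: V'_def\<close>)
    then show "e \<in> V' \<times> V'" by (simp add: mem_Times_iff)
  qed
  show "sym E'"
    using sym by (auto simp: E'_def sym_edges_def sym_def)
  show "\<exists>u. (x, u) \<in> E'" if "x \<in> V'" for x
    using that nbr nb_u1 nb_u2 unfolding V'_def E'_def by blast
  show "\<exists>p q. (x, p) \<in> E' \<and> (x, q) \<in> E' \<and> p \<noteq> q" if x: "x \<in> V'" "S' x \<noteq> SC" for x
  proof (cases "x = u1")
    case True
    then show ?thesis using nb_u1 v fresh by blast
  next
    case False
    then have "x \<in> V" using x by (auto simp: V'_def)
    then show ?thesis using x(2) deg2[of x] unfolding E'_def by auto
  qed
  show "\<exists>a. (c, a) \<in> E' \<and> S' a = SA" if c: "c \<in> V'" "S' c = SC" for c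
  proof (cases "c = u2")
    case True
    then show ?thesis using nb_u2 by auto
  next
    case False
    then have "c \<in> V" using c by (auto simp: V'_def)
    moreover from this have "S c = SC" using c by simp
    ultimately obtain a where "(c, a) \<in> E" "S a = SA" using C_nbr by blast
    then show ?thesis using edge_in unfolding E'_def by (metis S'_simps(3) UnI1)
  qed
  show "uniq E' S' SA SC" "uniq E' S' SC SA" "uniq E' S' SC SD" "uniq E' S' SD SC" "uniq E' S' SD SB" "uniq E' S' SB SD"
    using uniq v by (auto intro!: uniq')
  have c: "cnt V' S' x = cnt V S x + (if x = SA then 1 else 0) + (if x = SC then 1 else 0)" for x
  proof -
    have "V' = insert u2 (insert u1 V)" by (auto simp: V'_def)
    then show ?thesis using fin fresh cnt_insert[of "insert u1 V" u2 "S(u1 := SA)" SC x] cnt_insert[of V u1 S SA x]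
      by (simp add: S'_def)
  qed
  show "cnt V' S' SC = cnt V' S' SA" "cnt V' S' SD = cnt V' S' SB" using c counts by simp_all
  \<comment> \<open>At most one leaf, \<open>u2\<close>, is gained, and the new vertex
    \<open>u1\<close> of status A makes up for it.\<close>
  have "{x \<in> V'. leaf E' x} \<subseteq> insert u2 {x \<in> V. leaf E x}"
  proof
    fix x assume x: "x \<in> {x \<in> V'. leaf E' x}"
    show "x \<in> insert u2 {x \<in> V. leaf E x}"
    proof (cases "x \<in> V \<and> x \<noteq> v")
      case True
      then have "nbhd E' x = nbhd E x" using nb_old by (auto simp: nbhd_def)
      then show ?thesis using x True by (simp add: leaf_def deg_def)
    next
      case False
      have "x \<noteq> v"
      proof
        assume "x = v"
        obtain y where "(v, y) \<in> E" using nbr v by blast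
        then show False using leaf_nbr_unique[of E' v y u1] nb_v x \<open>x = v\<close> edge_in fresh by auto
      qed
      moreover have "x \<noteq> u1"
      proof
        assume "x = u1"
        then show False using leaf_nbr_unique[of E' u1 v u2] nb_u1 x v fresh by auto
      qed
      ultimately show ?thesis using False x by (auto simp: V'_def)
    qed
  qed
  then have "num_leaves V' E' \<le> card (insert u2 {x \<in> V. leaf E x})"
    unfolding num_leaves_def using fin by (intro card_mono) auto
  also have "\<dots> \<le> Suc (num_leaves V E)"
    unfolding num_leaves_def by (rule card_insert_le_m1) simp_all
  finally show "num_leaves V' E' + cnt V' S' SB \<le> cnt V' S' SA" using c counts by simp
qed

lemma corr_old: "corr E S \<subseteq> corr E' S'"
proof
  fix ab assume "ab \<in> corr E S"
  then obtain a b c d where *: "ab = (a, b)" "(a, c) \<in> E" "(c, d) \<in> E" "(d, b) \<in> E"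
    "S a = SA" "S c = SC" "S d = SD" "S b = SB" unfolding corr_def by auto
  have "a \<in> V" "c \<in> V" "d \<in> V" "b \<in> V" using edge_in * by blast+
  then have "S' a = SA" "S' c = SC" "S' d = SD" "S' b = SB" using * by simp_all
  then show "ab \<in> corr E' S'" using * unfolding corr_def E'_def by blast
qed

text \<open>\<open>u2\<close>, the only new vertex of status C, has no neighbour of status D, and
  \<open>u1\<close> has no other neighbour of status C.\<close>

lemma corr_new: "corr E' S' \<subseteq> corr E S"
proof
  fix ab assume "ab \<in> corr E' S'"
  then obtain a b c d where *: "ab = (a, b)" "(a, c) \<in> E'" "(c, d) \<in> E'" "(d, b) \<in> E'"
    "S' a = SA" "S' c = SC" "S' d = SD" "S' b = SB" unfolding corr_def by auto
  have cd: "(c, d) \<in> E" "c \<in> V" "d \<in> V"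
    by (rule E'_cases[OF *(3)]; use * v in auto)+
  have ac: "(a, c) \<in> E" "a \<in> V"
    by (rule E'_cases[OF *(2)]; use * cd v fresh in auto)+
  have db: "(d, b) \<in> E" "b \<in> V"
    by (rule E'_cases[OF *(4)]; use * cd v fresh in auto)+
  show "ab \<in> corr E S" unfolding corr_def using * cd ac db by auto
qed

lemma corr': "corr E' S' = corr E S"
  using corr_old corr_new by blast

lemma deg_old: "x \<in> V \<Longrightarrow> x \<noteq> v \<Longrightarrow> deg E' x = deg E x"
  using nb_old by (simp add: deg_def nbhd_def)

text \<open>Among the old vertices, only \<open>v\<close> and its neighbours are within two edges of
  \<open>u1\<close> or \<open>u2\<close>.\<close>

lemma dominated_restrict:
  assumes y: "y \<in> V" "y \<noteq> v" "(y, v) \<notin> E" and d: "dominated E' D y"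
  shows "dominated E (D - {u1, u2}) y"
proof -
  have nb: "(y, z) \<in> E \<and> (z \<in> V \<and> z \<noteq> v)" if "(y, z) \<in> E'" for z
    using that nb_old[OF y(2,1)] y(3) edge_in by auto
  have co: "(y, z) \<in> E \<and> (z, u) \<in> E \<and> u \<notin> {u1, u2}" if "(y, z) \<in> E'" "(z, u) \<in> E'" for z u
    using nb[OF that(1)] that(2) nb_old[of z u] edge_in(2)[of z u] fresh by auto
  consider "y \<in> D" | u where "u \<in> D" "(y, u) \<in> E'"
    | u w z z' where "u \<in> D" "w \<in> D" "u \<noteq> w" "(y, z) \<in> E'" "(z, u) \<in> E'" "(y, z') \<in> E'" "(z', w) \<in> E'"
    using d unfolding dominated_def by blast
  then show ?thesis
  proof cases
    case 1
    then show ?thesis using y fresh by (intro dominated_self) auto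
  next
    case 2
    then show ?thesis using nb[OF 2(2)] fresh by (intro dominated_nbr[of u]) auto
  next
    case 3
    then show ?thesis using co[OF 3(4,5)] co[OF 3(6,7)] by (intro dominated_two[of u _ w y z E z']) auto
  qed
qed

text \<open>The leaf \<open>u2\<close> forces \<open>u1\<close> or \<open>u2\<close> into
  \<open>D\<close>, and giving this element up pays for the new vertex of status A. It can have
  helped only the closed neighbourhood of \<open>v\<close>, which is exempted in the old tree by
  adding \<open>v\<close> to \<open>X\<close>.\<close>

lemma free_bound':
  assumes fb: "free_bound V E S P"
    and al: "\<And>X. allowed V' E' S' P X \<Longrightarrow> allowed V E S P (insert v (X - {u1, u2}))"
  shows "free_bound V' E' S' P"
  unfolding free_bound_def
proof (intro allI impI)
  fix X D assume X: "allowed V' E' S' P X" and D: "D \<subseteq> V'"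
    and dom: "\<forall>y\<in>V'. y \<in> X \<or> (\<exists>x\<in>X. (y, x) \<in> E') \<or> dominated E' D y"
  have "u1 \<notin> Domain (corr E S)" using corr_labels fresh by blast
  then have uX: "u1 \<notin> X" "u2 \<notin> X" using X corr' by (auto simp: allowed_def)
  have finD: "finite D" using D fin finite_subset unfolding V'_def by blast
  have "dominated E' D u2" using dom uX nb_u2 unfolding V'_def by auto
  then have "u1 \<in> D \<or> u2 \<in> D" unfolding dominated_def nb_u2 using nb_u1 nb_u2 by auto
  then have lt: "card (D - {u1, u2}) < card D" using finD by (intro psubset_card_mono) auto
  have "cnt V S SA \<le> card (D - {u1, u2})"
  proof (rule fb[unfolded free_bound_def, rule_format])
    show "allowed V E S P (insert v (X - {u1, u2}))" using al[OF X] .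
    show "D - {u1, u2} \<subseteq> V" using D by (auto simp: V'_def)
    fix y assume y: "y \<in> V"
    show "y \<in> insert v (X - {u1, u2}) \<or> (\<exists>x\<in>insert v (X - {u1, u2}). (y, x) \<in> E) \<or> dominated E (D - {u1, u2}) y"
    proof (cases "y = v \<or> (y, v) \<in> E")
      case False
      then have nb: "(y, z) \<in> E' \<longleftrightarrow> (y, z) \<in> E" for z using nb_old y by simp
      have "y \<in> X \<or> (\<exists>x\<in>X. (y, x) \<in> E) \<or> dominated E' D y"
        using bspec[OF dom, of y] y by (simp add: V'_def nb)
      then show ?thesis using dominated_restrict y False uX by auto
    qed auto
  qed
  moreover have "cnt V' S' SA = Suc (cnt V S SA)"
  proof -
    have "V' = insert u2 (insert u1 V)" by (auto simp: V'_def)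
    then show ?thesis using fin fresh cnt_insert[of "insert u1 V" u2 "S(u1 := SA)" SC SA] cnt_insert[of V u1 S SA SA]
      by (simp add: S'_def)
  qed
  ultimately show "cnt V' S' SA \<le> card D" using lt by simp
qed

lemma deg_v:
  shows "deg E' v \<noteq> 2"
proof -
  obtain x y where xy: "(v, x) \<in> E" "(v, y) \<in> E" "x \<noteq> y" using deg2[of v] v by auto
  then have "{x, y, u1} \<subseteq> nbhd E' v" using nb_v by (auto simp: nbhd_def)
  moreover have "x \<noteq> u1" "y \<noteq> u1" using xy edge_in(2) fresh by blast+
  then have "card {x, y, u1} = 3" using xy(3) by simp
  moreover have "finite (nbhd E' v)"
    by (rule finite_subset[of _ "insert u1 V"]) (use nb_v edge_in fin in \<open>auto simp: nbhd_def\<close>)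
  ultimately show ?thesis using card_mono[of "nbhd E' v" "{x, y, u1}"] by (auto simp: deg_def)
qed

text \<open>In the extended tree \<open>v\<close> has degree at least three. In a corresponding pair
  that contains \<open>v\<close>, it is therefore the other end that has degree two and avoids
  \<open>X\<close>, so \<open>v\<close> may join \<open>X\<close>.\<close>

lemma allowed_insert:
  assumes "S v = SB \<or> v \<notin> P \<and> v \<in> Domain (corr E S)" and X: "allowed V' E' S' P X"
  shows "allowed V E S P (insert v (X - {u1, u2}))"
  unfolding allowed_def
proof (intro conjI ballI)
  show "insert v (X - {u1, u2}) \<subseteq> V" using X v by (auto simp: allowed_def V'_def)
  fix x assume x: "x \<in> insert v (X - {u1, u2})"
  show "S x = SB \<or> S x = SA \<and> x \<notin> P \<and> x \<in> Domain (corr E S)"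
  proof (cases "x = v")
    case True
    then show ?thesis using assms(1) v by auto
  next
    case False
    then have "x \<in> V" "x \<in> X" using x X by (auto simp: allowed_def V'_def)
    then show ?thesis using X corr' unfolding allowed_def by fastforce
  qed
next
  fix ab assume ab: "ab \<in> corr E S"
  obtain a b where [simp]: "ab = (a, b)" by (cases ab)
  have "deg E' a = 2 \<and> a \<notin> X \<or> deg E' b = 2 \<and> b \<notin> X"
    using X ab corr' unfolding allowed_def by fastforce
  moreover have "a \<noteq> b" "a \<in> V" "b \<in> V" using corr_labels[of a b] ab by auto
  ultimately show "case ab of (a, b) \<Rightarrow> deg E a = 2 \<and> a \<notin> insert v (X - {u1, u2}) \<or> deg E b = 2 \<and> b \<notin> insert v (X - {u1, u2})"
    using deg_old[of a] deg_old[of b] deg_v by (cases "a = v"; cases "b = v") auto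
qed

text \<open>Only \<open>v\<close> changes its degree, and its unique partner is the vertex
  \<open>w\<close> of degree two demanded by the operation.\<close>

lemma thin':
  assumes "\<forall>(a, b)\<in>corr E S. deg E a = 2 \<or> deg E b = 2"
    and w: "(v, w) \<in> corr E S \<or> (w, v) \<in> corr E S" "deg E w = 2"
  shows "\<forall>(a, b)\<in>corr E' S'. deg E' a = 2 \<or> deg E' b = 2"
proof (intro ballI, unfold corr')
  fix ab assume ab: "ab \<in> corr E S"
  obtain a b where [simp]: "ab = (a, b)" by (cases ab)
  have l: "a \<noteq> b" "a \<in> V" "b \<in> V" "S a = SA" "S b = SB" using corr_labels[of a b] ab by auto
  have lw: "w \<in> V" "w \<noteq> v" using corr_labels[of v w] corr_labels[of w v] w(1) by auto
  show "case ab of (a, b) \<Rightarrow> deg E' a = 2 \<or> deg E' b = 2"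
  proof (cases "a = v \<or> b = v")
    case False
    then show ?thesis using bspec[OF assms(1) ab] deg_old[of a] deg_old[of b] l by auto
  next
    case True
    then have "w = a \<or> w = b"
      using w(1) ab l corr_labels[of w v] corr_labels[of v w] corr_unique_left[of a b w] corr_unique_right[of a b w] by auto
    then show ?thesis using deg_old[OF lw] w(2) by auto
  qed
qed

end

section \<open>The invariants under O3\<close>

locale quad_ext = labelled +
  fixes v u1 u2 u3 u4 :: 'a
  assumes v: "v \<in> V" "S v = SC" "deg E v = 1"
    and fresh: "u1 \<notin> V" "u2 \<notin> V" "u3 \<notin> V" "u4 \<notin> V" and dist: "distinct [u1, u2, u3, u4]"
begin

definition "V' = V \<union> {u1, u2, u3, u4}"
definition "E' = E \<union> sym_edges {(u1, v), (u1, u2), (u2, u3), (u3, u4)}"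
definition "S' = S(u1 := SD, u2 := SB, u3 := SA, u4 := SC)"

lemma v_neq: "v \<noteq> u1" "v \<noteq> u2" "v \<noteq> u3" "v \<noteq> u4"
  using v fresh by auto

lemma E_fresh: "(u1, y) \<notin> E" "(u2, y) \<notin> E" "(u3, y) \<notin> E" "(u4, y) \<notin> E"
  "(y, u1) \<notin> E" "(y, u2) \<notin> E" "(y, u3) \<notin> E" "(y, u4) \<notin> E"
  using edge_in fresh by blast+

lemma nb_u1: "(u1, y) \<in> E' \<longleftrightarrow> y = v \<or> y = u2"
  using E_fresh v_neq dist by (auto simp: E'_def sym_edges_def)

lemma nb_u2: "(u2, y) \<in> E' \<longleftrightarrow> y = u1 \<or> y = u3"
  using E_fresh v_neq dist by (auto simp: E'_def sym_edges_def)

lemma nb_u3: "(u3, y) \<in> E' \<longleftrightarrow> y = u2 \<or> y = u4"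
  using E_fresh v_neq dist by (auto simp: E'_def sym_edges_def)

lemma nb_u4: "(u4, y) \<in> E' \<longleftrightarrow> y = u3"
  using E_fresh v_neq dist by (auto simp: E'_def sym_edges_def)

lemma nb_v: "(v, y) \<in> E' \<longleftrightarrow> (v, y) \<in> E \<or> y = u1"
  using v_neq by (auto simp: E'_def sym_edges_def)

lemma nb_old: "x \<noteq> v \<Longrightarrow> x \<in> V \<Longrightarrow> (x, y) \<in> E' \<longleftrightarrow> (x, y) \<in> E"
  using fresh by (auto simp: E'_def sym_edges_def)

lemma E'_cases:
  assumes "(x, y) \<in> E'"
  obtains "(x, y) \<in> E" "x \<in> V" "y \<in> V" | "x = v" "y = u1" | "x = u1" "y = v" | "x = u1" "y = u2" | "x = u2" "y = u1"
    | "x = u2" "y = u3" | "x = u3" "y = u2" | "x = u3" "y = u4" | "x = u4" "y = u3"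
  using assms edge_in unfolding E'_def sym_edges_def by blast

lemma S'_simps [simp]: "S' u1 = SD" "S' u2 = SB" "S' u3 = SA" "S' u4 = SC" "x \<in> V \<Longrightarrow> S' x = S x"
  using fresh dist by (auto simp: S'_def)

lemma ex_v_nbr: "\<exists>a. S a = SA \<and> (\<forall>y. (v, y) \<in> E \<longleftrightarrow> y = a)"
proof -
  obtain a where "(v, a) \<in> E" "S a = SA" using C_nbr v by blast
  moreover have "leaf E v" using v by (simp add: leaf_def)
  ultimately show ?thesis using leaf_nbr_unique by metis
qed

text \<open>The only old neighbour of the leaf \<open>v\<close>; it becomes the corresponding vertex
  of \<open>u2\<close>.\<close>

definition "a0 = (SOME a. S a = SA \<and> (\<forall>y. (v, y) \<in> E \<longleftrightarrow> y = a))"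

lemma a0: "S a0 = SA" "(v, y) \<in> E \<longleftrightarrow> y = a0"
  using someI_ex[OF ex_v_nbr, folded a0_def] by blast+

lemma a0_edge: "(v, a0) \<in> E" "(a0, v) \<in> E" "a0 \<in> V"
  using a0 edge_sym edge_in by blast+

lemma nb_to_v: "(y, v) \<in> E \<longleftrightarrow> y = a0"
  using a0 edge_sym by blast

lemma uniq':
  assumes "uniq E S x y" "(x, y) \<in> {(SA, SC), (SC, SA), (SC, SD), (SD, SC), (SD, SB), (SB, SD)}"
  shows "uniq E' S' x y"
  unfolding uniq_def
proof (intro allI impI)
  fix p q r assume p: "(p, q) \<in> E'" "(p, r) \<in> E'" "S' p = x" "S' q = y" "S' r = y"
  consider "p = u1" | "p = u2" | "p = u3" | "p = u4" | "p = v" | "p \<in> V" "p \<noteq> v"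
    using p(1) by (auto elim: E'_cases simp: v(1))
  then show "q = r"
  proof cases
    case 1 then show ?thesis using p nb_u1 assms(2) v by auto
  next
    case 2 then show ?thesis using p nb_u2 assms(2) by auto
  next
    case 3 then show ?thesis using p nb_u3 assms(2) by auto
  next
    case 4 then show ?thesis using p nb_u4 by auto
  next
    case 5 then show ?thesis using p nb_v a0 a0_edge by auto
  next
    case 6
    then have "(p, q) \<in> E" "(p, r) \<in> E" using p nb_old by auto
    then show ?thesis using uniqD[OF assms(1)] p edge_in(2) 6 by auto
  qed
qed

lemma cnt': "cnt V' S' x = Suc (cnt V S x)"
proof -
  have "V' = insert u4 (insert u3 (insert u2 (insert u1 V)))" by (auto simp: V'_def)
  moreover have "u4 \<notin> insert u3 (insert u2 (insert u1 V))" "u3 \<notin> insert u2 (insert u1 V)" "u2 \<notin> insert u1 V"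
    using fresh dist by auto
  ultimately show ?thesis
    using fin fresh(1) by (cases x) (simp_all add: S'_def cnt_insert)
qed

lemma labelled': "labelled V' E' S' P"
proof
  show "finite V'" "P \<subseteq> V'" using fin P_sub by (auto simp: V'_def)
  show "E' \<subseteq> V' \<times> V'"
  proof
    fix e assume "e \<in> E'"
    then have "(fst e, snd e) \<in> E'" by simp
    then have "fst e \<in> V' \<and> snd e \<in> V'" by (rule E'_cases) (use v in \<open>auto simp: V'_def\<close>)
    then show "e \<in> V' \<times> V'" by (simp add: mem_Times_iff)
  qed
  show "sym E'"
    using sym by (auto simp: E'_def sym_edges_def sym_def)
  show "\<exists>u. (x, u) \<in> E'" if "x \<in> V'" for x
    using that nbr nb_u1 nb_u2 nb_u3 nb_u4 unfolding V'_def E'_def by blast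
  show "\<exists>p q. (x, p) \<in> E' \<and> (x, q) \<in> E' \<and> p \<noteq> q" if x: "x \<in> V'" "S' x \<noteq> SC" for x
  proof -
    consider "x = u1" | "x = u2" | "x = u3" | "x \<in> V" using x by (auto simp: V'_def)
    then show ?thesis
    proof cases
      case 1 then show ?thesis using nb_u1 v_neq by auto
    next
      case 2 then show ?thesis using nb_u2 dist by auto
    next
      case 3 then show ?thesis using nb_u3 dist by auto
    next
      case 4 then show ?thesis using x(2) deg2[of x] unfolding E'_def by auto
    qed
  qed
  show "\<exists>a. (c, a) \<in> E' \<and> S' a = SA" if c: "c \<in> V'" "S' c = SC" for c
  proof (cases "c = u4")
    case True
    then show ?thesis using nb_u4 by auto
  next
    case False
    then have "c \<in> V" using c by (auto simp: V'_def)
    moreover from this have "S c = SC" using c by simp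
    ultimately obtain a where "(c, a) \<in> E" "S a = SA" using C_nbr by blast
    then show ?thesis using edge_in unfolding E'_def by (metis S'_simps(5) UnI1)
  qed
  show "uniq E' S' SA SC" "uniq E' S' SC SA" "uniq E' S' SC SD" "uniq E' S' SD SC" "uniq E' S' SD SB" "uniq E' S' SB SD"
    using uniq by (auto intro!: uniq')
  show "cnt V' S' SC = cnt V' S' SA" "cnt V' S' SD = cnt V' S' SB" using cnt' counts by simp_all
  \<comment> \<open>The leaf \<open>v\<close> is lost and \<open>u4\<close> gained, so the number of
    leaves does not grow, while statuses A and B both gain one vertex.\<close>
  have "{x \<in> V'. leaf E' x} \<subseteq> insert u4 ({x \<in> V. leaf E x} - {v})"
  proof
    fix x assume x: "x \<in> {x \<in> V'. leaf E' x}"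
    have "x \<noteq> u1" "x \<noteq> u2" "x \<noteq> u3" "x \<noteq> v"
      using x leaf_nbr_unique[of E' u1 v u2] leaf_nbr_unique[of E' u2 u1 u3] leaf_nbr_unique[of E' u3 u2 u4]
        leaf_nbr_unique[of E' v a0 u1] nb_u1 nb_u2 nb_u3 nb_v v_neq dist a0_edge fresh by auto
    moreover have "nbhd E' x = nbhd E x" if "x \<in> V" "x \<noteq> v" using nb_old that by (auto simp: nbhd_def)
    ultimately show "x \<in> insert u4 ({x \<in> V. leaf E x} - {v})" using x by (auto simp: V'_def leaf_def deg_def)
  qed
  then have "num_leaves V' E' \<le> card (insert u4 ({x \<in> V. leaf E x} - {v}))"
    unfolding num_leaves_def using fin by (intro card_mono) auto
  also have "\<dots> \<le> Suc (card ({x \<in> V. leaf E x} - {v}))"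
    by (rule card_insert_le_m1) simp_all
  also have "\<dots> = num_leaves V E"
    unfolding num_leaves_def using v fin by (intro card_Suc_Diff1) (auto simp: leaf_def)
  finally show "num_leaves V' E' + cnt V' S' SB \<le> cnt V' S' SA" using cnt' counts by simp
qed

lemma deg_old: "x \<in> V \<Longrightarrow> x \<noteq> v \<Longrightarrow> deg E' x = deg E x"
  using nb_old by (simp add: deg_def nbhd_def)

text \<open>A new corresponding pair has to use the edge from \<open>v\<close> to \<open>u1\<close>,
  the only new edge between statuses C and D.\<close>

lemma corr': "corr E' S' = insert (a0, u2) (corr E S)"
proof (intro subset_antisym subsetI)
  fix ab assume "ab \<in> insert (a0, u2) (corr E S)"
  then show "ab \<in> corr E' S'"
  proof
    assume "ab = (a0, u2)"
    moreover have "(a0, v) \<in> E'" "(v, u1) \<in> E'" "(u1, u2) \<in> E'" "S' a0 = SA" "S' v = SC"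
      using a0_edge v nb_v nb_u1 a0(1) by (auto simp: E'_def)
    ultimately show ?thesis using S'_simps(1,2) unfolding corr_def by blast
  next
    assume "ab \<in> corr E S"
    then obtain a b c d where *: "ab = (a, b)" "(a, c) \<in> E" "(c, d) \<in> E" "(d, b) \<in> E"
      "S a = SA" "S c = SC" "S d = SD" "S b = SB" unfolding corr_def by auto
    have "a \<in> V" "c \<in> V" "d \<in> V" "b \<in> V" using edge_in * by blast+
    then have "S' a = SA" "S' c = SC" "S' d = SD" "S' b = SB" using * by simp_all
    then show ?thesis using * unfolding corr_def E'_def by blast
  qed
next
  fix ab assume "ab \<in> corr E' S'"
  then obtain a b c d where *: "ab = (a, b)" "(a, c) \<in> E'" "(c, d) \<in> E'" "(d, b) \<in> E'"
    "S' a = SA" "S' c = SC" "S' d = SD" "S' b = SB" unfolding corr_def by auto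
  have "c = v \<and> d = u1 \<or> (c, d) \<in> E"
    by (rule E'_cases[OF *(3)]; use * v in auto)
  then show "ab \<in> insert (a0, u2) (corr E S)"
  proof
    assume cd: "c = v \<and> d = u1"
    have "b = u2" using *(4,8) cd nb_u1 v by auto
    moreover have "a = a0" by (rule E'_cases[OF *(2)]; use cd * v_neq dist nb_to_v in auto)
    ultimately show ?thesis using * by simp
  next
    assume cd: "(c, d) \<in> E"
    then have V: "c \<in> V" "d \<in> V" using edge_in by blast+
    have ac: "(a, c) \<in> E" "a \<in> V"
      by (rule E'_cases[OF *(2)]; use * V fresh in auto)+
    have db: "(d, b) \<in> E" "b \<in> V"
      by (rule E'_cases[OF *(4)]; use * V fresh v in auto)+
    show ?thesis unfolding corr_def using * V cd ac db by auto
  qed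
qed

text \<open>Apart from \<open>v\<close>, the only old vertex within two edges of a new one is
  \<open>a0\<close>, and it reaches no new vertex but \<open>u1\<close>.\<close>

lemma dominated_restrict:
  assumes y: "y \<in> V" "y \<noteq> v" "y \<noteq> a0 \<or> u1 \<notin> D" and d: "dominated E' D y"
  shows "dominated E (D - {u1, u2, u3, u4}) y"
proof -
  let ?K = "{u1, u2, u3, u4}"
  have VK: "x \<notin> ?K" if "x \<in> V" for x using that fresh by auto
  have nb: "(y, z) \<in> E" if "(y, z) \<in> E'" for z
    using that nb_old[OF y(2,1)] by simp
  have co: "(y, z) \<in> E \<and> (z, u) \<in> E \<and> u \<notin> ?K" if "(y, z) \<in> E'" "(z, u) \<in> E'" "u \<in> D" for z u
  proof (cases "z = v")
    case True
    then have "y = a0" using nb[OF that(1)] nb_to_v by simp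
    then have "u \<noteq> u1" using y(3) that(3) by auto
    then have "(z, u) \<in> E" using that(2) True nb_v by simp
    then show ?thesis using nb[OF that(1)] VK edge_in(2) by blast
  next
    case False
    have "(y, z) \<in> E" using nb[OF that(1)] .
    moreover from this have "(z, u) \<in> E" using nb_old[OF False] edge_in(2) that(2) by blast
    ultimately show ?thesis using VK edge_in(2) by blast
  qed
  consider "y \<in> D" | u where "u \<in> D" "(y, u) \<in> E'"
    | u w z z' where "u \<in> D" "w \<in> D" "u \<noteq> w" "(y, z) \<in> E'" "(z, u) \<in> E'" "(y, z') \<in> E'" "(z', w) \<in> E'"
    using d unfolding dominated_def by blast
  then show ?thesis
  proof cases
    case 1
    then show ?thesis using VK[OF y(1)] by (intro dominated_self) auto
  next
    case 2
    then show ?thesis using nb[OF 2(2)] VK edge_in(2) by (intro dominated_nbr[of u]) auto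
  next
    case 3
    then show ?thesis using co[OF 3(4,5,1)] co[OF 3(6,7,2)] by (intro dominated_two[of u _ w y z E z']) auto
  qed
qed

text \<open>In the old tree \<open>v\<close> is a leaf at \<open>a0\<close>, so two edges from
  \<open>v\<close> never lead out of the closed neighbourhood of \<open>a0\<close>.\<close>

lemma dominated_without_v:
  assumes "y \<noteq> a0" "(y, a0) \<notin> E" "dominated E D y"
  shows "dominated E (D - {v}) y"
proof -
  have "u \<noteq> v" if "(y, z) \<in> E" "(z, u) \<in> E" for u z using that assms(2) nb_to_v by auto
  moreover have "u \<noteq> v" if "(y, u) \<in> E" for u using that assms(1) nb_to_v by auto
  moreover have "y \<noteq> v" using assms(2) a0_edge by auto
  ultimately show ?thesis using assms(3) unfolding dominated_def by blast
qed

text \<open>\<open>a0\<close> has to leave \<open>X\<close>, because its only corresponding vertex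
  is the new \<open>u2\<close>. That \<open>a0\<close> and \<open>u2\<close> are not both in
  \<open>X\<close> is the last clause of \<open>allowed\<close> for this pair.\<close>

lemma allowed_remove:
  assumes X: "allowed V' E' S' P X"
  shows "allowed V E S P (X - {u2, a0})" "X \<subseteq> insert u2 V" "a0 \<notin> X \<or> u2 \<notin> X" "v \<notin> X"
proof -
  have lab: "S' x = SB \<or> S' x = SA \<and> x \<notin> P \<and> x \<in> Domain (corr E' S')" if "x \<in> X" for x
    using X that unfolding allowed_def by blast
  have thin: "deg E' a = 2 \<and> a \<notin> X \<or> deg E' b = 2 \<and> b \<notin> X" if "(a, b) \<in> corr E' S'" for a b
    using X that unfolding allowed_def by fast
  show "a0 \<notin> X \<or> u2 \<notin> X" using thin[of a0 u2] corr' by auto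
  have "u3 \<notin> Domain (corr E S)" using corr_labels fresh by blast
  then have "u3 \<notin> X" using lab[of u3] corr' a0_edge fresh by auto
  then show sub: "X \<subseteq> insert u2 V" using X lab[of u1] lab[of u4] by (auto simp: allowed_def V'_def)
  show "v \<notin> X" using lab[of v] v by auto
  show "allowed V E S P (X - {u2, a0})"
    unfolding allowed_def
  proof (intro conjI ballI)
    show "X - {u2, a0} \<subseteq> V" using sub by blast
    show "S x = SB \<or> S x = SA \<and> x \<notin> P \<and> x \<in> Domain (corr E S)" if "x \<in> X - {u2, a0}" for x
      using lab[of x] that sub corr' by auto
    fix ab assume ab: "ab \<in> corr E S"
    obtain a b where [simp]: "ab = (a, b)" by (cases ab)
    have l: "a \<in> V" "b \<in> V" "a \<noteq> v" "b \<noteq> v" using corr_labels[of a b] ab v by auto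
    have "deg E' a = 2 \<and> a \<notin> X \<or> deg E' b = 2 \<and> b \<notin> X" using thin[of a b] ab corr' by simp
    then show "case ab of (a, b) \<Rightarrow> deg E a = 2 \<and> a \<notin> X - {u2, a0} \<or> deg E b = 2 \<and> b \<notin> X - {u2, a0}"
      using deg_old[of a] deg_old[of b] l by auto
  qed
qed

lemma thin':
  assumes "\<forall>(a, b)\<in>corr E S. deg E a = 2 \<or> deg E b = 2"
  shows "\<forall>(a, b)\<in>corr E' S'. deg E' a = 2 \<or> deg E' b = 2"
proof
  fix ab assume "ab \<in> corr E' S'"
  then consider "ab = (a0, u2)" | "ab \<in> corr E S" using corr' by blast
  then show "case ab of (a, b) \<Rightarrow> deg E' a = 2 \<or> deg E' b = 2"
  proof cases
    case 1
    have "nbhd E' u2 = {u1, u3}" using nb_u2 by (auto simp: nbhd_def)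
    then show ?thesis using 1 dist by (simp add: deg_def)
  next
    case 2
    obtain a b where [simp]: "ab = (a, b)" by (cases ab)
    have "a \<in> V" "b \<in> V" "a \<noteq> v" "b \<noteq> v" using corr_labels[of a b] 2 v by auto
    then show ?thesis using bspec[OF assms 2] deg_old[of a] deg_old[of b] by auto
  qed
qed

text \<open>The leaf \<open>u4\<close> forces \<open>u3\<close> or \<open>u4\<close> into
  \<open>D\<close>. An element of \<open>D\<close> has to be saved on the way back to the old tree,
  although the closed neighbourhood of \<open>a0\<close> may have to be dominated anew there; the
  cases show how this is paid for.\<close>

lemma free_bound':
  assumes fb: "free_bound V E S P"
  shows "free_bound V' E' S' P"
  unfolding free_bound_def
proof (intro allI impI)
  fix X D assume X: "allowed V' E' S' P X" and D: "D \<subseteq> V'"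
    and dom: "\<forall>y\<in>V'. y \<in> X \<or> (\<exists>x\<in>X. (y, x) \<in> E') \<or> dominated E' D y"
  let ?K = "{u1, u2, u3, u4}"
  note rem = allowed_remove[OF X]
  have finD: "finite D" using D fin finite_subset unfolding V'_def by blast
  have notX: "u1 \<notin> X" "u3 \<notin> X" "u4 \<notin> X" using rem(2) fresh dist by auto
  have "dominated E' D u4" using bspec[OF dom, of u4] notX nb_u4 by (auto simp: V'_def)
  then have u34: "u3 \<in> D \<or> u4 \<in> D" unfolding dominated_def nb_u4 using nb_u3 by auto
  have bound: "cnt V S SA \<le> card D1"
    if "D1 \<subseteq> V" "\<And>y. y \<in> V \<Longrightarrow> y \<notin> X - {u2, a0} \<Longrightarrow> \<forall>x\<in>X - {u2, a0}. (y, x) \<notin> E \<Longrightarrow> dominated E D1 y" for D1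
    using fb[unfolded free_bound_def, rule_format, OF rem(1) that(1)] that(2) by blast
  have old: "dominated E' D y"
    if y: "y \<in> V" "y \<noteq> v" "y \<notin> X - {u2, a0}" "\<forall>x\<in>X - {u2, a0}. (y, x) \<notin> E"
      and "a0 \<notin> X \<or> y \<noteq> a0 \<and> (y, a0) \<notin> E" for y
  proof -
    have "y \<noteq> u2" using y(1) fresh by auto
    then have "y \<notin> X" using y that(5) by blast
    moreover have "(y, x) \<notin> E'" if "x \<in> X" for x
      using nb_old[OF y(2,1)] y(4) that \<open>a0 \<notin> X \<or> y \<noteq> a0 \<and> (y, a0) \<notin> E\<close> E_fresh by auto
    ultimately show ?thesis using bspec[OF dom, of y] y(1) by (auto simp: V'_def)
  qed
  have cD: "card (D - ?K) + card (D \<inter> ?K) = card D"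
    using card_Diff_subset_Int[of D ?K] card_mono[OF finD, of "D \<inter> ?K"] by simp
  have k1: "1 \<le> card (D \<inter> ?K)" using u34 finD by (auto simp: Suc_le_eq card_gt_0_iff)
  have DV: "D - ?K \<subseteq> V" using D by (auto simp: V'_def)
  have "\<exists>D1. D1 \<subseteq> V \<and> card D1 < card D \<and>
    (\<forall>y\<in>V. y \<notin> X - {u2, a0} \<longrightarrow> (\<forall>x\<in>X - {u2, a0}. (y, x) \<notin> E) \<longrightarrow> dominated E D1 y)"
  proof (cases "card (D \<inter> ?K) \<ge> 2")
    case two: True
    \<comment> \<open>Two elements among the new vertices are traded for one old vertex:
      \<open>a0\<close> if its closed neighbourhood has been exempt, and otherwise \<open>v\<close>,
      which also does for \<open>a0\<close> what \<open>u1\<close> may have done.\<close>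
    define w where "w = (if a0 \<in> X then a0 else v)"
    define D1 where "D1 = insert w (D - ?K)"
    have c1: "card D1 < card D" using card_insert_le_m1[of "card (D - ?K) + 1" "D - ?K" w] cD two
      by (simp add: D1_def)
    have "D1 \<subseteq> V" using DV v a0_edge by (auto simp: D1_def w_def)
    moreover have "dominated E D1 y"
      if y: "y \<in> V" "y \<notin> X - {u2, a0}" "\<forall>x\<in>X - {u2, a0}. (y, x) \<notin> E" for y
    proof (cases "y = w \<or> (y, w) \<in> E")
      case True
      then show ?thesis using dominated_self[of w D1 E] dominated_nbr[of w D1 y E] by (auto simp: D1_def)
    next
      case False
      have "y \<noteq> v" using False a0_edge by (auto simp: w_def split: if_splits)
      have "dominated E' D y"
        using False by (intro old[OF y(1) \<open>y \<noteq> v\<close> y(2,3)]) (auto simp: w_def split: if_splits)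
      moreover have "y \<noteq> a0" using False a0_edge by (auto simp: w_def split: if_splits)
      ultimately have "dominated E (D - ?K) y" using dominated_restrict[OF y(1) \<open>y \<noteq> v\<close>] by blast
      then show ?thesis by (rule dominated_mono) (auto simp: D1_def)
    qed
    ultimately show ?thesis using c1 by blast
  next
    case False
    then have one: "card (D \<inter> ?K) = 1" using k1 by simp
    then obtain k where "D \<inter> ?K = {k}" by (auto simp: card_1_singleton_iff)
    moreover have "u \<in> D \<inter> ?K \<longleftrightarrow> u \<in> D" if "u \<in> ?K" for u using that by blast
    ultimately have "u \<in> D \<longleftrightarrow> u = k" if "u \<in> ?K" for u using that by blast
    \<comment> \<open>The single element is \<open>u3\<close> or \<open>u4\<close>, which are too
      far away to help any old vertex.\<close>
    then have uD: "u1 \<notin> D" "u2 \<notin> D" using u34 dist by auto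
    have lt: "card (D - ?K) < card D" using cD one by simp
    show ?thesis
    proof (cases "u2 \<in> X")
      case True
      \<comment> \<open>No exemption of an old vertex is lost in this case. Only \<open>v\<close>
        needs an argument: as \<open>u1\<close> and \<open>u2\<close> are not in \<open>D\<close>,
        it is dominated by itself or through \<open>a0\<close>.\<close>
      then have aX: "a0 \<notin> X" using rem(3) by blast
      have "dominated E (D - ?K) y"
        if y: "y \<in> V" "y \<notin> X - {u2, a0}" "\<forall>x\<in>X - {u2, a0}. (y, x) \<notin> E" for y
      proof (cases "y = v")
        case False
        then show ?thesis using dominated_restrict[OF y(1) False _ old[OF y(1) False y(2,3)]] uD aX by blast
      next
        case True
        have "dominated E' D v"
          using bspec[OF dom, of v] v(1) rem(4) aX notX nb_v a0 by (auto simp: V'_def)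
        then consider "v \<in> D" | "a0 \<in> D"
          | u w where "u \<in> D" "w \<in> D" "u \<noteq> w" "u \<noteq> v" "w \<noteq> v" "(a0, u) \<in> E" "(a0, w) \<in> E"
          using uD a0 nb_v nb_u1 nb_old[of a0] a0_edge unfolding dominated_def by metis
        then show ?thesis
        proof cases
          case 1 then show ?thesis using True v_neq by (intro dominated_self) auto
        next
          case 2 then show ?thesis using True a0_edge fresh by (intro dominated_nbr[of a0]) auto
        next
          case 3
          then have "u \<notin> ?K" "w \<notin> ?K" using edge_in(2) fresh by blast+
          then show ?thesis using dominated_two[of u "D - ?K" w v a0 E a0] 3 True a0_edge by simp
        qed
      qed
      then show ?thesis using DV lt by blast
    next
      case False
      have "dominated E' D u1"
        using bspec[OF dom, of u1] rem(4) False notX nb_u1 by (auto simp: V'_def)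
      \<comment> \<open>With \<open>u1\<close> and \<open>u2\<close> outside \<open>D\<close>, the
        vertex \<open>u1\<close> is dominated by \<open>v\<close>, or else by \<open>u3\<close>
        together with \<open>a0\<close>.\<close>
      then have va: "v \<in> D \<or> a0 \<in> D"
        using uD nb_u1 nb_u2 nb_v a0 unfolding dominated_def by metis
      \<comment> \<open>Moving \<open>v\<close> to \<open>a0\<close> does not increase the size and
        covers the whole closed neighbourhood of \<open>a0\<close>, to which everything that
        \<open>v\<close> could help belongs.\<close>
      define D1 where "D1 = insert a0 (D - ?K - {v})"
      have "card D1 \<le> card (D - ?K)"
      proof (cases "v \<in> D")
        case True
        then have "card (D - ?K) = Suc (card (D - ?K - {v}))"
          using finD v_neq by (intro card.remove) auto
        then show ?thesis using card_insert_le_m1[of "card (D - ?K)" "D - ?K - {v}" a0] by (simp add: D1_def)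
      next
        case False
        then have "D1 = D - ?K" using va a0_edge(3) fresh by (auto simp: D1_def)
        then show ?thesis by simp
      qed
      moreover have "D1 \<subseteq> V" using DV a0_edge by (auto simp: D1_def)
      moreover have "dominated E D1 y"
        if y: "y \<in> V" "y \<notin> X - {u2, a0}" "\<forall>x\<in>X - {u2, a0}. (y, x) \<notin> E" for y
      proof (cases "y = a0 \<or> (y, a0) \<in> E")
        case True
        then show ?thesis using dominated_self[of a0 D1 E] dominated_nbr[of a0 D1 y E] by (auto simp: D1_def)
      next
        case False
        have "y \<noteq> v" using False a0_edge by auto
        have "dominated E' D y" using False by (intro old[OF y(1) \<open>y \<noteq> v\<close> y(2,3)]) auto
        then have "dominated E (D - ?K) y" using dominated_restrict[OF y(1) \<open>y \<noteq> v\<close>] uD by blast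
        then have "dominated E (D - ?K - {v}) y" using dominated_without_v False by blast
        then show ?thesis by (rule dominated_mono) (auto simp: D1_def)
      qed
      ultimately show ?thesis using lt by (intro exI[of _ D1]) auto
    qed
  qed
  then obtain D1 where "D1 \<subseteq> V" "card D1 < card D"
    "\<And>y. y \<in> V \<Longrightarrow> y \<notin> X - {u2, a0} \<Longrightarrow> \<forall>x\<in>X - {u2, a0}. (y, x) \<notin> E \<Longrightarrow> dominated E D1 y"
    by blast
  then show "cnt V' S' SA \<le> card D" using bound[of D1] cnt' by simp
qed

end

section \<open>The invariants along the generation of the family, and the lower bound\<close>

lemma T2_start:
  assumes "distinct [a, b, c, d]" "S a = SC" "S b = SA" "S c = SA" "S d = SC"
  defines "V \<equiv> {a, b, c, d}" and "E \<equiv> sym_edges {(a, b), (b, c), (c, d)}"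
  shows "labelled V E S V" "corr E S = {}" "free_bound V E S V"
proof -
  have nb: "(a, y) \<in> E \<longleftrightarrow> y = b" "(b, y) \<in> E \<longleftrightarrow> y = a \<or> y = c" "(c, y) \<in> E \<longleftrightarrow> y = b \<or> y = d" "(d, y) \<in> E \<longleftrightarrow> y = c" for y
    using assms(1) by (auto simp: E_def sym_edges_def)
  have sub: "E \<subseteq> V \<times> V" by (auto simp: E_def V_def sym_edges_def)
  have lab: "S x = SA \<or> S x = SC" if "x \<in> V" for x using that assms by (auto simp: V_def)
  show R: "corr E S = {}"
    using lab sub unfolding corr_def by (auto simp: subset_iff) (metis status.distinct)
  have u: "uniq E S x y" if "(x, y) \<in> {(SA, SC), (SC, SA), (SC, SD), (SD, SC), (SD, SB), (SB, SD)}" for x y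
    unfolding uniq_def
  proof (intro allI impI)
    fix p q r assume p: "(p, q) \<in> E" "(p, r) \<in> E" "S p = x" "S q = y" "S r = y"
    have "p \<in> V" using p sub by blast
    then consider "p = a" | "p = b" | "p = c" | "p = d" by (auto simp: V_def)
    then show "q = r"
      by cases (use p nb that assms(2-5) in auto)
  qed
  have cA: "{x \<in> V. S x = SA} = {b, c}" and cC: "{x \<in> V. S x = SC} = {a, d}"
    and cB: "{x \<in> V. S x = SB} = {}" and cD: "{x \<in> V. S x = SD} = {}"
    using assms by (auto simp: V_def)
  have cnt: "cnt V S SA = 2" "cnt V S SC = 2" "cnt V S SB = 0" "cnt V S SD = 0"
    unfolding cnt_def cA cC cB cD using assms(1) by auto
  show "labelled V E S V"
  proof
    show "sym E" unfolding E_def sym_edges_def sym_def by blast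
    show "\<exists>u. (x, u) \<in> E" if "x \<in> V" for x using that nb by (auto simp: V_def)
    show "\<exists>p q. (x, p) \<in> E \<and> (x, q) \<in> E \<and> p \<noteq> q" if "x \<in> V" "S x \<noteq> SC" for x
    proof -
      have "x = b \<or> x = c" using that assms(2-5) by (auto simp: V_def)
      then show ?thesis using nb(2,3) assms(1) by (metis distinct_length_2_or_more)
    qed
    show "\<exists>a. (x, a) \<in> E \<and> S a = SA" if "x \<in> V" "S x = SC" for x using that nb assms by (auto simp: V_def)
    have "{x \<in> V. leaf E x} \<subseteq> {a, d}"
      using leaf_nbr_unique[of E b a c] leaf_nbr_unique[of E c b d] nb assms(1) by (auto simp: V_def)
    then have "num_leaves V E \<le> card {a, d}" unfolding num_leaves_def by (intro card_mono) auto
    then show "num_leaves V E + cnt V S SB \<le> cnt V S SA" using cnt assms(1) by simp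
  qed (use sub u cnt in \<open>auto simp: V_def\<close>)
  show "free_bound V E S V"
    unfolding free_bound_def
  proof (intro allI impI)
    fix X D assume X: "allowed V E S V X" and D: "D \<subseteq> V"
      and dom: "\<forall>y\<in>V. y \<in> X \<or> (\<exists>x\<in>X. (y, x) \<in> E) \<or> dominated E D y"
    \<comment> \<open>All vertices of status A lie on the basic path and there is none of status B,
      so nothing can be exempt.\<close>
    have "X = {}" using X R lab unfolding allowed_def by fastforce
    then have "dominated E D a" "dominated E D d" using dom by (auto simp: V_def)
    then have "a \<in> D \<or> b \<in> D" "c \<in> D \<or> d \<in> D" unfolding dominated_def using nb by auto
    then obtain x y where "x \<in> D" "y \<in> D" "x \<noteq> y" using assms(1) by auto
    then have "card {x, y} \<le> card D" using D finite_subset[OF D] by (intro card_mono) (auto simp: V_def)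
    then show "cnt V S SA \<le> card D" using cnt \<open>x \<noteq> y\<close> by simp
  qed
qed

lemma T2_invariant:
  assumes "T2 V E S P"
  shows "labelled V E S P \<and> (\<forall>(a, b)\<in>corr E S. deg E a = 2 \<or> deg E b = 2) \<and> free_bound V E S P"
  using assms
proof induction
  case (start a b c d S)
  then show ?case using T2_start[of a b c d S] by simp
next
  case (op2 V E S P v u1 u2)
  then interpret labelled V E S P by simp
  interpret pair_ext V E S P v u1 u2 using op2.hyps by unfold_locales simp_all
  obtain w where "(w, v) \<in> corr E S" "deg E w = 2"
    using op2.hyps unfolding corr_of_B_def induced_P4_def corr_def by blast
  then have "\<forall>(a, b)\<in>corr E' S'. deg E' a = 2 \<or> deg E' b = 2" using thin' op2.IH by blast
  moreover have "free_bound V' E' S' P" using free_bound' allowed_insert op2.IH op2.hyps by blast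
  ultimately show ?case using labelled' unfolding V'_def E'_def S'_def by blast
next
  case (op3 V E S P v u1 u2 u3 u4)
  then interpret labelled V E S P by simp
  interpret quad_ext V E S P v u1 u2 u3 u4 using op3.hyps by unfold_locales simp_all
  show ?case using labelled' thin' free_bound' op3.IH unfolding V'_def E'_def S'_def by blast
next
  case (op4 V E S P v u1 u2)
  then interpret labelled V E S P by simp
  interpret pair_ext V E S P v u1 u2 using op4.hyps by unfold_locales simp_all
  obtain w where w: "(v, w) \<in> corr E S" "deg E w = 2"
    using op4.hyps unfolding corr_of_A_def induced_P4_def corr_def by blast
  then have "\<forall>(a, b)\<in>corr E' S'. deg E' a = 2 \<or> deg E' b = 2" using thin' op4.IH by blast
  moreover have "free_bound V' E' S' P" using free_bound' allowed_insert op4.IH op4.hyps w by blast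
  ultimately show ?case using labelled' unfolding V'_def E'_def S'_def by blast
qed

text \<open>Let A and B be the numbers of vertices with these statuses. The order is at most 2A +
  2B, and l + s <= 2l <= 2A - 2B, so the sum is at most 4A; \<open>free_bound\<close> with nothing
  exempt bounds A by the minimum.\<close>

lemma T2_gamma:
  assumes "T2 V E S P" "connected_graph V E"
  shows "card V + num_leaves V E + num_support V E \<le> 4 * gamma_2d V E"
proof -
  interpret labelled V E S P using T2_invariant assms(1) by blast
  have thin: "\<forall>(a, b)\<in>corr E S. deg E a = 2 \<or> deg E b = 2" and fb: "free_bound V E S P"
    using T2_invariant assms(1) by blast+
  obtain D where D: "D \<subseteq> V" "\<And>v. v \<in> V \<Longrightarrow> dominated E D v" "card D = gamma_2d V E"
    using gamma_2d_attained[OF fin assms(2)] by blast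
  have "allowed V E S P {}" using thin by (simp add: allowed_def)
  then have g: "cnt V S SA \<le> gamma_2d V E" 
    using fb[unfolded free_bound_def, rule_format, of "{}" D] D by auto
  have V: "V = ({x \<in> V. S x = SA} \<union> {x \<in> V. S x = SB}) \<union> ({x \<in> V. S x = SC} \<union> {x \<in> V. S x = SD})"
    using status.exhaust by blast
  have "card V \<le> (cnt V S SA + cnt V S SB) + (cnt V S SC + cnt V S SD)"
    unfolding cnt_def by (subst V) (intro order_trans[OF card_Un_le] add_mono order_refl card_Un_le)
  moreover have "num_support V E \<le> num_leaves V E"
  proof -
    have "\<exists>f. \<forall>x\<in>{v\<in>V. support E v}. (x, f x) \<in> E \<and> leaf E (f x)"
      by (rule bchoice) (auto simp: support_def)
    then obtain f where f: "\<And>x. x \<in> V \<Longrightarrow> support E x \<Longrightarrow> (x, f x) \<in> E \<and> leaf E (f x)" by blast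
    show ?thesis
      unfolding num_support_def num_leaves_def
    proof (rule card_inj_on_le[of f])
      show "inj_on f {v\<in>V. support E v}"
      proof (rule inj_onI)
        fix x y assume xy: "x \<in> {v\<in>V. support E v}" "y \<in> {v\<in>V. support E v}" "f x = f y"
        have x: "(x, f x) \<in> E" "leaf E (f x)" and y: "(y, f x) \<in> E" using f[of x] f[of y] xy by auto
        show "x = y" using leaf_nbr_unique[OF x(2) edge_sym[OF x(1)] edge_sym[OF y]] .
      qed
      show "f ` {v\<in>V. support E v} \<subseteq> {v\<in>V. leaf E v}" using f edge_in(2) by blast
    qed (use fin in simp)
  qed
  ultimately show ?thesis using g counts by linarith
qed

section \<open>An edge between ends of degree two of different blocks\<close>

context rooted_blocks
begin

lemma head_unique:
  assumes "B \<in> \<B>" "h \<in> B" "h \<in> heads" "k \<in> B" "k \<in> heads"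
  shows "h = k"
proof -
  obtain x where "B \<inter> heads = {x}" using heads_single[OF assms(1)] by blast
  moreover have "h \<in> B \<inter> heads" "k \<in> B \<inter> heads" using assms by simp_all
  ultimately show ?thesis by simp
qed

lemma head_min:
  assumes "B \<in> \<B>" "h \<in> B" "h \<in> heads" "v \<in> B"
  shows "dep h \<le> dep v"
proof -
  obtain x where x: "x \<in> B" "\<And>y. y \<in> B \<Longrightarrow> dep x \<le> dep y"
    using assms(2) ex_has_least_nat[of "\<lambda>x. x \<in> B" h dep] by blast
  have "x \<in> heads"
  proof (cases "x = r")
    case False
    then have "dep x = Suc (dep (par x))" using dep_par block_sub[OF assms(1)] x(1) by blast
    then have "par x \<notin> B" using x(2)[of "par x"] by auto
    then show ?thesis using heads_iff[OF assms(1) x(1)] by simp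
  qed (simp add: r_head)
  then have "x = h" using head_unique[OF assms(1) x(1) _ assms(2,3)] by simp
  then show ?thesis using x(2) assms(4) by blast
qed

text \<open>Every block has an end of degree two with a single edge leaving the block. The edge leaving the root block
  leads downwards, so there is a deepest such end whose edge leads downwards; below it lies a block whose own
  edge leads upwards, hence is the same edge.\<close>

lemma ex_thin_edge:
  assumes thin: "\<And>B. B \<in> \<B> \<Longrightarrow> \<exists>t e. t \<in> B \<and> deg E t = 2 \<and> (t, e) \<in> E \<and> e \<notin> B"
  shows "\<exists>x y B. (x, y) \<in> E \<and> B \<in> \<B> \<and> x \<in> B \<and> y \<notin> B \<and> deg E x = 2 \<and> deg E y = 2"
proof -
  let ?P = "\<lambda>t. \<exists>B\<in>\<B>. \<exists>e. t \<in> B \<and> deg E t = 2 \<and> e \<notin> B \<and> e \<in> V \<and> e \<noteq> r \<and> par e = t"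
  have down_or_up: "e \<in> V \<and> e \<noteq> r \<and> par e = t \<or> t \<noteq> r \<and> e = par t \<and> t \<in> heads"
    if "B \<in> \<B>" "t \<in> B" "(t, e) \<in> E" "e \<notin> B" for B t e
    using that(3)
  proof (cases rule: edge_cases)
    case down
    then show ?thesis using edge_in(2)[OF that(3)] by simp
  next
    case up
    then show ?thesis using heads_iff[OF that(1,2)] that(4) by simp
  qed
  obtain R where R: "R \<in> \<B>" "r \<in> R" using ex_block r_in by blast
  obtain t e where te: "t \<in> R" "deg E t = 2" "(t, e) \<in> E" "e \<notin> R" using thin[OF R(1)] by blast
  have "\<not> (t \<noteq> r \<and> t \<in> heads)" using head_unique[OF R r_head te(1)] by blast
  then have "?P t" using down_or_up[OF R(1) te(1,3,4)] te R by blast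
  moreover have "dep t < Suc (Max (dep ` V))" if "?P t" for t
  proof -
    have "t \<in> V" using that block_sub by blast
    then show ?thesis using finite_V by (simp add: le_imp_less_Suc)
  qed
  ultimately obtain t where t: "?P t" "\<And>u. ?P u \<Longrightarrow> dep u \<le> dep t"
    using ex_has_greatest_nat[of ?P t dep "Suc (Max (dep ` V))"] by blast
  then obtain B e where B: "B \<in> \<B>" "t \<in> B" "deg E t = 2" "e \<notin> B" "e \<in> V" "e \<noteq> r" "par e = t" by blast
  obtain C where C: "C \<in> \<B>" "e \<in> C" using ex_block B(5) by blast
  have "t \<notin> C" using block_eq[OF B(1) C(1) B(2)] B(4) C(2) by blast
  then have eh: "e \<in> heads" using heads_iff[OF C] B(7) by simp
  obtain t' e' where t': "t' \<in> C" "deg E t' = 2" "(t', e') \<in> E" "e' \<notin> C" using thin[OF C(1)] by blast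
  have "dep t < dep t'" using dep_par[OF B(5,6)] B(7) head_min[OF C eh t'(1)] by simp
  then have "\<not> ?P t'" using t(2)[of t'] by fastforce
  then have "t' \<in> heads" using down_or_up[OF C(1) t'(1,3,4)] t' C by blast
  then have "t' = e" using head_unique[OF C(1) t'(1) _ C(2) eh] by simp
  moreover have "(t, e) \<in> E" using par_edge(2)[OF B(5,6)] B(7) by simp
  ultimately show ?thesis using B t' by blast
qed

end

section \<open>Growing the labelled tree\<close>

text \<open>Rooting at one end of the chosen edge makes both of its ends heads. As both have degree
  two, no further vertex is attached to the inner vertices of the basic path.\<close>

locale thin_rooted = rooted_blocks +
  fixes r'
  assumes thin: "B \<in> \<B> \<Longrightarrow> thin_pair E B \<or> thin_quad E B"
    and r': "(r, r') \<in> E" "\<And>B. B \<in> \<B> \<Longrightarrow> r \<in> B \<Longrightarrow> r' \<notin> B" "deg E r = 2" "deg E r' = 2"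
begin

text \<open>The status records the distance from the head of the block, because blocks hang down
  from their heads as paths (\<open>block_form\<close>). \<open>par\<close> is applied to non-heads
  only, hence never to \<open>r\<close>.\<close>

definition lab :: "'a \<Rightarrow> status" where
  "lab v = (if v \<in> heads then SA else if par v \<in> heads then SC else if par (par v) \<in> heads then SD else SB)"

lemma deg_2_nbrs:
  assumes "deg E v = 2" "(v, x) \<in> E" "(v, y) \<in> E" "x \<noteq> y"
  shows "(v, z) \<in> E \<longleftrightarrow> z = x \<or> z = y"
proof -
  have "{x, y} = nbhd E v"
    using assms nbhd_finite by (intro card_subset_eq) (auto simp: deg_def nbhd_def)
  then show ?thesis by (auto simp: nbhd_def)
qed

lemma r'_par: "r' \<in> V" "r' \<noteq> r" "par r' = r" "r' \<in> heads"
proof -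
  show *: "r' \<in> V" "r' \<noteq> r" using edge_in(2)[OF r'(1)] edge_neq[OF r'(1)] by auto
  show "par r' = r" by (rule edge_cases[OF r'(1)]) auto
  then show "r' \<in> heads" using r'(2) * unfolding heads_def by auto
qed

lemma head_has_ext:
  assumes "B \<in> \<B>" "h \<in> B" "h \<in> heads"
  obtains y where "(h, y) \<in> E" "y \<notin> B"
proof (cases "h = r")
  case True
  then show ?thesis using that r' assms by blast
next
  case False
  then have "par h \<notin> B" using heads_iff[OF assms(1,2)] assms(3) by simp
  then show ?thesis using that par_edge(1)[of h] False block_sub[OF assms(1)] assms(2) by blast
qed

text \<open>A head has a neighbour outside its block: its parent, or \<open>r'\<close> in the case
  of the root. The leaf of a pair and the inner vertices of a quad have degrees too small for that,
  so the head is the other vertex of the pair or an end of the quad.\<close>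

lemma block_form:
  assumes "B \<in> \<B>"
  obtains (pair) a c where "B = {a, c}" "a \<in> heads" "lab c = SC" "c \<noteq> r" "par c = a" "deg E c = 1" "deg E a = 2"
  | (quad) a c d b where "B = {a, c, d, b}" "a \<in> heads" "lab c = SC" "c \<noteq> r" "par c = a"
      "lab d = SD" "d \<noteq> r" "par d = c" "lab b = SB" "b \<noteq> r" "par b = d"
      "deg E c = 2" "deg E d = 2" "2 \<le> deg E b" "deg E a = 2 \<or> deg E b = 2" "distinct [a, c, d, b]"
proof -
  obtain h where h: "h \<in> B" "B \<inter> heads = {h}" using heads_single[OF assms] by blast
  then have hh: "h \<in> heads" by blast
  obtain y where y: "(h, y) \<in> E" "y \<notin> B" using head_has_ext[OF assms h(1) hh] .
  from thin[OF assms] show ?thesis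
  proof
    assume "thin_pair E B"
    then obtain a c where ac: "B = {a, c}" "(a, c) \<in> E" "deg E c = 1" "deg E a = 2"
      unfolding thin_pair_def by blast
    have "h \<noteq> c"
      using leaf_nbr_unique[of E c a y] ac y edge_sym by (auto simp: leaf_def)
    then have "h = a" using h ac by auto
    then have nc: "a \<in> heads" "c \<notin> heads" using hh h(2) \<open>h \<noteq> c\<close> ac(1) by auto
    then have "c \<noteq> r \<and> par c = a"
    proof (cases rule: edge_cases[OF ac(2)])
      case 1 then show ?thesis by simp
    next
      case 2
      then show ?thesis using nc heads_iff[OF assms, of a] ac(1) by auto
    qed
    then show ?thesis using ac nc pair[of a c] by (auto simp: lab_def)
  next
    assume "thin_quad E B"
    then obtain p q s t where Q: "distinct [p, q, s, t]" "B = {p, q, s, t}" "(p, q) \<in> E" "(q, s) \<in> E" "(s, t) \<in> E"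
      "deg E p = 2" "deg E q = 2" "deg E s = 2" "2 \<le> deg E t" unfolding thin_quad_def by blast
    have main: thesis
      if Q: "distinct [p, q, s, t]" "B = {p, q, s, t}" "(p, q) \<in> E" "(q, s) \<in> E" "(s, t) \<in> E"
        and deg: "deg E q = 2" "deg E s = 2" "2 \<le> deg E t" "deg E p = 2 \<or> deg E t = 2" and p: "h = p" for p q s t
    proof -
      have nh: "x \<notin> heads" if "x \<in> B" "x \<noteq> p" for x using that h(2) p by auto
      have pB: "p \<in> B" "q \<in> B" using Q(2) by simp_all
      have top: "\<not> (p \<noteq> r \<and> q = par p)" using heads_iff[OF assms pB(1)] hh p pB(2) by auto
      have parq: "q \<noteq> r \<and> par q = p" by (rule edge_cases[OF Q(3)]) (use top in auto)
      have pars: "s \<noteq> r \<and> par s = q"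
      proof (rule edge_cases[OF Q(4)])
        assume "s = par q"
        then show ?thesis using parq Q(1) by simp
      qed simp
      have part: "t \<noteq> r \<and> par t = s"
      proof (rule edge_cases[OF Q(5)])
        assume "t = par s"
        then show ?thesis using pars Q(1) by simp
      qed simp
      have "q \<noteq> p" "s \<noteq> p" "t \<noteq> p" using Q(1) by auto
      then have "lab q = SC" "lab s = SD" "lab t = SB"
        using nh[of q] nh[of s] nh[of t] Q(1,2) hh p parq pars part by (simp_all add: lab_def)
      then show thesis
        using quad[of p q s t] Q(1,2) deg p hh parq pars part by simp
    qed
    have rev: "distinct [t, s, q, p]" "B = {t, s, q, p}" "(t, s) \<in> E" "(s, q) \<in> E" "(q, p) \<in> E"
      using Q(1-5) by (auto intro: edge_sym)
    have "h \<noteq> q" using deg_2_nbrs[OF Q(7) edge_sym[OF Q(3)] Q(4), of y] Q(1,2) y by auto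
    moreover have "h \<noteq> s" using deg_2_nbrs[OF Q(8) edge_sym[OF Q(4)] Q(5), of y] Q(1,2) y by auto
    ultimately consider "h = p" | "h = t" using h(1) Q(2) by blast
    then show thesis
    proof cases
      case 1
      then show ?thesis using main[OF Q(1-5,7,8,9)] Q(6) by simp
    next
      case 2
      then show ?thesis using main[OF rev Q(8,7)] Q(6) by simp
    qed
  qed
qed

text \<open>A child that is not a head shares the block of its parent, and a block contains exactly
  one child of its head.\<close>

lemma C_of:
  assumes "a \<in> heads"
  obtains c where "c \<in> V" "c \<noteq> r" "par c = a" "lab c = SC" "c \<notin> heads"
    "\<And>x. x \<in> V \<Longrightarrow> x \<noteq> r \<Longrightarrow> par x = a \<Longrightarrow> x \<notin> heads \<Longrightarrow> x = c"
proof -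
  obtain B where B: "B \<in> \<B>" "a \<in> B" using ex_block assms unfolding heads_def by blast
  have inB: "x \<in> B" if "x \<in> V" "x \<noteq> r" "par x = a" "x \<notin> heads" for x
    using that block_eq[OF B(1) _ B(2)] unfolding heads_def by blast
  have nh: "x \<notin> heads" if "lab x \<noteq> SA" for x using that by (auto simp: lab_def)
  from B(1) show ?thesis
  proof (cases rule: block_form)
    case (pair a' c)
    then have "a' = a" using head_unique[OF B(1) _ pair(2) B(2) assms] by simp
    show ?thesis
    proof (rule that[of c])
      show "c \<in> V" using block_sub[OF B(1)] pair(1) by blast
      show "c \<notin> heads" using nh[of c] pair(3) by simp
      fix x assume x: "x \<in> V" "x \<noteq> r" "par x = a" "x \<notin> heads"
      then have "x \<in> {a', c}" using inB pair(1) by blast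
      then show "x = c" using x(3,4) \<open>a' = a\<close> assms by auto
    qed (use pair(3-5) \<open>a' = a\<close> in simp_all)
  next
    case (quad a' c d b)
    then have "a' = a" using head_unique[OF B(1) _ quad(2) B(2) assms] by simp
    show ?thesis
    proof (rule that[of c])
      show "c \<in> V" using block_sub[OF B(1)] quad(1) by blast
      show "c \<notin> heads" using nh[of c] quad(3) by simp
      fix x assume x: "x \<in> V" "x \<noteq> r" "par x = a" "x \<notin> heads"
      then have "x \<in> {a', c, d, b}" using inB quad(1) by blast
      then show "x = c" using x(3,4) \<open>a' = a\<close> assms quad(5,8,11,16) by auto
    qed (use quad(3-5) \<open>a' = a\<close> in simp_all)
  qed
qed

text \<open>The last condition reflects that \<open>op3\<close> adds a vertex of status D only together with its child of status B and a
  child of the latter.\<close>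

definition grown :: "'a set \<Rightarrow> 'a set \<Rightarrow> bool" where
  "grown P W \<longleftrightarrow> W \<subseteq> V \<and> T2 W (E \<inter> W \<times> W) lab P \<and> {r, r'} \<subseteq> W \<and> P \<inter> heads = {r, r'} \<and>
     (\<forall>v\<in>W. v \<noteq> r \<longrightarrow> par v \<in> W) \<and>
     (\<forall>c\<in>V. c \<noteq> r \<longrightarrow> c \<notin> heads \<longrightarrow> par c \<in> W \<longrightarrow> par c \<in> heads \<longrightarrow> c \<in> W) \<and>
     (\<forall>d\<in>W. lab d = SD \<longrightarrow> (\<exists>b\<in>W. \<exists>z\<in>W. b \<noteq> r \<and> par b = d \<and> z \<noteq> r \<and> par z = b))"

lemma r_nbrs:
  obtains c where "c \<in> V" "c \<noteq> r" "par c = r" "lab c = SC" "c \<notin> heads" "\<And>y. (r, y) \<in> E \<longleftrightarrow> y = c \<or> y = r'"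
proof -
  obtain c where c: "c \<in> V" "c \<noteq> r" "par c = r" "lab c = SC" "c \<notin> heads" using C_of[OF r_head] by blast
  have "(r, c) \<in> E" using par_edge(2)[OF c(1,2)] c(3) by simp
  then show ?thesis using that[OF c] deg_2_nbrs[OF r'(3) _ r'(1)] c(5) r'_par(4) by blast
qed

lemma grown_start:
  obtains P where "grown P P"
proof -
  obtain c where c: "c \<in> V" "c \<noteq> r" "par c = r" "lab c = SC" "c \<notin> heads" "\<And>y. (r, y) \<in> E \<longleftrightarrow> y = c \<or> y = r'"
    using r_nbrs by blast
  obtain c' where c': "c' \<in> V" "c' \<noteq> r" "par c' = r'" "lab c' = SC" "c' \<notin> heads"
    "\<And>x. x \<in> V \<Longrightarrow> x \<noteq> r \<Longrightarrow> par x = r' \<Longrightarrow> x \<notin> heads \<Longrightarrow> x = c'" using C_of[OF r'_par(4)] by blast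
  define P where "P = {c, r, r', c'}"
  have d: "distinct [c, r, r', c']" 
  proof -
    have "c \<noteq> c'" using c(3) c'(3) r'_par(2) by auto
    then show ?thesis using c(2,5) c'(2,5) r'_par(2,4) r_head by auto
  qed
  have ra: "lab r = SA" "lab r' = SA" using r_head r'_par by (auto simp: lab_def)
  have "E \<inter> P \<times> P = sym_edges {(c, r), (r, r'), (r', c')}" (is "?L = ?R")
  proof (intro subset_antisym subrelI)
    fix x y assume "(x, y) \<in> ?L"
    then have "(x, y) \<in> E" "x \<in> P" "y \<in> P" by auto
    then show "(x, y) \<in> ?R"
      by (cases rule: edge_cases) (use c(3) c'(3) r'_par(3) in \<open>auto simp: P_def sym_edges_def\<close>)
  next
    fix x y assume "(x, y) \<in> ?R"
    then show "(x, y) \<in> ?L"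
      using par_edge[OF c(1,2)] par_edge[OF c'(1,2)] c(3) c'(3) r'(1) edge_sym[OF r'(1)]
      by (auto simp: P_def sym_edges_def)
  qed
  moreover have "T2 {c, r, r', c'} (sym_edges {(c, r), (r, r'), (r', c')}) lab {c, r, r', c'}"
    using T2.start[OF d, of lab] c(4) c'(4) ra by simp
  ultimately have T: "T2 P (E \<inter> P \<times> P) lab P" by (simp add: P_def)
  have "grown P P"
    unfolding grown_def
  proof (intro conjI ballI impI T)
    show "P \<subseteq> V" "{r, r'} \<subseteq> P" "P \<inter> heads = {r, r'}"
      using c(1,5) c'(1,5) r_in r_head r'_par by (auto simp: P_def)
    show "par v \<in> P" if "v \<in> P" "v \<noteq> r" for v using that c(3) c'(3) r'_par(3) by (auto simp: P_def)
    fix x assume x: "x \<in> V" "x \<noteq> r" "x \<notin> heads" "par x \<in> P" "par x \<in> heads"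
    then have "par x = r \<or> par x = r'" using c(5) c'(5) by (auto simp: P_def)
    then show "x \<in> P"
    proof
      assume "par x = r"
      then have "(r, x) \<in> E" using par_edge(2)[OF x(1,2)] by simp
      then show ?thesis using c(6) r'_par(4) x(3) by (auto simp: P_def)
    next
      assume "par x = r'"
      then show ?thesis using c'(6)[OF x(1,2)] x(3) by (auto simp: P_def)
    qed
  next
    fix x assume "x \<in> P" "lab x = SD"
    then have False using c(4) c'(4) ra by (auto simp: P_def)
    then show "\<exists>b\<in>P. \<exists>z\<in>P. b \<noteq> r \<and> par b = x \<and> z \<noteq> r \<and> par z = b" ..
  qed
  then show ?thesis using that by blast
qed

lemma sym_edges_sub: "F \<subseteq> E \<inter> W \<times> W \<Longrightarrow> sym_edges F \<subseteq> E \<inter> W \<times> W"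
  using edge_sym unfolding sym_edges_def by blast

lemma lab_head: "v \<in> heads \<Longrightarrow> lab v = SA"
  by (simp add: lab_def)

lemma deg_sub:
  assumes "v \<in> W" "\<And>y. (v, y) \<in> E \<Longrightarrow> y \<in> W"
  shows "deg (E \<inter> W \<times> W) v = deg E v"
proof -
  have "nbhd (E \<inter> W \<times> W) v = nbhd E v" using assms by (auto simp: nbhd_def)
  then show ?thesis by (simp add: deg_def)
qed

context
  fixes P W assumes gr: "grown P W"
begin

lemma W_sub: "W \<subseteq> V" and W_T2: "T2 W (E \<inter> W \<times> W) lab P" and W_r: "r \<in> W" "r' \<in> W"
  and P_heads: "P \<inter> heads = {r, r'}"
  and W_par: "v \<in> W \<Longrightarrow> v \<noteq> r \<Longrightarrow> par v \<in> W"
  and W_C: "c \<in> V \<Longrightarrow> c \<noteq> r \<Longrightarrow> c \<notin> heads \<Longrightarrow> par c \<in> W \<Longrightarrow> par c \<in> heads \<Longrightarrow> c \<in> W"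
  and W_D: "d \<in> W \<Longrightarrow> lab d = SD \<Longrightarrow> \<exists>b\<in>W. \<exists>z\<in>W. b \<noteq> r \<and> par b = d \<and> z \<noteq> r \<and> par z = b"
  using gr unfolding grown_def by blast+

text \<open>Degree two leaves room only for the parent (\<open>r'\<close> in the case of the root)
  and the child of status C, and \<open>grown\<close> puts both into \<open>W\<close>.\<close>

lemma thin_head_nbrs:
  assumes "a \<in> heads" "a \<in> W" "deg E a = 2" "(a, y) \<in> E"
  shows "y \<in> W"
proof (cases "a = r")
  case True
  obtain c where "c \<in> V" "c \<noteq> r" "par c = r" "c \<notin> heads" "\<And>y. (r, y) \<in> E \<longleftrightarrow> y = c \<or> y = r'"
    using r_nbrs by blast
  then show ?thesis using True assms(2,4) W_r W_C[of c] r_head by auto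
next
  case False
  obtain c where c: "c \<in> V" "c \<noteq> r" "par c = a" "c \<notin> heads" using C_of[OF assms(1)] by blast
  have "a \<in> V" using assms(2) W_sub by blast
  then have "(a, par a) \<in> E" "(a, c) \<in> E" "par a \<noteq> c"
    using par_edge(1)[of a] par_edge(2)[OF c(1,2)] c(3) False dep_par[OF c(1,2)] dep_par[of a] by auto
  then have "y = par a \<or> y = c" using deg_2_nbrs[OF assms(3), of "par a" c y] assms(4) by blast
  then show ?thesis using W_par[OF assms(2) False] W_C[OF c(1,2,4)] c(3) assms(1,2) by auto
qed

lemma not_leaf_W:
  assumes "(v, x) \<in> E" "(v, y) \<in> E" "x \<noteq> y" "v \<in> W" "x \<in> W" "y \<in> W"
  shows "\<not> leaf (E \<inter> W \<times> W) v"
  using leaf_nbr_unique[of "E \<inter> W \<times> W" v x y] assms by auto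

lemma par_neq_child:
  assumes "v \<in> V" "v \<noteq> r" "x \<in> V" "x \<noteq> r" "par x = v"
  shows "par v \<noteq> x"
proof
  assume "par v = x"
  have "dep v = Suc (dep x)" using dep_par[OF assms(1,2)] unfolding \<open>par v = x\<close> .
  moreover have "dep x = Suc (dep v)" using dep_par[OF assms(3,4)] unfolding assms(5) .
  ultimately show False by simp
qed

lemma child_edge: "x \<in> V \<Longrightarrow> x \<noteq> r \<Longrightarrow> par x = v \<Longrightarrow> (v, x) \<in> E"
  using par_edge(2) by auto

text \<open>Besides \<open>d\<close> and \<open>b\<close>, \<open>op3\<close> requires a child
  \<open>z\<close> of \<open>b\<close> and its child of status C. \<open>z\<close> exists since
  \<open>b\<close> has degree at least two; further children of \<open>b\<close> are left to
  \<open>op2\<close>.\<close>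

lemma grow_D:
  assumes d: "d \<in> V" "d \<notin> W" "d \<noteq> r" "par d \<in> W" "lab d = SD"
  shows "\<exists>W'. grown P W' \<and> card W < card W'"
proof -
  obtain B where B: "B \<in> \<B>" "d \<in> B" using ex_block d(1) by blast
  from B(1) show ?thesis
  proof (cases rule: block_form)
    case (pair a c)
    then show ?thesis using B(2) d(5) by (auto simp: lab_def)
  next
    case (quad a c d' b)
    have "lab a = SA" using quad(2) by (simp add: lab_def)
    then have [simp]: "d' = d" using B(2) quad(1,3,6,9) d(5) by auto
    have V: "a \<in> V" "c \<in> V" "b \<in> V" using block_sub[OF B(1)] quad(1) by auto
    have nh: "c \<notin> heads" "d \<notin> heads" "b \<notin> heads" using quad(3,6,9) by (auto simp: lab_def)
    have "card {d} < deg E b" using quad(14) by simp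
    then obtain z where z: "(b, z) \<in> E" "z \<notin> {d}" using nbr_outside[of "{d}" E b] by auto
    then have zb: "z \<in> V" "z \<noteq> r" "par z = b"
      using edge_cases[OF z(1)] edge_in(2)[OF z(1)] quad(10,11) by auto
    have zB: "z \<notin> B"
    proof
      assume "z \<in> B"
      then have "z = a" using quad(1,5,8,11,16) zb(3) by auto
      then have "b \<notin> B" using heads_iff[OF B(1), of a] quad(1,2) zb(2,3) by auto
      then show False using quad(1) by simp
    qed
    have zh: "z \<in> heads"
      using ex_block[OF zb(1)] block_eq[OF B(1)] zB zb(1,3) quad(1) unfolding heads_def by blast
    obtain e where e: "e \<in> V" "e \<noteq> r" "par e = z" "lab e = SC" "e \<notin> heads"
      "\<And>x. x \<in> V \<Longrightarrow> x \<noteq> r \<Longrightarrow> par x = z \<Longrightarrow> x \<notin> heads \<Longrightarrow> x = e" using C_of[OF zh] by blast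
    have cW: "c \<in> W" using d(4) quad(8) by simp
    then have aW: "a \<in> W" using W_par[of c] quad(4,5) by simp
    have bW: "b \<notin> W" using W_par[of b] quad(10,11) d(2) by auto
    have zW: "z \<notin> W" using W_par[of z] zb bW by auto
    have eW: "e \<notin> W" using W_par[of e] e(2,3) zW by auto
    have dep: "dep b = Suc (dep d)" "dep z = Suc (dep b)" "dep e = Suc (dep z)"
      using dep_par[OF V(3) quad(10)] dep_par[OF zb(1,2)] dep_par[OF e(1,2)] quad(11) zb(3) e(3) by simp_all
    then have dist: "distinct [d, b, z, e]" by auto
    define W' where "W' = W \<union> {d, b, z, e}"
    have edges: "E \<inter> W' \<times> W' = E \<inter> W \<times> W \<union> sym_edges {(d, c), (d, b), (b, z), (z, e)}" (is "?L = ?R")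
    proof (intro subset_antisym subrelI)
      have half: "(x, y) \<in> ?R \<and> (y, x) \<in> ?R" if "x \<in> W'" "y \<in> W'" "x \<noteq> r" "y = par x" "(x, y) \<in> E" for x y
      proof (cases "x \<in> W")
        case True
        then show ?thesis using that W_par[of x] edge_sym by auto
      next
        case False
        then have "x = d \<or> x = b \<or> x = z \<or> x = e" using that(1) by (auto simp: W'_def)
        then show ?thesis using that(4) quad(8,11) zb(3) e(3) by (auto simp: sym_edges_def)
      qed
      fix x y assume "(x, y) \<in> ?L"
      then have m: "(x, y) \<in> E" "x \<in> W'" "y \<in> W'" by auto
      from m(1) show "(x, y) \<in> ?R"
      proof (cases rule: edge_cases)
        case down
        then show ?thesis using half[OF m(3,2) _ _ edge_sym[OF m(1)]] by blast
      next
        case up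
        then show ?thesis using half[OF m(2,3) _ _ m(1)] by blast
      qed
    next
      have "(c, d) \<in> E" "(d, b) \<in> E" "(b, z) \<in> E" "(z, e) \<in> E"
        using child_edge[OF d(1,3)] child_edge[OF V(3) quad(10)] child_edge[OF zb(1,2)] child_edge[OF e(1,2)]
          quad(8,11) zb(3) e(3) by simp_all
      then have "{(d, c), (d, b), (b, z), (z, e)} \<subseteq> ?L"
        using cW edge_sym[of c d] by (simp add: W'_def)
      then have "sym_edges {(d, c), (d, b), (b, z), (z, e)} \<subseteq> ?L" by (rule sym_edges_sub)
      moreover have "E \<inter> W \<times> W \<subseteq> ?L" unfolding W'_def by blast
      moreover fix x y assume "(x, y) \<in> ?R"
      ultimately show "(x, y) \<in> ?L" by blast
    qed
    have ca: "(c, a) \<in> E" "(c, d) \<in> E" "a \<noteq> d"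
      using par_edge(1)[OF V(2) quad(4)] child_edge[OF d(1,3)] quad(5,8,16) by auto
    \<comment> \<open>\<open>c\<close> has degree two and its neighbour \<open>d\<close> is missing,
      so \<open>c\<close> is a leaf of the current tree, as \<open>op3\<close> demands.\<close>
    have "nbhd (E \<inter> W \<times> W) c = {a}"
      using deg_2_nbrs[OF quad(12) ca(1,2,3)] cW aW d(2) by (auto simp: nbhd_def)
    then have "deg (E \<inter> W \<times> W) c = 1" by (simp add: deg_def)
    then have "T2 (W \<union> {d, b, z, e}) (E \<inter> W \<times> W \<union> sym_edges {(d, c), (d, b), (b, z), (z, e)})
      (lab(d := SD, b := SB, z := SA, e := SC)) P"
      using T2.op3[OF W_T2 cW quad(3) _ d(2) bW zW eW dist] by simp
    moreover have "lab(d := SD, b := SB, z := SA, e := SC) = lab"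
      using d(5) quad(9) e(4) lab_head[OF zh] by (auto simp: fun_eq_iff)
    ultimately have T: "T2 W' (E \<inter> W' \<times> W') lab P" using edges by (simp add: W'_def)
    have "grown P W'"
      unfolding grown_def
    proof (intro conjI ballI impI T P_heads)
      show "W' \<subseteq> V" using W_sub d(1) V(3) zb(1) e(1) by (auto simp: W'_def)
      show "{r, r'} \<subseteq> W'" using W_r by (auto simp: W'_def)
      show "par v \<in> W'" if "v \<in> W'" "v \<noteq> r" for v
        using that W_par[of v] quad(11) zb(3) e(3) d(4) by (auto simp: W'_def)
      fix x assume x: "x \<in> V" "x \<noteq> r" "x \<notin> heads" "par x \<in> W'" "par x \<in> heads"
      then consider "par x \<in> W" | "par x = z" using nh e(5) by (auto simp: W'_def)
      then show "x \<in> W'"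
      proof cases
        case 1 then show ?thesis using W_C[OF x(1-3) _ x(5)] by (simp add: W'_def)
      next
        case 2 then show ?thesis using e(6)[OF x(1,2) _ x(3)] by (simp add: W'_def)
      qed
    next
      fix x assume x: "x \<in> W'" "lab x = SD"
      show "\<exists>b\<in>W'. \<exists>z\<in>W'. b \<noteq> r \<and> par b = x \<and> z \<noteq> r \<and> par z = b"
      proof (cases "x \<in> W")
        case True
        then show ?thesis using W_D[OF True x(2)] unfolding W'_def by blast
      next
        case False
        then have "x = d" using x quad(9) e(4) zh by (auto simp: W'_def lab_def)
        then show ?thesis using quad(10,11) zb(2,3) unfolding W'_def by auto
      qed
    qed
    moreover have "card W < card W'"
      using finite_subset[OF W_sub finite_V] d(2) by (intro psubset_card_mono) (auto simp: W'_def)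
    ultimately show ?thesis by blast
  qed
qed

text \<open>The missing head \<open>y\<close> is added with its child of status C, whatever the kind
  of its block; the rest of a quad is left to \<open>grow_D\<close>.\<close>

lemma grow_pair:
  assumes y: "y \<in> V" "y \<notin> W" "y \<noteq> r" "y \<in> heads" "par y = x" "x \<in> W"
    and legal: "lab x = SB \<and> (\<exists>w. corr_of_B W (E \<inter> W \<times> W) lab x w \<and> deg (E \<inter> W \<times> W) w = 2) \<or>
      x \<notin> P \<and> lab x = SA \<and> (\<exists>w. corr_of_A W (E \<inter> W \<times> W) lab P x w \<and> deg (E \<inter> W \<times> W) w = 2)"
  shows "\<exists>W'. grown P W' \<and> card W < card W'"
proof -
  obtain e where e: "e \<in> V" "e \<noteq> r" "par e = y" "lab e = SC" "e \<notin> heads"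
    "\<And>u. u \<in> V \<Longrightarrow> u \<noteq> r \<Longrightarrow> par u = y \<Longrightarrow> u \<notin> heads \<Longrightarrow> u = e" using C_of[OF y(4)] by blast
  have eW: "e \<notin> W" using W_par[of e] e(2,3) y(2) by auto
  have ye: "y \<noteq> e" using y(4) e(5) by auto
  define W' where "W' = W \<union> {y, e}"
  have edges: "E \<inter> W' \<times> W' = E \<inter> W \<times> W \<union> sym_edges {(y, x), (y, e)}" (is "?L = ?R")
  proof (intro subset_antisym subrelI)
    have half: "(p, q) \<in> ?R \<and> (q, p) \<in> ?R" if "p \<in> W'" "q \<in> W'" "p \<noteq> r" "q = par p" "(p, q) \<in> E" for p q
    proof (cases "p \<in> W")
      case True
      then show ?thesis using that W_par[of p] edge_sym by auto
    next
      case False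
      then have "p = y \<or> p = e" using that(1) by (auto simp: W'_def)
      then show ?thesis using that(4) y(5) e(3) by (auto simp: sym_edges_def)
    qed
    fix p q assume "(p, q) \<in> ?L"
    then have m: "(p, q) \<in> E" "p \<in> W'" "q \<in> W'" by auto
    from m(1) show "(p, q) \<in> ?R"
    proof (cases rule: edge_cases)
      case down
      then show ?thesis using half[OF m(3,2) _ _ edge_sym[OF m(1)]] by blast
    next
      case up
      then show ?thesis using half[OF m(2,3) _ _ m(1)] by blast
    qed
  next
    have "(x, y) \<in> E" "(y, e) \<in> E" using child_edge[OF y(1,3,5)] child_edge[OF e(1-3)] .
    then have "{(y, x), (y, e)} \<subseteq> ?L"
      using y(6) edge_sym[of x y] by (simp add: W'_def)
    then have "sym_edges {(y, x), (y, e)} \<subseteq> ?L" by (rule sym_edges_sub)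
    moreover have "E \<inter> W \<times> W \<subseteq> ?L" unfolding W'_def by blast
    moreover fix p q assume "(p, q) \<in> ?R"
    ultimately show "(p, q) \<in> ?L" by blast
  qed
  have "T2 (W \<union> {y, e}) (E \<inter> W \<times> W \<union> sym_edges {(y, x), (y, e)}) (lab(y := SA, e := SC)) P"
    using legal T2.op2[OF W_T2 y(6) _ _ y(2) eW ye] T2.op4[OF W_T2 y(6) _ _ _ y(2) eW ye] by blast
  moreover have "lab(y := SA, e := SC) = lab"
    using e(4) lab_head[OF y(4)] by (auto simp: fun_eq_iff)
  ultimately have T: "T2 W' (E \<inter> W' \<times> W') lab P" using edges by (simp add: W'_def)
  have "grown P W'"
    unfolding grown_def
  proof (intro conjI ballI impI T P_heads)
    show "W' \<subseteq> V" using W_sub y(1) e(1) by (auto simp: W'_def)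
    show "{r, r'} \<subseteq> W'" using W_r by (auto simp: W'_def)
    show "par v \<in> W'" if "v \<in> W'" "v \<noteq> r" for v
      using that W_par[of v] y(5,6) e(3) by (auto simp: W'_def)
    fix u assume u: "u \<in> V" "u \<noteq> r" "u \<notin> heads" "par u \<in> W'" "par u \<in> heads"
    then consider "par u \<in> W" | "par u = y" using e(5) by (auto simp: W'_def)
    then show "u \<in> W'"
    proof cases
      case 1 then show ?thesis using W_C[OF u(1-3) _ u(5)] by (simp add: W'_def)
    next
      case 2 then show ?thesis using e(6)[OF u(1,2) _ u(3)] by (simp add: W'_def)
    qed
  next
    fix u assume u: "u \<in> W'" "lab u = SD"
    then have "u \<in> W" using e(4) y(4) by (auto simp: W'_def lab_def)
    then show "\<exists>b\<in>W'. \<exists>z\<in>W'. b \<noteq> r \<and> par b = u \<and> z \<noteq> r \<and> par z = b"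
      using W_D[OF _ u(2)] unfolding W'_def by blast
  qed
  moreover have "card W < card W'"
    using finite_subset[OF W_sub finite_V] y(2) by (intro psubset_card_mono) (auto simp: W'_def)
  ultimately show ?thesis by blast
qed

text \<open>If no \<open>op3\<close> step is available, a missing vertex can hang only at an end of
  a quad: heads of pairs have degree two, leaves have no children, and both neighbours of
  \<open>c\<close> and of \<open>d\<close> are present. As one end of the quad has degree two, the
  other one may be extended.\<close>

lemma grow:
  assumes "W \<noteq> V"
  shows "\<exists>W'. grown P W' \<and> card W < card W'"
proof (cases "\<exists>d. d \<in> V \<and> d \<notin> W \<and> d \<noteq> r \<and> par d \<in> W \<and> lab d = SD")
  case True
  then show ?thesis using grow_D by blast
next
  case noD: False
  have "\<exists>x\<in>W. \<exists>y. (x, y) \<in> E \<and> y \<notin> W"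
  proof (rule ccontr)
    assume "\<not> ?thesis"
    then have "W = V" using W_sub W_r by (intro closed_set_eq) auto
    then show False using assms by simp
  qed
  then obtain x y where xy: "x \<in> W" "(x, y) \<in> E" "y \<notin> W" by blast
  have y: "y \<in> V" "y \<noteq> r" "par y = x"
    using edge_in(2)[OF xy(2)] edge_cases[OF xy(2)] W_par[OF xy(1)] xy(3) by auto
  have xV: "x \<in> V" using xy(1) W_sub by blast
  obtain B where B: "B \<in> \<B>" "x \<in> B" using ex_block xV by blast
  from B(1) show ?thesis
  proof (cases rule: block_form)
    case (pair a c)
    have "a \<in> V" "c \<in> V" using block_sub[OF B(1)] pair(1) by auto
    then have ac: "(a, c) \<in> E" using child_edge pair(4,5) by simp
    show ?thesis
    proof (cases "x = a")
      case True
      then show ?thesis using thin_head_nbrs[OF pair(2) _ pair(7), of y] xy by simp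
    next
      case False
      then have "x = c" using B(2) pair(1) by blast
      then have "y = a" using leaf_nbr_unique[of E c y a] pair(6) xy(2) edge_sym[OF ac] by (auto simp: leaf_def)
      then show ?thesis using W_par[OF xy(1)] pair(4,5) \<open>x = c\<close> xy(3) by simp
    qed
  next
    case (quad a c d b)
    have V: "a \<in> V" "c \<in> V" "d \<in> V" "b \<in> V" using block_sub[OF B(1)] quad(1) by auto
    have E: "(a, c) \<in> E" "(c, d) \<in> E" "(d, b) \<in> E"
      using child_edge[OF V(2) quad(4,5)] child_edge[OF V(3) quad(7,8)] child_edge[OF V(4) quad(10,11)] .
    note E' = E[THEN edge_sym]
    have dist: "a \<noteq> c" "a \<noteq> d" "a \<noteq> b" "c \<noteq> d" "c \<noteq> b" "d \<noteq> b" using quad(16) by auto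
    note ind = path_induced[OF E dist(2) dist(5)]
    have la: "lab a = SA" using quad(2) by (simp add: lab_def)
    have nh: "c \<notin> heads" "d \<notin> heads" "b \<notin> heads" using quad(3,6,9) by (auto simp: lab_def)
    have dW: "d \<in> W" if "c \<in> W" using noD V(3) quad(6,7,8) that by auto
    have b_W: "b \<in> W \<and> (\<exists>z\<in>W. (b, z) \<in> E \<and> z \<noteq> d)" if dw: "d \<in> W"
    proof -
      obtain b' z where bz: "b' \<in> W" "z \<in> W" "b' \<noteq> r" "par b' = d" "z \<noteq> r" "par z = b'"
        using W_D[OF dw quad(6)] by blast
      have bV: "b' \<in> V" "z \<in> V" using bz W_sub by blast+
      have "(d, b') \<in> E" using child_edge[OF bV(1) bz(3,4)] .
      moreover have "b' \<noteq> c" using par_neq_child[OF V(3) quad(7) bV(1) bz(3,4)] quad(8) by simp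
      ultimately have "b' = b" using deg_2_nbrs[OF quad(13) E'(2) E(3) dist(5)] by blast
      moreover have "(b', z) \<in> E" using child_edge[OF bV(2) bz(5,6)] .
      moreover have "z \<noteq> d" using par_neq_child[OF bV(1) bz(3) bV(2) bz(5,6)] bz(4) by simp
      ultimately show ?thesis using bz by blast
    qed
    have P4: "induced_P4 W (E \<inter> W \<times> W) a c d b" if "a \<in> W" "c \<in> W" "d \<in> W" "b \<in> W"
      unfolding induced_P4_def using that E ind quad(16) by simp
    consider "x = a" | "x = c" | "x = d" | "x = b" using B(2) quad(1) by blast
    then show ?thesis
    proof cases
      case 2
      then have "y = a \<or> y = d" using deg_2_nbrs[OF quad(12) E'(1) E(2) dist(2)] xy(2) by blast
      then show ?thesis using xy(3) W_par[OF xy(1)] dW 2 xy(1) quad(4,5) by auto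
    next
      case 3
      then have "y = c \<or> y = b" using deg_2_nbrs[OF quad(13) E'(2) E(3) dist(5)] xy(2) by blast
      then show ?thesis using xy(3) W_par[OF xy(1)] b_W 3 xy(1) quad(7,8) by auto
    next
      case 4
      have W: "d \<in> W" "c \<in> W" "a \<in> W"
        using W_par[of b] W_par[of d] W_par[of c] xy(1) 4 quad(4,5,7,8,10,11) by auto
      obtain z where z: "z \<in> W" "(b, z) \<in> E" "z \<noteq> d" using b_W[OF W(1)] by blast
      \<comment> \<open>\<open>d\<close>, \<open>z\<close> and the missing \<open>y\<close> are
        three neighbours of \<open>b\<close>. So \<open>a\<close> is the end of degree two; it has
        both neighbours in \<open>W\<close>, and \<open>op2\<close> is legal at
        \<open>b\<close>.\<close>
      have "deg E b \<noteq> 2"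
        using deg_2_nbrs[OF _ E'(3) z(2), of y] z(1,3) xy W(1) 4 by auto
      then have da: "deg E a = 2" using quad(15) by simp
      then have "deg (E \<inter> W \<times> W) a = 2"
        using deg_sub[of a W] W(3) thin_head_nbrs[OF quad(2) W(3) da] by simp
      moreover have "corr_of_B W (E \<inter> W \<times> W) lab b a"
        unfolding corr_of_B_def using P4 W xy(1) 4 quad(3,6,9) la by blast
      moreover have "y \<in> heads"
      proof (rule ccontr)
        assume "y \<notin> heads"
        then obtain C where C: "C \<in> \<B>" "y \<in> C" "b \<in> C" using y 4 unfolding heads_def by auto
        then have "y \<in> B" using block_eq[OF B(1) C(1), of b] B(2) 4 by simp
        then have "y = b" using quad(1) W xy(3) by auto
        then show False using xy(2) 4 no_loop by simp
      qed
      ultimately show ?thesis using grow_pair[OF y(1) xy(3) y(2) _ y(3) xy(1)] 4 quad(9) by blast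
    next
      case 1
      have aW: "a \<in> W" using xy(1) 1 by simp
      have cW: "c \<in> W" using W_C[OF V(2) quad(4) nh(1)] quad(5,2) aW by simp
      note dW = dW[OF cW]
      note bW = b_W[OF dW]
      \<comment> \<open>As a neighbour of \<open>a\<close> is missing, \<open>b\<close> must be the
        end of degree two. Moreover \<open>a\<close> is off the basic path, because the heads on it
        have degree two.\<close>
      have da: "deg E a \<noteq> 2" using thin_head_nbrs[OF quad(2) aW] xy 1 by blast
      then have db: "deg E b = 2" using quad(15) by simp
      have ar: "a \<noteq> r" "a \<noteq> r'" using da r'(3,4) by auto
      then have aP: "a \<notin> P" using P_heads quad(2) by blast
      obtain z where z: "z \<in> W" "(b, z) \<in> E" "z \<noteq> d" using bW by blast
      have "deg (E \<inter> W \<times> W) b = 2"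
        using deg_sub[of b W] bW db deg_2_nbrs[OF db E'(3) z(2)] z(1,3) dW by auto
      moreover have yh: "y \<in> heads" using W_C[OF y(1,2)] y(3) xy(1,3) quad(2) 1 by blast
      \<comment> \<open>Every neighbour of \<open>a\<close> in \<open>W\<close> has a second
        neighbour there: the parent of \<open>a\<close> is not the root and has its own parent, a
        child that is a head has its child of status C, and \<open>c\<close> has
        \<open>d\<close>.\<close>
      moreover have "\<not> support (E \<inter> W \<times> W) a"
        unfolding support_def
      proof (intro notI, elim exE conjE)
        fix u assume u: "(a, u) \<in> E \<inter> W \<times> W" "leaf (E \<inter> W \<times> W) u"
        have uW: "u \<in> W" and au: "(a, u) \<in> E" using u(1) by auto
        have uV: "u \<in> V" using uW W_sub by blast
        from au show False
        proof (cases rule: edge_cases)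
          case up
          have "u \<noteq> r"
          proof
            assume ur: "u = r"
            then have "(r, a) \<in> E" using edge_sym[OF au] by simp
            obtain k where "k \<notin> heads" "\<And>y. (r, y) \<in> E \<longleftrightarrow> y = k \<or> y = r'" using r_nbrs by metis
            then show False using \<open>(r, a) \<in> E\<close> ar(2) quad(2) by auto
          qed
          note ur = this
          have "(u, par u) \<in> E" using par_edge(1)[OF uV ur] .
          moreover have "par u \<in> W" using W_par[OF uW ur] .
          moreover have "par u \<noteq> a" using par_neq_child[OF uV ur V(1) ar(1) up(2)[symmetric]] .
          ultimately show False using not_leaf_W[OF edge_sym[OF au], of "par u"] uW aW u(2) by blast
        next
          case down
          show False
          proof (cases "u \<in> heads")
            case True
            obtain k where k: "k \<in> V" "k \<noteq> r" "par k = u" "k \<notin> heads" using C_of[OF True] by blast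
            have "k \<in> W" using W_C[OF k(1,2,4)] k(3) uW True by simp
            moreover have "k \<noteq> a" using k(4) quad(2) by auto
            ultimately show False
              using not_leaf_W[OF edge_sym[OF au] child_edge[OF k(1-3)]] uW aW u(2) by blast
          next
            case False
            obtain k where k: "\<And>x. x \<in> V \<Longrightarrow> x \<noteq> r \<Longrightarrow> par x = a \<Longrightarrow> x \<notin> heads \<Longrightarrow> x = k"
              using C_of[OF quad(2)] by metis
            have "u = c" using k[OF uV _ _ False] k[OF V(2) quad(4,5) nh(1)] down by simp
            then show False using not_leaf_W[OF E'(1) E(2) dist(2)] cW aW dW u(2) by simp
          qed
        qed
      qed
      moreover have "induced_P4 W (E \<inter> W \<times> W) a c d b" using P4[OF aW cW dW] bW by blast
      ultimately have "corr_of_A W (E \<inter> W \<times> W) lab P a b"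
        unfolding corr_of_A_def using la aP quad(3,6,9) by blast
      then show ?thesis
        using grow_pair[OF y(1) xy(3) y(2) yh y(3) xy(1)] 1 la aP \<open>deg (E \<inter> W \<times> W) b = 2\<close> by blast
    qed
  qed
qed

end

lemma T2_of_thin: "\<exists>S P. T2 V E S P"
proof -
  obtain P where P: "grown P P" by (rule grown_start)
  have "\<exists>W. grown P W \<and> W = V"
  proof (rule ccontr)
    assume no: "\<not> ?thesis"
    have "\<exists>W. grown P W \<and> n \<le> card W" for n
    proof (induction n)
      case 0
      then show ?case using P by blast
    next
      case (Suc n)
      then obtain W where W: "grown P W" "n \<le> card W" by blast
      then obtain W' where "grown P W'" "card W < card W'" using grow[OF W(1)] no by blast
      then show ?case using W(2) by (intro exI[of _ W']) simp
    qed
    then obtain W where W: "grown P W" "Suc (card V) \<le> card W" by blast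
    have "W \<subseteq> V" using W(1) by (simp add: grown_def)
    then show False using card_mono[OF finite_V \<open>W \<subseteq> V\<close>] W(2) by simp
  qed
  then have "T2 V (E \<inter> V \<times> V) lab P" by (auto simp: grown_def)
  moreover have "E \<inter> V \<times> V = E" using edge_in by auto
  ultimately show ?thesis by auto
qed

end

section \<open>From a tight partition to the family, and the final equivalence\<close>

lemma thin_block_exit:
  assumes T: "tree V E" and n: "3 \<le> card V" and part: "block_partition V E \<B>" and B: "B \<in> \<B>"
    and thin: "thin_pair E B \<or> thin_quad E B"
  shows "\<exists>t e. t \<in> B \<and> deg E t = 2 \<and> (t, e) \<in> E \<and> e \<notin> B"
  using thin
proof
  have g: "finite V" "E \<subseteq> V \<times> V" "\<And>v. (v, v) \<notin> E" using T by (auto simp: tree_def graph_def)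
  assume "thin_pair E B"
  then obtain a c where ac: "B = {a, c}" "(a, c) \<in> E" "deg E a = 2" unfolding thin_pair_def by blast
  then have "card {c} < deg E a" by simp
  then obtain e where "(a, e) \<in> E" "e \<notin> {c}" using nbr_outside[of "{c}" E a] by auto
  then show ?thesis using ac g(3) by (intro exI[of _ a] exI[of _ e]) auto
next
  assume "thin_quad E B"
  then obtain p q s t where Q: "distinct [p, q, s, t]" "B = {p, q, s, t}" "(p, q) \<in> E" "(q, s) \<in> E" "(s, t) \<in> E"
    "deg E p = 2" unfolding thin_quad_def by blast
  have "p \<in> V" using B part Q(2) by (auto simp: block_partition_def)
  then obtain par dep where "rooted_tree V E p par dep" using tree_rooted[OF T] by blast
  then interpret rooted_tree V E p par dep .
  have "p \<noteq> s" "q \<noteq> t" using Q(1) by auto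
  note ind = path_induced[OF Q(3-5) this]
  have "card {q} < deg E p" using Q(6) by simp
  then obtain e where e: "(p, e) \<in> E" "e \<notin> {q}" using nbr_outside[of "{q}" E p] by auto
  then have "e \<noteq> p" "e \<noteq> s" "e \<noteq> t" using ind no_loop by auto
  then show ?thesis using Q(2,6) e by (intro exI[of _ p] exI[of _ e]) auto
qed

lemma T2_of_tight:
  assumes T: "tree V E" and n: "3 \<le> card V" and part: "block_partition V E \<B>"
    and min: "card \<B> \<le> gamma_2d V E"
  shows "\<exists>S P. T2 V E S P"
proof -
  have thin: "thin_pair E B \<or> thin_quad E B" if "B \<in> \<B>" for B
    using blocks_thin[OF T n part min that] .
  obtain x0 where "x0 \<in> V" using T by (auto simp: tree_def)
  then obtain par dep where "rooted_tree V E x0 par dep" using tree_rooted[OF T] by blast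
  then interpret A: rooted_blocks V E x0 par dep \<B>
    using part n by (simp add: rooted_blocks_def rooted_blocks_axioms_def)
  obtain r r' B where r: "(r, r') \<in> E" "B \<in> \<B>" "r \<in> B" "r' \<notin> B" "deg E r = 2" "deg E r' = 2"
    using A.ex_thin_edge[OF thin_block_exit[OF T n part _ thin]] by blast
  \<comment> \<open>The edge was found with an arbitrary root; the labelling requires the tree to be
    rooted anew at an end of this edge.\<close>
  have "r \<in> V" using A.block_sub r(2,3) by blast
  then obtain par dep where "rooted_tree V E r par dep" using tree_rooted[OF T] by blast
  then interpret rooted_blocks V E r par dep \<B>
    using part n by (simp add: rooted_blocks_def rooted_blocks_axioms_def)
  interpret thin_rooted V E r par dep \<B> r'
    by unfold_locales (use thin r block_eq in blast)+
  show ?thesis by (rule T2_of_thin)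
qed

theorem theorem2p4:
  fixes V :: "'a set" and E :: "('a \<times> 'a) set"
  assumes "tree V E" and "card V \<ge> 2"
  shows "4 * gamma_2d V E \<le> card V + num_leaves V E + num_support V E
     \<and> (4 * gamma_2d V E = card V + num_leaves V E + num_support V E
          \<longleftrightarrow> (\<exists>S P. T2 V E S P))"
proof -
  have fin: "finite V" and con: "connected_graph V E" using assms(1) by (auto simp: tree_def graph_def)
  obtain r where "r \<in> V" using assms(1) by (auto simp: tree_def)
  then obtain par dep where "rooted_tree V E r par dep" using tree_rooted[OF assms(1)] by blast
  then interpret rooted_tree V E r par dep .
  have ge: "card V + num_leaves V E + num_support V E \<le> 4 * gamma_2d V E" if "T2 V E S P" for S P
    using T2_gamma[OF that con] .
  show ?thesis
  proof (cases "3 \<le> card V")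
    case True
    have le: "4 * gamma_2d V E \<le> card V + num_leaves V E + num_support V E"
      using gamma_2d_bound(1)[OF con True] .
    moreover have "\<exists>S P. T2 V E S P" if "4 * gamma_2d V E = card V + num_leaves V E + num_support V E"
      using gamma_2d_bound(2)[OF con True that] T2_of_tight[OF assms(1) True] by blast
    ultimately show ?thesis using ge by fastforce
  next
    case False
    \<comment> \<open>For a single edge one vertex dominates while the numerator is 6. The
      inequality is strict, and by \<open>ge\<close> the tree then has no labelling in the
      family.\<close>
    then have "card V = 2" using assms(2) by simp
    then obtain a b where ab: "V = {a, b}" "a \<noteq> b" by (auto simp: card_2_iff)
    have nbr: "\<exists>u. (v, u) \<in> E \<and> u \<in> V \<and> u \<noteq> v" if "v \<in> V" for v
      using ex_nbr[OF assms(2) that] edge_in(2) edge_neq by metis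
    then have e: "(a, b) \<in> E" "(b, a) \<in> E" using ab by auto
    have "leaf E a" "leaf E b"
      using leafI[OF e(1)] leafI[OF e(2)] edge_in(2) no_loop ab(1) by (metis insertE singletonD)+
    then have "{v \<in> V. leaf E v} = V" "{v \<in> V. support E v} = V" using ab(1) e by (auto simp: support_def)
    then have "num_leaves V E = 2" "num_support V E = 2"
      using \<open>card V = 2\<close> by (simp_all add: num_leaves_def num_support_def)
    moreover have "gamma_2d V E \<le> card {a}"
      using ab e by (intro gamma_2d_le[OF fin con]) (auto intro: dominated_self dominated_nbr)
    ultimately have lt: "4 * gamma_2d V E < card V + num_leaves V E + num_support V E"
      using \<open>card V = 2\<close> by simp
    then have "\<not> (\<exists>S P. T2 V E S P)" using ge by (meson not_less)
    then show ?thesis using lt by simp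
  qed
qed

end
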